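(* Let $d,a,b_1,\dots,b_n,c$ be positive integers with $d\mid q-1$ and let $\lambda_1,\dots,\lambda_n\in\kappa^\times$. Let $C_{D,\lambda}$ (where, for $C_{D,\lambda}$, the $\lambda_i$ are assumed distinct and different from $1$) and $S_{D,\lambda}$ be the affine varieties over $\kappa$ defined by $$C_{D,\lambda}:\ y^d=\Big(\prod_{i=1}^n(1-\lambda_ix)^{b_i}\Big)x^a(1-x)^c,\qquad S_{D,\lambda}:\ y^d=\Big(1-\sum_{i=1}^n\lambda_ix_i\Big)^a\Big(\prod_{i=1}^nx_i^{b_i}\Big)\Big(1-\sum_{i=1}^nx_i\Big)^c,$$ with $\mu_d$ acting by multiplication on $y$. For $m\in\mathbb{Z}/d\mathbb{Z}$ and $r\ge1$ define functions over $\kappa_r$ by $$f_r(\lambda)=F_D^{(n)}\left({\varphi_{d,r}^{ma};\overline{\varphi_{d,r}}^{mb_1},\dots,\overline{\varphi_{d,r}}^{mb_n}\atop\varphi_{d,r}^{m(c+a)}};\lambda_1,\dots,\lambda_n\right),\qquad g_r(\lambda)=F_D^{(n)}\left({\overline{\varphi_{d,r}}^{ma};\varphi_{d,r}^{mb_1},\dots,\varphi_{d,r}^{mb_n}\atop\varphi_{d,r}^{m(b_1+\cdots+b_n+c)}};\lambda_1,\dots,\lambda_n\right).$$ (i) Suppose that $\gcd(d,c)=\gcd(d,b_i)=1$ for all $i$. Then $$L(C_{D,\lambda},\chi^m;t)=\begin{cases}\dfrac{1}{1-qt}&(m=0),\\ \exp\Big(\sum_{r=1}^\infty j(\varphi_d^{ma},\varphi_d^{mc})^rf_r(\lambda)\dfrac{t^r}{r}\Big)^{-1}&(m\neq0).\end{cases}$$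 (ii) Suppose that $\gcd(d,a)=\gcd(d,c)=1$. Then $$L(S_{D,\lambda},\chi^m;t)=\begin{cases}\dfrac{1}{1-q^nt}&(m=0),\\ \exp\Big(\sum_{r=1}^\infty J_D^r\cdot g_r(\lambda)\dfrac{t^r}{r}\Big)^{(-1)^n}&(m\neq0),\end{cases}$$ where $J_D=j(\varphi_d^{mb_1},\dots,\varphi_d^{mb_n},\varphi_d^{mc})$.
   Context: $\kappa$ is a finite field with $q$ elements of characteristic $p$. $\widehat{\kappa^\times}=\mathrm{Hom}(\kappa^\times,\overline{\mathbb{Q}}^\times)$ is the group of multiplicative characters, $\varepsilon$ the trivial character, $\overline{\eta}=\eta^{-1}$; every $\eta\in\widehat{\kappa^\times}$ (including $\varepsilon$) is extended to $\kappa$ by $\eta(0)=0$. $\delta(\eta)=1$ if $\eta=\varepsilon$ and $0$ otherwise. Fix a non-trivial additive character $\psi\in\mathrm{Hom}(\kappa,\overline{\mathbb{Q}}^\times)$. Put $$g(\eta)=-\sum_{x\in\kappa^\times}\psi(x)\eta(x),\quad g^\circ(\eta)=q^{\delta(\eta)}g(\eta),\quad j(\eta_1,\dots,\eta_k)=(-1)^{k-1}\sum_{x_i\in\kappa^\times,\ x_1+\cdots+x_k=1}\ \prod_{i=1}^k\eta_i(x_i)\ (k\ge 2),$$ $$(\alpha)_\nu=\frac{g(\alpha\nu)}{g(\alpha)},\qquad(\alpha)_\nu^\circ=\frac{g^\circ(\alpha\nu)}{g^\circ(\alpha)},$$ $$F_D^{(n)}\left({\alpha;\beta_1,\dots,\beta_n\atop\gamma};\lambda_1,\dots,\lambda_n\right)=\frac{1}{(1-q)^n}\sum_{\nu_1,\dots,\nu_n\in\widehat{\kappa^\times}}\frac{(\alpha)_{\nu_1\cdots\nu_n}(\beta_1)_{\nu_1}\cdots(\beta_n)_{\nu_n}}{(\gamma)^\circ_{\nu_1\cdots\nu_n}(\varepsilon)^\circ_{\nu_1}\cdots(\varepsilon)^\circ_{\nu_n}}\nu_1(\lambda_1)\cdots\nu_n(\lambda_n).$$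 $\kappa_r\subset\overline{\kappa}$ is the degree $r$ extension of $\kappa$; functions over $\kappa_r$ are defined by the same formulas with $\kappa,q$ replaced by $\kappa_r,q^r$ and with any non-trivial additive character of $\kappa_r$ (the values of $F_D^{(n)}$ do not depend on this choice). $\mu_d\subset\kappa^\times$ is the group of $d$th roots of unity. Fix a generator $\varphi$ of $\widehat{\kappa^\times}$ and put $\varphi_d=\varphi^{(q-1)/d}$, $\chi=\varphi|_{\mu_d}$ (so $\widehat{\mu_d}=\{\chi^m\mid m\in\mathbb{Z}/d\mathbb{Z}\}$) and $\varphi_{d,r}=\varphi_d\circ N_{\kappa_r/\kappa}\in\widehat{\kappa_r^\times}$, where $N_{\kappa_r/\kappa}$ is the norm map. For a variety $V$ over $\kappa$ with an action over $\kappa$ of a finite abelian group $G$, with $F$ the $q$-Frobenius on $V(\overline{\kappa})$, and for $\theta\in\mathrm{Hom}(G,\overline{\mathbb{Q}}^\times)$, $$N_r(V;\theta)=\frac{1}{\#G}\sum_{g\in G}\theta(g)\,\#\{x\in V(\overline{\kappa})\mid F^r(x)=g(x)\},\qquad L(V,\theta;t)=\exp\Big(\sum_{r=1}^\infty\frac{N_r(V;\theta)}{r}t^r\Big)\in\overline{\mathbb{Q}}[[t]].$$ *)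

theory Defs
  imports
    "HOL-Algebra.Algebraic_Closure_Type"
    "HOL-Computational_Algebra.Computational_Algebra"
    "HOL-Library.FuncSet"
    "HOL-Library.Cardinality"
begin

type_synonym qbar = "rat alg_closure"

text \<open>
  The definitions up to \<open>lauricella_FD\<close> are relative to a finite subfield \<open>K\<close> of a field
  \<open>'f\<close>. A multiplicative character of \<open>K\<close> is represented by its extension by zero to all
  of \<open>'f\<close>, so that distinct elements of \<open>mult_chars K\<close> are distinct homomorphisms
  from the group of units of \<open>K\<close>. Products of characters are pointwise products.
\<close>

definition mult_chars :: "'f::field set \<Rightarrow> ('f \<Rightarrow> qbar) set" where
  "mult_chars K = {\<eta>. (\<forall>x\<in>K - {0}. \<eta> x \<noteq> 0) \<and>
                       (\<forall>x\<in>K - {0}. \<forall>y\<in>K - {0}. \<eta> (x * y) = \<eta> x * \<eta> y) \<and>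
                       (\<forall>x. x \<notin> K - {0} \<longrightarrow> \<eta> x = 0)}"

definition triv_char :: "'f::field set \<Rightarrow> 'f \<Rightarrow> qbar" where
  "triv_char K = (\<lambda>x. if x \<in> K - {0} then 1 else 0)"

definition char_mult :: "('f \<Rightarrow> qbar) \<Rightarrow> ('f \<Rightarrow> qbar) \<Rightarrow> 'f \<Rightarrow> qbar" where
  "char_mult \<eta> \<nu> = (\<lambda>x. \<eta> x * \<nu> x)"

definition char_inv :: "('f \<Rightarrow> qbar) \<Rightarrow> 'f \<Rightarrow> qbar" where
  "char_inv \<eta> = (\<lambda>x. inverse (\<eta> x))"

text \<open>
  The case distinction is needed for the exponent \<open>0\<close>: the power must be the trivial
  character, which vanishes at \<open>0\<close>, whereas \<open>0 powi 0 = 1\<close>.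
\<close>

definition char_pow :: "'f::field set \<Rightarrow> ('f \<Rightarrow> qbar) \<Rightarrow> int \<Rightarrow> 'f \<Rightarrow> qbar" where
  "char_pow K \<eta> k = (\<lambda>x. if x \<in> K - {0} then \<eta> x powi k else 0)"

definition nontriv_add_char :: "'f::field set \<Rightarrow> ('f \<Rightarrow> qbar) \<Rightarrow> bool" where
  "nontriv_add_char K \<psi> \<longleftrightarrow>
     (\<forall>x\<in>K. \<psi> x \<noteq> 0) \<and> (\<forall>x\<in>K. \<forall>y\<in>K. \<psi> (x + y) = \<psi> x * \<psi> y) \<and> (\<exists>x\<in>K. \<psi> x \<noteq> 1)"

definition char_delta :: "'f::field set \<Rightarrow> ('f \<Rightarrow> qbar) \<Rightarrow> nat" where
  "char_delta K \<eta> = (if \<eta> = triv_char K then 1 else 0)"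

definition gauss_sum :: "'f::field set \<Rightarrow> ('f \<Rightarrow> qbar) \<Rightarrow> ('f \<Rightarrow> qbar) \<Rightarrow> qbar" where
  "gauss_sum K \<psi> \<eta> = - (\<Sum>x\<in>K - {0}. \<psi> x * \<eta> x)"

definition gauss_sum_circ :: "'f::field set \<Rightarrow> ('f \<Rightarrow> qbar) \<Rightarrow> ('f \<Rightarrow> qbar) \<Rightarrow> qbar" where
  "gauss_sum_circ K \<psi> \<eta> = of_nat (card K) ^ char_delta K \<eta> * gauss_sum K \<psi> \<eta>"

text \<open>\<open>jacobi_sum K k \<eta>\<close> is $j(\eta_1,\dots,\eta_k)$; only \<open>\<eta> 1, \<dots>, \<eta> k\<close> are relevant.\<close>

definition jacobi_sum :: "'f::field set \<Rightarrow> nat \<Rightarrow> (nat \<Rightarrow> 'f \<Rightarrow> qbar) \<Rightarrow> qbar" where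
  "jacobi_sum K k \<eta> =
     (-1) ^ (k - 1) * (\<Sum>x | x \<in> ({1..k} \<rightarrow>\<^sub>E K - {0}) \<and> (\<Sum>i=1..k. x i) = 1. \<Prod>i=1..k. \<eta> i (x i))"

definition poch :: "'f::field set \<Rightarrow> ('f \<Rightarrow> qbar) \<Rightarrow> ('f \<Rightarrow> qbar) \<Rightarrow> ('f \<Rightarrow> qbar) \<Rightarrow> qbar" where
  "poch K \<psi> \<alpha> \<nu> = gauss_sum K \<psi> (char_mult \<alpha> \<nu>) / gauss_sum K \<psi> \<alpha>"

definition poch_circ :: "'f::field set \<Rightarrow> ('f \<Rightarrow> qbar) \<Rightarrow> ('f \<Rightarrow> qbar) \<Rightarrow> ('f \<Rightarrow> qbar) \<Rightarrow> qbar" where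
  "poch_circ K \<psi> \<alpha> \<nu> = gauss_sum_circ K \<psi> (char_mult \<alpha> \<nu>) / gauss_sum_circ K \<psi> \<alpha>"

definition lauricella_FD ::
  "'f::field set \<Rightarrow> ('f \<Rightarrow> qbar) \<Rightarrow> nat \<Rightarrow> ('f \<Rightarrow> qbar) \<Rightarrow> (nat \<Rightarrow> 'f \<Rightarrow> qbar) \<Rightarrow> ('f \<Rightarrow> qbar)
     \<Rightarrow> (nat \<Rightarrow> 'f) \<Rightarrow> qbar" where
  "lauricella_FD K \<psi> n \<alpha> \<beta> \<gamma> l =
     1 / (1 - of_nat (card K)) ^ n *
     (\<Sum>\<nu>\<in>{1..n} \<rightarrow>\<^sub>E mult_chars K.
        poch K \<psi> \<alpha> (\<lambda>x. \<Prod>i=1..n. \<nu> i x) * (\<Prod>i=1..n. poch K \<psi> (\<beta> i) (\<nu> i)) /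
        (poch_circ K \<psi> \<gamma> (\<lambda>x. \<Prod>i=1..n. \<nu> i x) *
           (\<Prod>i=1..n. poch_circ K \<psi> (triv_char K) (\<nu> i))) *
        (\<Prod>i=1..n. \<nu> i (l i)))"

text \<open>
  The base field is the type \<open>'a\<close>, with \<open>q = CARD('a)\<close>. Its extension of degree \<open>r\<close> inside
  the algebraic closure is the fixed field of the \<open>r\<close>-th power of the \<open>q\<close>-Frobenius, and the
  norm is the product over the Galois group, which is generated by the \<open>q\<close>-Frobenius.
\<close>

definition ext_field :: "nat \<Rightarrow> 'a::finite_field alg_closure set" where
  "ext_field r = {x. x ^ (CARD('a) ^ r) = x}"

definition ext_norm :: "nat \<Rightarrow> 'a::finite_field alg_closure \<Rightarrow> 'a" where
  "ext_norm r x = of_ac (\<Prod>i<r. x ^ (CARD('a) ^ i))"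

definition char_d :: "('a::finite_field \<Rightarrow> qbar) \<Rightarrow> nat \<Rightarrow> 'a \<Rightarrow> qbar" where
  "char_d \<phi> d = char_pow UNIV \<phi> (int ((CARD('a) - 1) div d))"

definition char_d_ext :: "('a::finite_field \<Rightarrow> qbar) \<Rightarrow> nat \<Rightarrow> nat \<Rightarrow> 'a alg_closure \<Rightarrow> qbar" where
  "char_d_ext \<phi> d r = (\<lambda>x. if x \<in> ext_field r then char_d \<phi> d (ext_norm r x) else 0)"

definition is_char_generator :: "('a::finite_field \<Rightarrow> qbar) \<Rightarrow> bool" where
  "is_char_generator \<phi> \<longleftrightarrow>
     \<phi> \<in> mult_chars UNIV \<and> (\<forall>\<eta>\<in>mult_chars UNIV. \<exists>k. \<eta> = char_pow UNIV \<phi> k)"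

text \<open>\<open>exp_series c\<close> is $\exp(\sum_{r\ge 1} c_r t^r/r)$; the value \<open>c 0\<close> is irrelevant.\<close>

definition exp_series :: "(nat \<Rightarrow> qbar) \<Rightarrow> qbar fps" where
  "exp_series c = fps_exp 1 oo Abs_fps (\<lambda>r. if r = 0 then 0 else c r / of_nat r)"

text \<open>
  A variety is given by its set \<open>V\<close> of geometric points, with the Frobenius \<open>F\<close> and the action
  \<open>act\<close> of the finite group \<open>G\<close> on these points.
\<close>

definition twisted_count ::
  "'x set \<Rightarrow> ('x \<Rightarrow> 'x) \<Rightarrow> 'g set \<Rightarrow> ('g \<Rightarrow> 'x \<Rightarrow> 'x) \<Rightarrow> ('g \<Rightarrow> qbar) \<Rightarrow> nat \<Rightarrow> qbar" where
  "twisted_count V F G act \<theta> r =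
     1 / of_nat (card G) * (\<Sum>g\<in>G. \<theta> g * of_nat (card {x\<in>V. (F ^^ r) x = act g x}))"

definition L_fun ::
  "'x set \<Rightarrow> ('x \<Rightarrow> 'x) \<Rightarrow> 'g set \<Rightarrow> ('g \<Rightarrow> 'x \<Rightarrow> 'x) \<Rightarrow> ('g \<Rightarrow> qbar) \<Rightarrow> qbar fps" where
  "L_fun V F G act \<theta> = exp_series (twisted_count V F G act \<theta>)"

definition mu :: "nat \<Rightarrow> 'a::finite_field set" where
  "mu d = {z. z ^ d = 1}"

definition mu_act :: "'a::finite_field \<Rightarrow> 'x \<times> 'a alg_closure \<Rightarrow> 'x \<times> 'a alg_closure" where
  "mu_act z = (\<lambda>(x, y). (x, to_ac z * y))"

definition mu_char :: "('a::finite_field \<Rightarrow> qbar) \<Rightarrow> int \<Rightarrow> 'a \<Rightarrow> qbar" where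
  "mu_char \<phi> m = (\<lambda>z. \<phi> z powi m)"

definition curve_C ::
  "nat \<Rightarrow> nat \<Rightarrow> nat \<Rightarrow> (nat \<Rightarrow> nat) \<Rightarrow> nat \<Rightarrow> (nat \<Rightarrow> 'a::finite_field)
     \<Rightarrow> ('a alg_closure \<times> 'a alg_closure) set" where
  "curve_C n d a b c l =
     {(x, y). y ^ d = (\<Prod>i=1..n. (1 - to_ac (l i) * x) ^ b i) * x ^ a * (1 - x) ^ c}"

definition frob_C ::
  "'a::finite_field alg_closure \<times> 'a alg_closure \<Rightarrow> 'a alg_closure \<times> 'a alg_closure" where
  "frob_C = (\<lambda>(x, y). (x ^ CARD('a), y ^ CARD('a)))"

text \<open>Points of affine \<open>n\<close>-space are extensional functions on \<open>{1..n}\<close>.\<close>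

definition hypersurface_S ::
  "nat \<Rightarrow> nat \<Rightarrow> nat \<Rightarrow> (nat \<Rightarrow> nat) \<Rightarrow> nat \<Rightarrow> (nat \<Rightarrow> 'a::finite_field)
     \<Rightarrow> ((nat \<Rightarrow> 'a alg_closure) \<times> 'a alg_closure) set" where
  "hypersurface_S n d a b c l =
     {(x, y). x \<in> ({1..n} \<rightarrow>\<^sub>E UNIV) \<and>
        y ^ d = (1 - (\<Sum>i=1..n. to_ac (l i) * x i)) ^ a * (\<Prod>i=1..n. x i ^ b i) *
                (1 - (\<Sum>i=1..n. x i)) ^ c}"

definition frob_S ::
  "nat \<Rightarrow> (nat \<Rightarrow> 'a::finite_field alg_closure) \<times> 'a alg_closure
     \<Rightarrow> (nat \<Rightarrow> 'a alg_closure) \<times> 'a alg_closure" where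
  "frob_S n = (\<lambda>(x, y). (\<lambda>i\<in>{1..n}. x i ^ CARD('a), y ^ CARD('a)))"

end

theory Submission
  imports Defs
begin

text \<open>
  Counting over \<open>\<kappa>\<^sub>r\<close>, the point count twisted by \<open>\<chi>\<^sup>m\<close> of a cyclic cover \<open>y\<^sup>d = f(x)\<close> is the character sum
  of \<open>\<phi>\<^sub>d\<^sub>,\<^sub>r\<^sup>m(f(x))\<close> over the points \<open>x\<close> of the base with coordinates in \<open>\<kappa>\<^sub>r\<close>, if \<open>d\<close> does not divide \<open>m\<close>,
  and the number of these points otherwise (\<open>twisted_count_cyclic_cover\<close>): above \<open>x\<close> with
  \<open>f(x) \<noteq> 0\<close> the \<open>q\<^sup>r\<close>-Frobenius multiplies every \<open>d\<close>-th root of \<open>f(x)\<close> by the same element of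
  \<open>\<mu>\<^sub>d\<close>, a power of the norm of \<open>f(x)\<close>. The second case gives the geometric series.

  In the first case the character sum is a finite analogue of the Euler integral of the Lauricella
  function. The proof of the analogue follows the classical one. The reciprocals of the symbols
  \<open>(\<epsilon>)\<degree>\<close> are, up to normalisation, the coefficients of an additive character in the basis of
  multiplicative characters (\<open>exponential_expansion\<close>), as the reciprocals of factorials are those of the exponential
  function. Inserting this into the Gauss sum that defines \<open>(\<alpha>)\<close> yields the multinomial theorem
  (\<open>multinomial_theorem\<close>). For the curve, the quotient of the symbols of \<open>\<alpha>\<close> and \<open>\<gamma>\<close> is a
  quotient of Jacobi sums, hence a sum over \<open>x\<close>, and the multinomial theorem with one variable sums
  the series in every \<open>\<nu>\<^sub>i\<close> separately (\<open>FD_curve_integral\<close>). For the hypersurface the symbols of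
  \<open>\<beta>\<^sub>1, \<dots>, \<beta>\<^sub>n\<close> and \<open>\<gamma>\<close> combine into Jacobi sums with \<open>n + 1\<close> characters, and the multinomial
  theorem with \<open>n\<close> variables sums the series (\<open>FD_hypersurface_integral\<close>).

  The factor in front of the Lauricella function obtained in this way is a Jacobi sum over \<open>\<kappa>\<^sub>r\<close>.
  It is the \<open>r\<close>-th power of the one over \<open>\<kappa>\<close> by the relation of Hasse and Davenport
  (\<open>hasse_davenport_jacobi\<close>). That relation is proved by counting monic polynomials over \<open>\<kappa>\<close>,
  represented by their multisets of roots, with the weight \<open>\<eta>\<close>(product of the roots)
  \<open>\<psi>\<close>(sum of the roots): the logarithmic derivative of the Euler product turns into the recursion
  \<open>weighted_recursion\<close>, and the weights of all polynomials of a given degree \<open>k \<ge> 2\<close> add up to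
  zero (\<open>mset_sum_ge_2\<close>).
\<close>

section \<open>Roots of separable polynomials\<close>

lemma proots_prod_linear:
  fixes A :: "'k::field multiset"
  shows "proots (\<Prod>x\<in>#A. [:-x, 1:]) = A"
proof (induction A)
  case (add x A)
  have "[:-x, 1:] * (\<Prod>x\<in>#A. [:-x, 1:]) \<noteq> 0"
    by (auto simp: prod_mset_zero_iff simp del: mult_pCons_left)
  thus ?case
    using add by (simp add: proots_mult del: mult_pCons_left)
qed simp

lemma card_roots_separable:
  fixes p :: "'k::alg_closed_field poly"
  assumes "\<And>a. poly p a = 0 \<Longrightarrow> poly (pderiv p) a \<noteq> 0"
  shows "card {x. poly p x = 0} = degree p"
proof -
  have nz: "p \<noteq> 0"
    using assms[of 0] by (intro notI) simp
  have order_le: "order x p \<le> 1" if "poly p x = 0" for x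
  proof (rule ccontr)
    assume "\<not> order x p \<le> 1"
    hence "[:-x, 1:] ^ 2 dvd p"
      by (intro dvd_trans[OF le_imp_power_dvd order_1]) simp
    then obtain r where r: "p = [:-x, 1:] ^ 2 * r" ..
    have "poly (pderiv p) x = 0"
      unfolding r power2_eq_square mult.assoc pderiv_mult by simp
    thus False using assms[OF that] by simp
  qed
  obtain A where A: "size A = degree p" "p = smult (lead_coeff p) (\<Prod>x\<in>#A. [:-x, 1:])"
    using alg_closed_imp_factorization[OF nz] by blast
  have "proots p = proots (\<Prod>x\<in>#A. [:-x, 1:])"
    using nz by (subst A(2)) simp
  also have "\<dots> = A"
    by (rule proots_prod_linear)
  finally have size: "size (proots p) = degree p"
    using A by simp
  have "proots p = mset_set {x. poly p x = 0}"
  proof (rule multiset_eqI)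
    fix x
    show "count (proots p) x = count (mset_set {x. poly p x = 0}) x"
      using nz poly_roots_finite[OF nz] order_le[of x] order_root[of p x]
      by (cases "poly p x = 0") auto
  qed
  with size show ?thesis
    by (metis size_mset_set)
qed

lemma card_roots_of_unity:
  fixes N :: nat
  assumes "N \<ge> 1"
  shows "finite {w :: qbar. w ^ N = 1}" "card {w :: qbar. w ^ N = 1} = N"
proof -
  let ?p = "monom 1 N - 1 :: qbar poly"
  have roots: "{w. poly ?p w = 0} = {w :: qbar. w ^ N = 1}"
    by (auto simp: poly_monom)
  have deg: "degree ?p = N"
  proof -
    have "degree (monom 1 N + (-1) :: qbar poly) = degree (monom 1 N :: qbar poly)"
      by (rule degree_add_eq_left) (use assms in \<open>auto simp: degree_monom_eq\<close>)
    thus ?thesis by (simp add: degree_monom_eq)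
  qed
  have "card {w. poly ?p w = 0} = degree ?p"
  proof (rule card_roots_separable)
    fix w assume "poly ?p w = 0"
    hence "w ^ N = 1" by (simp add: poly_monom)
    hence "w \<noteq> 0" using assms by (auto simp: power_0_left)
    thus "poly (pderiv ?p) w \<noteq> 0"
      using assms by (simp add: pderiv_diff pderiv_monom poly_monom)
  qed
  thus "card {w :: qbar. w ^ N = 1} = N" using roots deg by simp
  thus "finite {w :: qbar. w ^ N = 1}" using assms by (intro card_ge_0_finite) simp
qed

lemma power_mod_exponent:
  fixes w :: "'b::monoid_mult"
  assumes "w ^ k = 1"
  shows "w ^ (i mod k) = w ^ i"
proof -
  have "w ^ i = w ^ (k * (i div k) + i mod k)" by simp
  also have "\<dots> = w ^ (i mod k)" by (simp only: power_add power_mult assms power_one mult_1_left)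
  finally show ?thesis ..
qed

section \<open>Finite subfields and their multiplicative characters\<close>

text \<open>
  Both a whole finite type and a finite set \<open>ext_field r\<close> inside an infinite field have to be
  covered.
\<close>
locale finite_subfield =
  fixes K :: "'f::field set"
  assumes finite_K [simp, intro]: "finite K"
    and zero_in [simp, intro]: "0 \<in> K"
    and one_in [simp, intro]: "1 \<in> K"
    and add_in [simp, intro]: "\<And>x y. x \<in> K \<Longrightarrow> y \<in> K \<Longrightarrow> x + y \<in> K"
    and uminus_in [simp, intro]: "\<And>x. x \<in> K \<Longrightarrow> - x \<in> K"
    and mult_in [simp, intro]: "\<And>x y. x \<in> K \<Longrightarrow> y \<in> K \<Longrightarrow> x * y \<in> K"
    and inverse_in [simp, intro]: "\<And>x. x \<in> K \<Longrightarrow> inverse x \<in> K"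
begin

abbreviation N :: nat where "N \<equiv> card K - 1"

lemma diff_in [simp, intro]: "x \<in> K \<Longrightarrow> y \<in> K \<Longrightarrow> x - y \<in> K"
  using add_in[of x "- y"] by simp

lemma divide_in [simp, intro]: "x \<in> K \<Longrightarrow> y \<in> K \<Longrightarrow> x / y \<in> K"
  by (simp add: field_class.field_divide_inverse)

lemma power_in [simp, intro]: "x \<in> K \<Longrightarrow> x ^ k \<in> K"
  by (induction k) auto

lemma sum_in [simp, intro]: "(\<And>i. i \<in> I \<Longrightarrow> f i \<in> K) \<Longrightarrow> sum f I \<in> K"
  by (induction I rule: infinite_finite_induct) auto

lemma prod_in [simp, intro]: "(\<And>i. i \<in> I \<Longrightarrow> f i \<in> K) \<Longrightarrow> prod f I \<in> K"
  by (induction I rule: infinite_finite_induct) auto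

lemma card_ge_2: "card K \<ge> 2"
  using card_mono[of K "{0, 1}"] by simp

lemma N_pos: "N \<ge> 1"
  using card_ge_2 by simp

lemma of_nat_N: "of_nat N = (of_nat (card K) - 1 :: qbar)"
  using card_ge_2 by (simp add: of_nat_diff)

lemma of_nat_N_nz: "of_nat (card K) - 1 \<noteq> (0 :: qbar)" "1 - of_nat (card K) \<noteq> (0 :: qbar)"
  using N_pos of_nat_N of_nat_eq_0_iff[of N, where ?'a = qbar] by (auto simp del: of_nat_eq_0_iff)

lemma bij_betw_units_mult:
  assumes "t \<in> K - {0}"
  shows "bij_betw (\<lambda>x. t * x) (K - {0}) (K - {0})"
  by (rule bij_betwI[where g = "\<lambda>x. inverse t * x"]) (use assms in auto)

lemma sum_units_scale:
  assumes "t \<in> K - {0}"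
  shows "(\<Sum>x\<in>K - {0}. f (t * x)) = (\<Sum>x\<in>K - {0}. f x)"
  using sum.reindex_bij_betw[OF bij_betw_units_mult[OF assms]] .

lemma power_N:
  assumes "x \<in> K - {0}"
  shows "x ^ N = 1"
proof -
  let ?P = "\<Prod>y\<in>K - {0}. y"
  have "?P = (\<Prod>y\<in>K - {0}. x * y)"
    using prod.reindex_bij_betw[OF bij_betw_units_mult[OF assms], of "\<lambda>y. y"] by simp
  also have "\<dots> = x ^ N * ?P"
    by (simp add: prod.distrib)
  finally show ?thesis
    by simp
qed

text \<open>
  Cyclicity of the units of a finite field, transferred from the field structure with carrier \<open>K\<close>.
\<close>
lemma ex_generator: "\<exists>h\<in>K - {0}. K - {0} = range (\<lambda>i::nat. h ^ i)"
proof -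
  define R :: "'f ring" where
    "R = \<lparr>carrier = K, monoid.mult = (*), one = 1, ring.zero = 0, add = (+)\<rparr>"
  have "Ring.field R"
  proof (rule Ring.cring.cring_fieldI2)
    show "cring R"
    proof (rule cringI)
      show "abelian_group R"
        by (rule abelian_groupI) (auto simp: R_def algebra_simps intro!: bexI[of _ "- x" for x])
      show "comm_monoid R"
        by (rule comm_monoidI) (auto simp: R_def algebra_simps)
    qed (auto simp: R_def algebra_simps)
  next
    fix a assume "a \<in> carrier R" "a \<noteq> \<zero>\<^bsub>R\<^esub>"
    thus "\<exists>b\<in>carrier R. a \<otimes>\<^bsub>R\<^esub> b = \<one>\<^bsub>R\<^esub>"
      by (intro bexI[of _ "inverse a"]) (auto simp: R_def)
  qed (auto simp: R_def)
  then interpret R: Ring.field R .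
  have pow: "x [^]\<^bsub>R\<^esub> i = x ^ i" for x and i :: nat
    by (induction i) (auto simp: R_def nat_pow_def)
  obtain h where "h \<in> carrier (mult_of R)" "carrier (mult_of R) = {h [^]\<^bsub>R\<^esub> i |i::nat. i \<in> UNIV}"
    using R.finite_field_mult_group_has_gen by (auto simp: R_def)
  thus ?thesis
    unfolding pow by (intro bexI[of _ h]) (auto simp: R_def)
qed

definition gen :: 'f where
  "gen = (SOME h. h \<in> K - {0} \<and> K - {0} = range (\<lambda>i::nat. h ^ i))"

lemma gen_in: "gen \<in> K - {0}" and range_gen: "K - {0} = range (\<lambda>i::nat. gen ^ i)"
proof -
  have "\<exists>h. h \<in> K - {0} \<and> K - {0} = range (\<lambda>i::nat. h ^ i)"
    using ex_generator unfolding Bex_def .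
  from someI_ex[OF this] have *: "gen \<in> K - {0} \<and> K - {0} = range (\<lambda>i::nat. gen ^ i)"
    unfolding gen_def .
  from * show "gen \<in> K - {0}" by (rule conjunct1)
  from * show "K - {0} = range (\<lambda>i::nat. gen ^ i)" by (rule conjunct2)
qed

lemma gen_powerE:
  assumes "x \<in> K - {0}"
  obtains i :: nat where "x = gen ^ i"
  using assms unfolding range_gen by (elim rangeE)

lemma gen_power_mod: "gen ^ i = gen ^ (i mod N)"
  by (rule power_mod_exponent[symmetric]) (rule power_N[OF gen_in])

lemma gen_power_eq_1_iff: "gen ^ i = 1 \<longleftrightarrow> N dvd i"
proof
  assume i: "gen ^ i = 1"
  show "N dvd i"
  proof (rule ccontr)
    assume nd: "\<not> N dvd i"
    define r where "r = i mod N"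
    have r: "0 < r" "r < N" "gen ^ r = 1"
      using nd N_pos i gen_power_mod[of i] unfolding r_def by (auto simp: dvd_eq_mod_eq_0)
    have "gen ^ j = gen ^ (j mod r)" for j
      by (rule power_mod_exponent[symmetric]) (rule r(3))
    moreover have "j mod r < r" for j using r by simp
    ultimately have "K - {0} \<subseteq> (\<lambda>i. gen ^ i) ` {..<r}"
      unfolding range_gen by blast
    hence "card (K - {0}) \<le> card ((\<lambda>i. gen ^ i) ` {..<r})"
      by (intro card_mono) auto
    also have "\<dots> \<le> r" using card_image_le[of "{..<r}" "\<lambda>i. gen ^ i"] by simp
    finally show False using r by simp
  qed
next
  assume "N dvd i"
  thus "gen ^ i = 1" using power_N[OF gen_in] by (auto simp: power_mult)
qed

lemma gen_power_eq_iff: "gen ^ i = gen ^ j \<longleftrightarrow> i mod N = j mod N"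
proof
  have *: "i mod N = j mod N" if "gen ^ i = gen ^ j" "i \<le> j" for i j
  proof -
    have "gen ^ i * gen ^ (j - i) = gen ^ (i + (j - i))" by (rule power_add[symmetric])
    also have "\<dots> = gen ^ i * 1" using that by simp
    finally have "gen ^ i * gen ^ (j - i) = gen ^ i * 1" .
    hence "gen ^ (j - i) = 1" using gen_in by simp
    hence "N dvd j - i" by (simp add: gen_power_eq_1_iff)
    thus ?thesis using that(2) mod_eq_dvd_iff_nat[of i j N] by simp
  qed
  show "i mod N = j mod N" if "gen ^ i = gen ^ j"
  proof (cases "i \<le> j")
    case True
    show ?thesis by (rule *[OF that True])
  next
    case False
    show ?thesis by (rule *[OF that[symmetric], symmetric]) (use False in simp)
  qed
next
  assume "i mod N = j mod N"
  thus "gen ^ i = gen ^ j" using gen_power_mod[of i] gen_power_mod[of j] by simp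
qed

lemma mult_char_0: "\<eta> \<in> mult_chars K \<Longrightarrow> x \<notin> K - {0} \<Longrightarrow> \<eta> x = 0"
  by (auto simp: mult_chars_def)

lemma mult_char_zero [simp]: "\<eta> \<in> mult_chars K \<Longrightarrow> \<eta> 0 = 0"
  by (auto simp: mult_chars_def)

lemma mult_char_nz: "\<eta> \<in> mult_chars K \<Longrightarrow> x \<in> K - {0} \<Longrightarrow> \<eta> x \<noteq> 0"
  by (auto simp: mult_chars_def)

lemma mult_char_mult: "\<eta> \<in> mult_chars K \<Longrightarrow> x \<in> K \<Longrightarrow> y \<in> K \<Longrightarrow> \<eta> (x * y) = \<eta> x * \<eta> y"
  by (cases "x = 0"; cases "y = 0") (auto simp: mult_chars_def)

lemma mult_char_one [simp]:
  assumes "\<eta> \<in> mult_chars K" shows "\<eta> 1 = 1"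
  using mult_char_mult[OF assms, of 1 1] mult_char_nz[OF assms, of 1] by simp

lemma mult_char_inverse:
  assumes "\<eta> \<in> mult_chars K" "x \<in> K" shows "\<eta> (inverse x) = inverse (\<eta> x)"
proof (cases "x = 0")
  case False
  have "\<eta> (inverse x) * \<eta> x = \<eta> (inverse x * x)"
    using assms by (simp add: mult_char_mult)
  also have "\<dots> = 1" using False assms(1) by simp
  finally show ?thesis by (metis inverse_unique mult.commute)
qed (use assms in auto)

lemma mult_char_divide:
  assumes "\<eta> \<in> mult_chars K" "x \<in> K" "y \<in> K" shows "\<eta> (x / y) = \<eta> x / \<eta> y"
  using assms by (simp add: field_class.field_divide_inverse mult_char_mult mult_char_inverse)

lemma mult_char_power:
  assumes "\<eta> \<in> mult_chars K" "x \<in> K" shows "\<eta> (x ^ k) = \<eta> x ^ k"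
  using assms by (induction k) (auto simp: mult_char_mult)

lemma mult_char_minus_one_sq:
  assumes "\<eta> \<in> mult_chars K" shows "\<eta> (- 1) * \<eta> (- 1) = 1"
  using mult_char_mult[OF assms, of "-1" "-1"] assms by simp

lemma mult_char_gen_power_N: "\<eta> \<in> mult_chars K \<Longrightarrow> \<eta> gen ^ N = 1"
  using mult_char_power[of \<eta> gen N] gen_in power_N[OF gen_in] by auto

lemma mult_char_eqI:
  assumes "\<eta> \<in> mult_chars K" "\<nu> \<in> mult_chars K" "\<eta> gen = \<nu> gen"
  shows "\<eta> = \<nu>"
proof
  fix x
  show "\<eta> x = \<nu> x"
  proof (cases "x \<in> K - {0}")
    case True
    then obtain i where "x = gen ^ i" by (rule gen_powerE)
    thus ?thesis using assms gen_in by (simp add: mult_char_power)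
  qed (use assms in \<open>auto simp: mult_char_0\<close>)
qed

text \<open>
  The character is a power of \<open>w\<close> given by a discrete logarithm to the base \<open>gen\<close>; the choice of
  the logarithm does not matter, as it is determined modulo \<open>N\<close>.
\<close>
lemma ex_mult_char:
  assumes w: "w ^ N = 1"
  shows "\<exists>\<eta>\<in>mult_chars K. \<eta> gen = w"
proof -
  define lg where "lg = (\<lambda>x. SOME i::nat. gen ^ i = x)"
  have lg: "gen ^ lg x = x" if x: "x \<in> K - {0}" for x
  proof -
    obtain i where "gen ^ i = x" using gen_powerE[OF x] by metis
    thus ?thesis unfolding lg_def by (rule someI)
  qed
  have w_mod: "w ^ i = w ^ (i mod N)" for i
    by (rule power_mod_exponent[symmetric]) (rule w)
  have w_cong: "w ^ i = w ^ j" if "gen ^ i = gen ^ j" for i j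
    using that w_mod[of i] w_mod[of j] by (simp add: gen_power_eq_iff)
  have w_nz: "w \<noteq> 0" using w N_pos by (auto simp: power_0_left split: if_splits)
  define \<eta> where "\<eta> = (\<lambda>x. if x \<in> K - {0} then w ^ lg x else 0)"
  have "\<eta> \<in> mult_chars K"
    unfolding mult_chars_def
  proof (intro CollectI conjI ballI allI impI)
    fix x y assume xy: "x \<in> K - {0}" "y \<in> K - {0}"
    have "gen ^ lg (x * y) = gen ^ (lg x + lg y)"
      using xy by (simp add: lg power_add)
    from w_cong[OF this] show "\<eta> (x * y) = \<eta> x * \<eta> y"
      using xy by (auto simp: \<eta>_def power_add)
  qed (auto simp: \<eta>_def w_nz)
  moreover have "\<eta> gen = w"
    using w_cong[of "lg gen" 1] lg[OF gen_in] gen_in by (simp add: \<eta>_def)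
  ultimately show ?thesis by blast
qed

lemma bij_mult_chars: "bij_betw (\<lambda>\<eta>. \<eta> gen) (mult_chars K) {w. w ^ N = 1}"
  unfolding bij_betw_def
proof
  show "inj_on (\<lambda>\<eta>. \<eta> gen) (mult_chars K)"
    by (intro inj_onI mult_char_eqI)
  show "(\<lambda>\<eta>. \<eta> gen) ` mult_chars K = {w. w ^ N = 1}"
    using ex_mult_char mult_char_gen_power_N by fast
qed

lemma finite_mult_chars [simp]: "finite (mult_chars K)"
  using bij_betw_finite[OF bij_mult_chars] card_roots_of_unity(1)[OF N_pos] by simp

lemma card_mult_chars: "card (mult_chars K) = N"
  using bij_betw_same_card[OF bij_mult_chars] card_roots_of_unity(2)[OF N_pos] by simp

text \<open>
  For \<open>x = gen ^ i\<close>, if every character were trivial at \<open>x\<close>, all \<open>N\<close> of the \<open>N\<close>-th roots of unity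
  would be roots of unity of the smaller order \<open>gcd i N\<close>.
\<close>
lemma mult_chars_separate:
  assumes x: "x \<in> K - {0}" "x \<noteq> 1"
  shows "\<exists>\<eta>\<in>mult_chars K. \<eta> x \<noteq> 1"
proof (rule ccontr)
  assume "\<not> ?thesis"
  hence all: "\<eta> x = 1" if "\<eta> \<in> mult_chars K" for \<eta> using that by auto
  obtain i where i: "x = gen ^ i" using x(1) by (rule gen_powerE)
  hence nd: "\<not> N dvd i" using x gen_power_eq_1_iff by auto
  hence "i > 0" by (auto intro!: Nat.gr0I)
  define e where "e = gcd i N"
  have e: "e \<ge> 1" "e < N"
    using N_pos nd gcd_le2_nat[of N i] by (auto simp: e_def order_less_le Suc_le_eq)
      (metis gcd_nat.cobounded1)
  have "w ^ e = 1" if w: "w ^ N = 1" for w :: qbar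
  proof -
    obtain \<eta> where \<eta>: "\<eta> \<in> mult_chars K" "\<eta> gen = w" using ex_mult_char[OF w] by auto
    have "w ^ i = 1" using all[OF \<eta>(1)] \<eta> gen_in by (simp add: i mult_char_power)
    obtain u v where uv: "i * u = N * v + e"
      using bezout_nat[of i N] \<open>i > 0\<close> unfolding e_def by auto
    have "w ^ (i * u) = w ^ (N * v) * w ^ e" by (simp add: uv power_add)
    thus ?thesis using \<open>w ^ i = 1\<close> w by (simp add: power_mult)
  qed
  hence "{w :: qbar. w ^ N = 1} \<subseteq> {w. w ^ e = 1}" by auto
  from card_mono[OF card_roots_of_unity(1)[OF e(1)] this] have "N \<le> e"
    using card_roots_of_unity(2)[OF e(1)] card_roots_of_unity(2)[OF N_pos] by simp
  thus False using e by simp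
qed

lemma triv_char_in [simp, intro]: "triv_char K \<in> mult_chars K"
  by (auto simp: mult_chars_def triv_char_def)

lemma char_mult_in [simp, intro]:
  "\<eta> \<in> mult_chars K \<Longrightarrow> \<nu> \<in> mult_chars K \<Longrightarrow> char_mult \<eta> \<nu> \<in> mult_chars K"
  by (auto simp: mult_chars_def char_mult_def)

lemma char_inv_in [simp, intro]: "\<eta> \<in> mult_chars K \<Longrightarrow> char_inv \<eta> \<in> mult_chars K"
  by (auto simp: mult_chars_def char_inv_def)

lemma char_pow_in [simp, intro]: "\<eta> \<in> mult_chars K \<Longrightarrow> char_pow K \<eta> k \<in> mult_chars K"
  by (auto simp: mult_chars_def char_pow_def power_int_mult_distrib)

lemma char_prod_in:
  assumes "finite I" "I \<noteq> {}" "\<And>i. i \<in> I \<Longrightarrow> \<nu> i \<in> mult_chars K"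
  shows "(\<lambda>x. \<Prod>i\<in>I. \<nu> i x) \<in> mult_chars K"
  using assms by (auto simp: mult_chars_def prod.distrib intro!: prod_zero)

lemma char_mult_triv [simp]:
  "\<eta> \<in> mult_chars K \<Longrightarrow> char_mult \<eta> (triv_char K) = \<eta>"
  "\<eta> \<in> mult_chars K \<Longrightarrow> char_mult (triv_char K) \<eta> = \<eta>"
  by (auto simp: char_mult_def triv_char_def mult_char_0)

lemma char_inv_eq_triv_iff: "\<eta> \<in> mult_chars K \<Longrightarrow> char_inv \<eta> = triv_char K \<longleftrightarrow> \<eta> = triv_char K"
proof
  assume "char_inv \<eta> = triv_char K"
  hence "inverse (\<eta> x) = triv_char K x" for x by (auto simp: char_inv_def dest: fun_cong)
  hence "\<eta> x = inverse (triv_char K x)" for x by (metis inverse_inverse_eq)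
  thus "\<eta> = triv_char K" by (auto simp: triv_char_def fun_eq_iff)
qed (auto simp: char_inv_def triv_char_def fun_eq_iff)

lemma nontriv_witness:
  assumes "\<eta> \<in> mult_chars K" "\<eta> \<noteq> triv_char K"
  obtains t where "t \<in> K - {0}" "\<eta> t \<noteq> 1"
proof -
  obtain x where x: "\<eta> x \<noteq> triv_char K x" using assms(2) by (auto simp: fun_eq_iff)
  have "x \<in> K - {0}"
  proof (rule ccontr)
    assume "x \<notin> K - {0}"
    with x mult_char_0[OF assms(1) this] show False by (auto simp: triv_char_def split: if_splits)
  qed
  with x that show ?thesis by (auto simp: triv_char_def)
qed

text \<open>
  In this and the dual orthogonality relation below, the sum is invariant under multiplication by a
  value different from \<open>1\<close>.
\<close>
lemma sum_mult_char:
  assumes "\<eta> \<in> mult_chars K"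
  shows "(\<Sum>x\<in>K - {0}. \<eta> x) = (if \<eta> = triv_char K then of_nat (card K) - 1 else 0)"
proof (cases "\<eta> = triv_char K")
  case True
  thus ?thesis using of_nat_N by (simp add: triv_char_def)
next
  case False
  then obtain t where t: "t \<in> K - {0}" "\<eta> t \<noteq> 1" using assms nontriv_witness by blast
  have "(\<Sum>x\<in>K - {0}. \<eta> x) = (\<Sum>x\<in>K - {0}. \<eta> (t * x))"
    by (simp only: sum_units_scale[OF t(1)])
  also have "\<dots> = \<eta> t * (\<Sum>x\<in>K - {0}. \<eta> x)"
    unfolding sum_distrib_left using t(1) assms by (intro sum.cong) (auto simp: mult_char_mult)
  finally show ?thesis using t(2) False by simp
qed

lemma sum_over_chars:
  assumes "x \<in> K - {0}"
  shows "(\<Sum>\<nu>\<in>mult_chars K. \<nu> x) = (if x = 1 then of_nat (card K) - 1 else 0)"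
proof (cases "x = 1")
  case True
  thus ?thesis using of_nat_N by (simp add: card_mult_chars)
next
  case False
  then obtain \<eta> where \<eta>: "\<eta> \<in> mult_chars K" "\<eta> x \<noteq> 1" using assms mult_chars_separate by blast
  have cancel: "inverse (\<eta> y) * (\<eta> y * \<nu> y) = \<nu> y" "\<eta> y * (inverse (\<eta> y) * \<nu> y) = \<nu> y"
    if "\<nu> \<in> mult_chars K" for \<nu> y
    using mult_char_0[OF that, of y] mult_char_nz[OF \<eta>(1), of y]
    by (cases "y \<in> K - {0}"; simp)+
  have "bij_betw (char_mult \<eta>) (mult_chars K) (mult_chars K)"
  proof (rule bij_betwI[where g = "char_mult (char_inv \<eta>)"])
    show "char_mult \<eta> \<in> mult_chars K \<rightarrow> mult_chars K"
         "char_mult (char_inv \<eta>) \<in> mult_chars K \<rightarrow> mult_chars K"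
      using \<eta>(1) by auto
  qed (simp_all add: char_mult_def char_inv_def cancel)
  hence "(\<Sum>\<nu>\<in>mult_chars K. \<nu> x) = (\<Sum>\<nu>\<in>mult_chars K. char_mult \<eta> \<nu> x)"
    by (simp add: sum.reindex_bij_betw[of "char_mult \<eta>" _ _ "\<lambda>\<nu>. \<nu> x"])
  also have "\<dots> = \<eta> x * (\<Sum>\<nu>\<in>mult_chars K. \<nu> x)"
    by (simp add: char_mult_def sum_distrib_left)
  finally show ?thesis using \<eta>(2) False by simp
qed

end

section \<open>Gauss and Jacobi sums\<close>

locale gauss_field = finite_subfield K for K :: "'f::field set" +
  fixes \<psi> :: "'f \<Rightarrow> qbar"
  assumes psi: "nontriv_add_char K \<psi>"
begin

abbreviation q :: qbar where "q \<equiv> of_nat (card K)"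
abbreviation g :: "('f \<Rightarrow> qbar) \<Rightarrow> qbar" where "g \<equiv> gauss_sum K \<psi>"
abbreviation gc :: "('f \<Rightarrow> qbar) \<Rightarrow> qbar" where "gc \<equiv> gauss_sum_circ K \<psi>"

lemma psi_nz: "x \<in> K \<Longrightarrow> \<psi> x \<noteq> 0"
  and psi_add: "x \<in> K \<Longrightarrow> y \<in> K \<Longrightarrow> \<psi> (x + y) = \<psi> x * \<psi> y"
  using psi by (auto simp: nontriv_add_char_def)

lemma psi_0 [simp]: "\<psi> 0 = 1"
  using psi_add[of 0 0] psi_nz[of 0] by simp

lemma psi_sum: "(\<And>i. i \<in> I \<Longrightarrow> f i \<in> K) \<Longrightarrow> \<psi> (sum f I) = (\<Prod>i\<in>I. \<psi> (f i))"
  by (induction I rule: infinite_finite_induct) (auto simp: psi_add)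

lemma q_nz: "q \<noteq> 0"
  unfolding of_nat_eq_0_iff using card_ge_2 by linarith

lemma sum_units: "(\<Sum>x\<in>K - {0}. f x) = (\<Sum>x\<in>K. f x) - (f 0 :: qbar)"
  by (simp add: sum_diff1)

lemma sum_psi: "(\<Sum>x\<in>K. \<psi> x) = 0"
proof -
  obtain t where t: "t \<in> K" "\<psi> t \<noteq> 1"
    using psi by (auto simp: nontriv_add_char_def)
  have "(\<Sum>x\<in>K. \<psi> x) = (\<Sum>x\<in>K. \<psi> (t + x))"
    by (rule sum.reindex_bij_witness[of _ "\<lambda>x. t + x" "\<lambda>x. x - t"]) (use t in auto)
  also have "\<dots> = \<psi> t * (\<Sum>x\<in>K. \<psi> x)"
    unfolding sum_distrib_left using t by (intro sum.cong) (auto simp: psi_add)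
  finally show ?thesis using t(2) by simp
qed

lemma sum_psi_scaled:
  assumes "s \<in> K"
  shows "(\<Sum>x\<in>K - {0}. \<psi> (x * s)) = (if s = 0 then q - 1 else - 1)"
proof (cases "s = 0")
  case True
  thus ?thesis using of_nat_N by simp
next
  case False
  have "(\<Sum>x\<in>K - {0}. \<psi> (x * s)) = (\<Sum>x\<in>K - {0}. \<psi> x)"
    using sum_units_scale[of s \<psi>] assms False by (simp add: mult.commute)
  also have "\<dots> = - 1" by (simp only: sum_units sum_psi psi_0 diff_0)
  finally show ?thesis using False by simp
qed

lemma gauss_triv [simp]: "g (triv_char K) = 1"
proof -
  have "(\<Sum>x\<in>K - {0}. \<psi> x * triv_char K x) = (\<Sum>x\<in>K - {0}. \<psi> (x * 1))"
    by (intro sum.cong) (auto simp: triv_char_def)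
  also have "\<dots> = - 1" by (subst sum_psi_scaled) auto
  finally show ?thesis by (simp add: gauss_sum_def)
qed

lemma gauss_circ_triv: "gc (triv_char K) = q"
  by (simp add: gauss_sum_circ_def char_delta_def)

lemma gauss_circ_nontriv: "\<eta> \<noteq> triv_char K \<Longrightarrow> gc \<eta> = g \<eta>"
  by (simp add: gauss_sum_circ_def char_delta_def)

text \<open>
  Replace \<open>x\<close> by \<open>x / s\<close>. For \<open>s = 0\<close> both sides vanish, the right one because \<open>inverse 0 = 0\<close>;
  this is where \<open>\<eta>\<close> has to be non-trivial.
\<close>
lemma gauss_twisted:
  assumes "\<eta> \<in> mult_chars K" "\<eta> \<noteq> triv_char K" "s \<in> K"
  shows "(\<Sum>x\<in>K - {0}. \<psi> (x * s) * \<eta> x) = - (inverse (\<eta> s) * g \<eta>)"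
proof (cases "s = 0")
  case True
  thus ?thesis using assms sum_mult_char[OF assms(1)] by simp
next
  case False
  hence s: "s \<in> K - {0}" using assms by simp
  have "(\<Sum>x\<in>K - {0}. \<psi> x * \<eta> x) = (\<Sum>x\<in>K - {0}. \<psi> (s * x) * \<eta> (s * x))"
    by (rule sum_units_scale[OF s, symmetric])
  also have "\<dots> = \<eta> s * (\<Sum>x\<in>K - {0}. \<psi> (x * s) * \<eta> x)"
    unfolding sum_distrib_left
    by (intro sum.cong) (use s assms in \<open>auto simp: mult_char_mult mult_ac\<close>)
  finally show ?thesis
    using mult_char_nz[OF assms(1) s] by (simp add: gauss_sum_def field_simps)
qed

text \<open>
  The analogue of Euler's reflection formula. The factor \<open>q\<close> in \<open>gc\<close> makes it hold for the trivial
  character as well, and it shows that Gauss sums do not vanish.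
\<close>
lemma gauss_reflection:
  assumes \<eta>: "\<eta> \<in> mult_chars K"
  shows "g (char_inv \<eta>) * gc \<eta> = \<eta> (- 1) * q"
proof (cases "\<eta> = triv_char K")
  case True
  hence "char_inv \<eta> = triv_char K" using char_inv_eq_triv_iff[OF \<eta>] by simp
  moreover have "\<eta> (- 1) = 1" by (simp add: True triv_char_def)
  ultimately show ?thesis using True gauss_circ_triv by simp
next
  case False
  hence inv: "char_inv \<eta> \<noteq> triv_char K" "char_inv \<eta> \<in> mult_chars K"
    using \<eta> char_inv_eq_triv_iff by auto
  have "g (char_inv \<eta>) * g \<eta> = (\<Sum>y\<in>K - {0}. \<psi> y * \<eta> y) * - g (char_inv \<eta>)"
    by (simp add: gauss_sum_def[of K \<psi> \<eta>])
  also have "\<dots> = (\<Sum>y\<in>K - {0}. \<psi> y * \<eta> y * - g (char_inv \<eta>))"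
    by (rule sum_distrib_right)
  also have "\<dots> = (\<Sum>y\<in>K - {0}. \<psi> y * (\<Sum>x\<in>K - {0}. \<psi> (x * y) * char_inv \<eta> x))"
    using gauss_twisted[OF inv(2,1)] by (intro sum.cong) (auto simp: char_inv_def)
  also have "\<dots> = (\<Sum>x\<in>K - {0}. char_inv \<eta> x * (\<Sum>y\<in>K - {0}. \<psi> (y * (1 + x))))"
    unfolding sum_distrib_left
    by (subst sum.swap) (auto intro!: sum.cong simp: psi_add distrib_left mult_ac)
  also have "\<dots> = (\<Sum>x\<in>K - {0}. (if x = - 1 then char_inv \<eta> x * q else 0) - char_inv \<eta> x)"
  proof (intro sum.cong refl)
    fix x assume x: "x \<in> K - {0}"
    have "(\<Sum>y\<in>K - {0}. \<psi> (y * (1 + x))) = (if 1 + x = 0 then q - 1 else - 1)"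
      by (rule sum_psi_scaled) (use x in auto)
    moreover have "1 + x = 0 \<longleftrightarrow> x = - 1" by (auto simp: add_eq_0_iff)
    ultimately have *: "(\<Sum>y\<in>K - {0}. \<psi> (y * (1 + x))) = (if x = - 1 then q else 0) - 1"
      by simp
    show "char_inv \<eta> x * (\<Sum>y\<in>K - {0}. \<psi> (y * (1 + x))) =
          (if x = - 1 then char_inv \<eta> x * q else 0) - char_inv \<eta> x"
      unfolding * by (simp add: right_diff_distrib)
  qed
  also have "\<dots> = char_inv \<eta> (- 1) * q"
    using sum_mult_char[OF inv(2)] inv(1) by (simp add: sum_subtractf)
  also have "char_inv \<eta> (- 1) = \<eta> (- 1)"
    using mult_char_minus_one_sq[OF \<eta>] by (simp add: char_inv_def inverse_unique)
  finally show ?thesis using gauss_circ_nontriv[OF False] by simp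
qed

lemma gauss_circ_nz: "\<eta> \<in> mult_chars K \<Longrightarrow> gc \<eta> \<noteq> 0"
  using gauss_reflection[of \<eta>] q_nz mult_char_nz[of \<eta> "- 1"] by auto

lemma gauss_nz: "\<eta> \<in> mult_chars K \<Longrightarrow> g \<eta> \<noteq> 0"
  using gauss_circ_nz[of \<eta>] by (auto simp: gauss_sum_circ_def)

text \<open>
  Expand the product of Gauss sums and collect the tuples with a given sum \<open>s\<close>. By homogeneity
  the contribution of \<open>s \<noteq> 0\<close> is \<open>\<psi> s\<close> times the product character at \<open>s\<close> times the Jacobi sum;
  that of \<open>s = 0\<close> is determined by the vanishing of the total of all of them without \<open>\<psi>\<close>.
\<close>
lemma jacobi_gauss:
  assumes \<eta>: "\<And>i. i \<in> {1..k} \<Longrightarrow> \<eta> i \<in> mult_chars K"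
    and j: "j \<in> {1..k}" "\<eta> j \<noteq> triv_char K"
  shows "jacobi_sum K k \<eta> * gc (\<lambda>x. \<Prod>i=1..k. \<eta> i x) = (\<Prod>i=1..k. g (\<eta> i))"
proof -
  define P where "P = (\<lambda>x. \<Prod>i=1..k. \<eta> i x)"
  define T where "T = ({1..k} \<rightarrow>\<^sub>E K - {0})"
  define J where "J = (\<lambda>s. \<Sum>x | x \<in> T \<and> (\<Sum>i=1..k. x i) = s. \<Prod>i=1..k. \<eta> i (x i))"
  have P: "P \<in> mult_chars K"
    unfolding P_def using \<eta> j by (intro char_prod_in) auto
  have finT [simp]: "finite T" unfolding T_def by (intro finite_PiE) auto
  have TK: "(\<Sum>i=1..k. x i) \<in> K" if "x \<in> T" for x
    using that by (intro sum_in) (auto simp: T_def)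
  have J_scale: "J s = P s * J 1" if s: "s \<in> K - {0}" for s
  proof -
    have "J s = (\<Sum>x | x \<in> T \<and> (\<Sum>i=1..k. x i) = 1. P s * (\<Prod>i=1..k. \<eta> i (x i)))"
      unfolding J_def
    proof (rule sum.reindex_bij_witness[of _ "\<lambda>x. \<lambda>i\<in>{1..k}. s * x i" "\<lambda>x. \<lambda>i\<in>{1..k}. x i / s"])
      fix x assume x: "x \<in> {x \<in> T. sum x {1..k} = s}"
      show "(\<lambda>i\<in>{1..k}. s * (\<lambda>i\<in>{1..k}. x i / s) i) = x"
        using x s by (auto simp: T_def fun_eq_iff PiE_iff extensional_def)
      show "(\<lambda>i\<in>{1..k}. x i / s) \<in> {x \<in> T. sum x {1..k} = 1}"
        using x s by (auto simp: T_def PiE_iff simp flip: sum_divide_distrib)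
      have "\<eta> i (x i) = \<eta> i s * \<eta> i (x i / s)" if "i \<in> {1..k}" for i
        using \<eta>[OF that] x s that by (subst mult_char_mult[symmetric]) (auto simp: T_def)
      thus "P s * (\<Prod>i=1..k. \<eta> i ((\<lambda>i\<in>{1..k}. x i / s) i)) = (\<Prod>i=1..k. \<eta> i (x i))"
        by (simp add: P_def flip: prod.distrib)
    next
      fix x assume x: "x \<in> {x \<in> T. sum x {1..k} = 1}"
      show "(\<lambda>i\<in>{1..k}. (\<lambda>i\<in>{1..k}. s * x i) i / s) = x"
        using x s by (auto simp: T_def fun_eq_iff PiE_iff extensional_def)
      show "(\<lambda>i\<in>{1..k}. s * x i) \<in> {x \<in> T. sum x {1..k} = s}"
        using x s by (auto simp: T_def PiE_iff simp flip: sum_distrib_left)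
    qed
    thus ?thesis by (simp add: J_def sum_distrib_left)
  qed
  have collect: "(\<Sum>s\<in>K. f s * J s) = (\<Sum>x\<in>T. f (\<Sum>i=1..k. x i) * (\<Prod>i=1..k. \<eta> i (x i)))"
    for f :: "'f \<Rightarrow> qbar"
  proof -
    have "(\<Sum>x\<in>T. f (\<Sum>i=1..k. x i) * (\<Prod>i=1..k. \<eta> i (x i))) =
          (\<Sum>s\<in>K. \<Sum>x | x \<in> T \<and> (\<Sum>i=1..k. x i) = s. f (\<Sum>i=1..k. x i) * (\<Prod>i=1..k. \<eta> i (x i)))"
      by (rule sum.group[symmetric]) (use TK in auto)
    also have "\<dots> = (\<Sum>s\<in>K. f s * J s)"
      unfolding J_def sum_distrib_left by (intro sum.cong) auto
    finally show ?thesis ..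
  qed
  have "(\<Sum>s\<in>K. 1 * J s) = (\<Prod>i=1..k. \<Sum>x\<in>K - {0}. \<eta> i x)"
    unfolding collect by (subst prod_sum_PiE) (auto simp: T_def)
  also have "\<dots> = 0"
    using j sum_mult_char[OF \<eta>[OF j(1)]] by (intro prod_zero) auto
  finally have "J 0 = - (\<Sum>s\<in>K - {0}. J s)"
    by (simp add: sum_units)
  also have "(\<Sum>s\<in>K - {0}. J s) = (\<Sum>s\<in>K - {0}. P s) * J 1"
    unfolding sum_distrib_right by (intro sum.cong refl J_scale)
  finally have J0: "J 0 = - (\<Sum>s\<in>K - {0}. P s) * J 1" by simp
  have "(\<Prod>i=1..k. g (\<eta> i)) = (- 1) ^ k * (\<Prod>i=1..k. \<Sum>x\<in>K - {0}. \<psi> x * \<eta> i x)"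
    unfolding gauss_sum_def prod_uminus by simp
  also have "(\<Prod>i=1..k. \<Sum>x\<in>K - {0}. \<psi> x * \<eta> i x) = (\<Sum>s\<in>K. \<psi> s * J s)"
  proof -
    have "(\<Prod>i=1..k. \<psi> (x i) * \<eta> i (x i)) = \<psi> (\<Sum>i=1..k. x i) * (\<Prod>i=1..k. \<eta> i (x i))"
      if "x \<in> T" for x
      using that by (subst psi_sum) (auto simp: T_def prod.distrib)
    thus ?thesis
      unfolding collect by (subst prod_sum_PiE) (auto simp: T_def intro!: sum.cong)
  qed
  also have "\<dots> = (\<Sum>s\<in>K - {0}. \<psi> s * J s) + J 0"
    by (simp add: sum_units)
  also have "(\<Sum>s\<in>K - {0}. \<psi> s * J s) = (\<Sum>s\<in>K - {0}. \<psi> s * P s * J 1)"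
    by (intro sum.cong refl) (subst J_scale, simp_all)
  also have "\<dots> = - g P * J 1"
    by (simp add: gauss_sum_def sum_distrib_right)
  also have "- g P * J 1 + J 0 = - gc P * J 1"
  proof (cases "P = triv_char K")
    case True
    have S: "(\<Sum>s\<in>K - {0}. P s) = q - 1" using sum_mult_char[OF P] True by simp
    show ?thesis unfolding J0 S by (simp add: True gauss_circ_triv algebra_simps)
  next
    case False
    thus ?thesis using sum_mult_char[OF P] by (simp add: J0 gauss_circ_nontriv)
  qed
  finally have "(\<Prod>i=1..k. g (\<eta> i)) = (- 1) ^ k * (- gc P * J 1)" .
  moreover have "jacobi_sum K k \<eta> = (- 1) ^ (k - 1) * J 1"
    by (simp add: jacobi_sum_def J_def T_def)
  moreover have "k \<ge> 1" using j by auto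
  ultimately show ?thesis
    unfolding P_def[symmetric] by (cases k) auto
qed

lemma jacobi_eq_gauss:
  assumes "\<And>i. i \<in> {1..k} \<Longrightarrow> \<eta> i \<in> mult_chars K" "j \<in> {1..k}" "\<eta> j \<noteq> triv_char K"
  shows "jacobi_sum K k \<eta> = (\<Prod>i=1..k. g (\<eta> i)) / gc (\<lambda>x. \<Prod>i=1..k. \<eta> i x)"
proof -
  have "gc (\<lambda>x. \<Prod>i=1..k. \<eta> i x) \<noteq> 0"
    using assms by (intro gauss_circ_nz char_prod_in) auto
  thus ?thesis using jacobi_gauss[of k \<eta> j] assms by (simp add: field_simps)
qed

end

text \<open>Solving the constraint \<open>x 1 + \<dots> + x (n + 1) = 1\<close> for the last variable.\<close>
lemma (in finite_subfield) jacobi_sum_eliminate_last: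
  assumes \<eta>: "\<And>i. i \<in> {1..n+1} \<Longrightarrow> \<eta> i \<in> mult_chars K"
  shows "jacobi_sum K (n + 1) \<eta> =
           (- 1) ^ n * (\<Sum>x\<in>{1..n} \<rightarrow>\<^sub>E K - {0}. (\<Prod>i=1..n. \<eta> i (x i)) * \<eta> (n + 1) (1 - (\<Sum>i=1..n. x i)))"
proof -
  let ?A = "{x \<in> {1..n+1} \<rightarrow>\<^sub>E K - {0}. (\<Sum>i=1..n+1. x i) = 1}"
  let ?B = "{x \<in> {1..n} \<rightarrow>\<^sub>E K - {0}. 1 - (\<Sum>i=1..n. x i) \<noteq> 0}"
  have ins: "{1..n+1} = insert (n + 1) {1..n}" by auto
  have "(\<Sum>x\<in>?A. \<Prod>i=1..n+1. \<eta> i (x i)) =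
        (\<Sum>x\<in>?B. (\<Prod>i=1..n. \<eta> i (x i)) * \<eta> (n + 1) (1 - (\<Sum>i=1..n. x i)))"
  proof (rule sum.reindex_bij_witness[of _ "\<lambda>x. x(n + 1 := 1 - (\<Sum>i=1..n. x i))" "\<lambda>x. restrict x {1..n}"])
    fix x assume x: "x \<in> ?A"
    hence last: "x (n + 1) = 1 - (\<Sum>i=1..n. x i)" by (simp add: algebra_simps)
    show "(restrict x {1..n})(n + 1 := 1 - (\<Sum>i=1..n. restrict x {1..n} i)) = x"
      using x last by (auto simp: fun_eq_iff PiE_iff extensional_def)
    show "restrict x {1..n} \<in> ?B"
      using x last[symmetric] by (auto simp: PiE_iff)
    show "(\<Prod>i=1..n. \<eta> i (restrict x {1..n} i)) * \<eta> (n + 1) (1 - (\<Sum>i=1..n. restrict x {1..n} i)) =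
          (\<Prod>i=1..n+1. \<eta> i (x i))"
      using last by simp
  next
    fix x assume x: "x \<in> ?B"
    have eq: "(\<Sum>i=1..n. if i = n + 1 then y else x i) = (\<Sum>i=1..n. x i)" for y
      by (intro sum.cong) auto
    have inK: "(\<Sum>i=1..n. x i) \<in> K" using x by (intro sum_in) (auto simp: PiE_iff)
    show "restrict (x(n + 1 := 1 - (\<Sum>i=1..n. x i))) {1..n} = x"
      using x by (auto simp: fun_eq_iff PiE_iff extensional_def)
    show "x(n + 1 := 1 - (\<Sum>i=1..n. x i)) \<in> ?A"
      using x inK by (auto simp: PiE_iff extensional_def eq)
  qed
  also have "\<dots> = (\<Sum>x\<in>{1..n} \<rightarrow>\<^sub>E K - {0}. (\<Prod>i=1..n. \<eta> i (x i)) * \<eta> (n + 1) (1 - (\<Sum>i=1..n. x i)))"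
    by (rule sum.mono_neutral_left) (use \<eta>[of "n + 1"] in \<open>auto intro!: finite_PiE\<close>)
  finally show ?thesis by (simp add: jacobi_sum_def)
qed

lemma sum_PiE_singleton:
  assumes "finite S"
  shows "(\<Sum>x\<in>{Suc 0} \<rightarrow>\<^sub>E S. f (x (Suc 0))) = (\<Sum>y\<in>S. f y :: 'b::comm_semiring_1)"
  using prod_sum_PiE[of "{Suc 0}" "\<lambda>_. S" "\<lambda>_. f"] assms by simp

lemma (in finite_subfield) jacobi_sum_2:
  assumes "\<alpha> \<in> mult_chars K" "\<eta> \<in> mult_chars K"
  shows "jacobi_sum K 2 (\<lambda>i. if i = 1 then \<alpha> else \<eta>) = - (\<Sum>x\<in>K - {0}. \<alpha> x * \<eta> (1 - x))"
proof -
  have "jacobi_sum K (1 + 1) (\<lambda>i. if i = 1 then \<alpha> else \<eta>) =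
          - (\<Sum>x\<in>{Suc 0} \<rightarrow>\<^sub>E K - {0}. \<alpha> (x (Suc 0)) * \<eta> (1 - x (Suc 0)))"
    by (subst jacobi_sum_eliminate_last) (use assms in simp_all)
  also have "\<dots> = - (\<Sum>x\<in>K - {0}. \<alpha> x * \<eta> (1 - x))"
    using sum_PiE_singleton[of "K - {0}" "\<lambda>x. \<alpha> x * \<eta> (1 - x)"] by simp
  finally show ?thesis by (simp only: one_add_one)
qed

section \<open>Finite multinomial theorem and Euler integrals\<close>

context gauss_field
begin

text \<open>
  The reflection formula turns the denominators into numerators, so that the sums over characters
  below become sums of products of Gauss sums.
\<close>
lemma inverse_poch_circ_triv:
  assumes "\<nu> \<in> mult_chars K"
  shows "inverse (poch_circ K \<psi> (triv_char K) \<nu>) = \<nu> (- 1) * g (char_inv \<nu>)"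
proof -
  have "inverse (poch_circ K \<psi> (triv_char K) \<nu>) = q / gc \<nu>"
    using assms by (simp add: poch_circ_def gauss_circ_triv)
  also have "\<dots> = \<nu> (- 1) * (\<nu> (- 1) * q) / gc \<nu>"
    using mult_char_minus_one_sq[OF assms] by (simp flip: mult.assoc)
  also have "\<dots> = \<nu> (- 1) * g (char_inv \<nu>)"
    using gauss_reflection[OF assms] gauss_circ_nz[OF assms] by (simp add: field_simps)
  finally show ?thesis .
qed

text \<open>
  The symbols \<open>(\<epsilon>)\<degree>\<close> play the role of factorials, and this is the exponential series: write the
  Gauss sum in \<open>inverse_poch_circ_triv\<close> as a sum over \<open>y\<close>; then orthogonality singles out \<open>y = - t\<close>.
\<close>
lemma exponential_expansion:
  assumes t: "t \<in> K - {0}"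
  shows "(\<Sum>\<nu>\<in>mult_chars K. inverse (poch_circ K \<psi> (triv_char K) \<nu>) * \<nu> t) = (1 - q) * \<psi> (- t)"
proof -
  have term_eq: "inverse (poch_circ K \<psi> (triv_char K) \<nu>) * \<nu> t = - (\<Sum>y\<in>K - {0}. \<psi> y * \<nu> (- t / y))"
    if \<nu>: "\<nu> \<in> mult_chars K" for \<nu>
  proof -
    have "\<nu> (- t / y) = \<nu> (- 1) * char_inv \<nu> y * \<nu> t" if "y \<in> K - {0}" for y
    proof -
      have "\<nu> (- t / y) = \<nu> ((- 1) * t) / \<nu> y"
        using \<nu> t that by (subst mult_char_divide[symmetric]) auto
      also have "\<nu> ((- 1) * t) = \<nu> (- 1) * \<nu> t"
        using \<nu> t by (intro mult_char_mult) auto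
      finally show ?thesis by (simp add: char_inv_def field_class.field_divide_inverse mult_ac)
    qed
    hence "(\<Sum>y\<in>K - {0}. \<psi> y * \<nu> (- t / y)) = (\<Sum>y\<in>K - {0}. \<nu> (- 1) * (\<psi> y * char_inv \<nu> y) * \<nu> t)"
      by (intro sum.cong) (simp_all add: mult_ac)
    thus ?thesis
      by (simp add: inverse_poch_circ_triv[OF \<nu>] gauss_sum_def sum_distrib_left sum_distrib_right)
  qed
  have "(\<Sum>\<nu>\<in>mult_chars K. inverse (poch_circ K \<psi> (triv_char K) \<nu>) * \<nu> t) =
        - (\<Sum>y\<in>K - {0}. \<psi> y * (\<Sum>\<nu>\<in>mult_chars K. \<nu> (- t / y)))"
    unfolding sum_distrib_left by (subst sum.swap) (simp add: term_eq sum_negf)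
  also have "(\<Sum>y\<in>K - {0}. \<psi> y * (\<Sum>\<nu>\<in>mult_chars K. \<nu> (- t / y))) =
             (\<Sum>y\<in>K - {0}. if y = - t then \<psi> y * (q - 1) else 0)"
  proof (intro sum.cong refl)
    fix y assume y: "y \<in> K - {0}"
    have "- t / y \<in> K - {0}" using y t by auto
    moreover have "- t / y = 1 \<longleftrightarrow> y = - t" using y by (auto simp: field_simps)
    ultimately show "\<psi> y * (\<Sum>\<nu>\<in>mult_chars K. \<nu> (- t / y)) = (if y = - t then \<psi> y * (q - 1) else 0)"
      by (subst sum_over_chars) auto
  qed
  also have "\<dots> = \<psi> (- t) * (q - 1)"
    using t by simp
  finally show ?thesis by (simp add: algebra_simps)
qed

text \<open>
  The analogue of deriving the multinomial series from the integral of
  \<open>exp (- x (1 - \<mu>\<^sub>1 - \<dots> - \<mu>\<^sub>n)) x\<^sup>\<alpha> / x\<close> by expanding the exponentials of the \<open>\<mu>\<^sub>i x\<close>: in the Gauss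
  sum for \<open>(\<alpha>)\<close> the sums over the \<open>\<nu>\<^sub>i\<close> are exponential series in \<open>\<mu>\<^sub>i x\<close>, and what remains is a
  Gauss sum of \<open>\<alpha>\<close> with argument scaled by \<open>1 - \<mu>\<^sub>1 - \<dots> - \<mu>\<^sub>n\<close>. If this factor is zero, then both
  sides vanish.
\<close>
theorem multinomial_theorem:
  assumes \<alpha>: "\<alpha> \<in> mult_chars K" "\<alpha> \<noteq> triv_char K"
    and n: "n \<ge> 1" and \<mu>: "\<And>i. i \<in> {1..n} \<Longrightarrow> \<mu> i \<in> K - {0}"
  shows "1 / (1 - q) ^ n *
          (\<Sum>\<nu>\<in>{1..n} \<rightarrow>\<^sub>E mult_chars K.
             poch K \<psi> \<alpha> (\<lambda>x. \<Prod>i=1..n. \<nu> i x) /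
             (\<Prod>i=1..n. poch_circ K \<psi> (triv_char K) (\<nu> i)) * (\<Prod>i=1..n. \<nu> i (\<mu> i))) =
         inverse (\<alpha> (1 - (\<Sum>i=1..n. \<mu> i)))"
proof -
  let ?s = "1 - (\<Sum>i=1..n. \<mu> i)"
  let ?E = "\<lambda>\<nu> t. inverse (poch_circ K \<psi> (triv_char K) \<nu>) * \<nu> t"
  have sumK: "(\<Sum>i=1..n. \<mu> i) \<in> K" using \<mu> by (intro sum_in) auto
  have term_eq: "poch K \<psi> \<alpha> (\<lambda>x. \<Prod>i=1..n. \<nu> i x) /
             (\<Prod>i=1..n. poch_circ K \<psi> (triv_char K) (\<nu> i)) * (\<Prod>i=1..n. \<nu> i (\<mu> i)) =
        - (1 / g \<alpha>) * (\<Sum>x\<in>K - {0}. \<psi> x * \<alpha> x * (\<Prod>i=1..n. ?E (\<nu> i) (\<mu> i * x)))"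
    if \<nu>: "\<nu> \<in> {1..n} \<rightarrow>\<^sub>E mult_chars K" for \<nu>
  proof -
    have "(\<Prod>i=1..n. ?E (\<nu> i) (\<mu> i * x)) =
          (\<Prod>i=1..n. \<nu> i x) * ((\<Prod>i=1..n. \<nu> i (\<mu> i)) / (\<Prod>i=1..n. poch_circ K \<psi> (triv_char K) (\<nu> i)))"
      if x: "x \<in> K - {0}" for x
    proof -
      have "(\<Prod>i=1..n. ?E (\<nu> i) (\<mu> i * x)) =
            (\<Prod>i=1..n. \<nu> i x * (\<nu> i (\<mu> i) / poch_circ K \<psi> (triv_char K) (\<nu> i)))"
      proof (intro prod.cong refl)
        fix i assume i: "i \<in> {1..n}"
        have "\<nu> i (\<mu> i * x) = \<nu> i (\<mu> i) * \<nu> i x"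
          using \<nu> i x \<mu>[OF i] by (intro mult_char_mult) auto
        thus "?E (\<nu> i) (\<mu> i * x) = \<nu> i x * (\<nu> i (\<mu> i) / poch_circ K \<psi> (triv_char K) (\<nu> i))"
          by (simp add: field_class.field_divide_inverse mult_ac)
      qed
      thus ?thesis by (simp only: prod.distrib prod_dividef)
    qed
    hence *: "(\<Sum>x\<in>K - {0}. \<psi> x * \<alpha> x * (\<Prod>i=1..n. ?E (\<nu> i) (\<mu> i * x))) =
          (\<Sum>x\<in>K - {0}. \<psi> x * char_mult \<alpha> (\<lambda>x. \<Prod>i=1..n. \<nu> i x) x) *
          ((\<Prod>i=1..n. \<nu> i (\<mu> i)) / (\<Prod>i=1..n. poch_circ K \<psi> (triv_char K) (\<nu> i)))"
      unfolding sum_distrib_right by (intro sum.cong) (auto simp: char_mult_def)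
    have **: "poch K \<psi> \<alpha> (\<lambda>x. \<Prod>i=1..n. \<nu> i x) =
        - (\<Sum>x\<in>K - {0}. \<psi> x * char_mult \<alpha> (\<lambda>x. \<Prod>i=1..n. \<nu> i x) x) / g \<alpha>"
      by (simp only: poch_def gauss_sum_def[of K \<psi> "char_mult _ _"])
    show ?thesis
      unfolding * ** by simp
  qed
  have "(\<Sum>\<nu>\<in>{1..n} \<rightarrow>\<^sub>E mult_chars K.
             poch K \<psi> \<alpha> (\<lambda>x. \<Prod>i=1..n. \<nu> i x) /
             (\<Prod>i=1..n. poch_circ K \<psi> (triv_char K) (\<nu> i)) * (\<Prod>i=1..n. \<nu> i (\<mu> i))) =
        - (1 / g \<alpha>) * (\<Sum>\<nu>\<in>{1..n} \<rightarrow>\<^sub>E mult_chars K.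
             \<Sum>x\<in>K - {0}. \<psi> x * \<alpha> x * (\<Prod>i=1..n. ?E (\<nu> i) (\<mu> i * x)))"
    unfolding sum_distrib_left[of "- (1 / g \<alpha>)" _ "{1..n} \<rightarrow>\<^sub>E mult_chars K"]
    by (intro sum.cong refl term_eq)
  also have "(\<Sum>\<nu>\<in>{1..n} \<rightarrow>\<^sub>E mult_chars K.
             \<Sum>x\<in>K - {0}. \<psi> x * \<alpha> x * (\<Prod>i=1..n. ?E (\<nu> i) (\<mu> i * x))) =
        (\<Sum>x\<in>K - {0}. \<psi> x * \<alpha> x * (\<Prod>i=1..n. \<Sum>\<nu>\<in>mult_chars K. ?E \<nu> (\<mu> i * x)))"
    by (subst sum.swap) (simp add: prod_sum_PiE sum_distrib_left)
  also have "\<dots> = (\<Sum>x\<in>K - {0}. (1 - q) ^ n * (\<psi> (x * ?s) * \<alpha> x))"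
  proof (intro sum.cong refl)
    fix x assume x: "x \<in> K - {0}"
    have "(\<Prod>i=1..n. \<Sum>\<nu>\<in>mult_chars K. ?E \<nu> (\<mu> i * x)) = (\<Prod>i=1..n. (1 - q) * \<psi> (- (\<mu> i * x)))"
      by (intro prod.cong refl exponential_expansion) (use x \<mu> in auto)
    also have "\<dots> = (1 - q) ^ n * \<psi> (\<Sum>i=1..n. - (\<mu> i * x))"
      by (subst psi_sum) (use x \<mu> in \<open>auto simp: prod.distrib\<close>)
    finally have "\<psi> x * \<alpha> x * (\<Prod>i=1..n. \<Sum>\<nu>\<in>mult_chars K. ?E \<nu> (\<mu> i * x)) =
        (1 - q) ^ n * (\<psi> x * \<psi> (\<Sum>i=1..n. - (\<mu> i * x)) * \<alpha> x)"
      by simp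
    also have "\<psi> x * \<psi> (\<Sum>i=1..n. - (\<mu> i * x)) = \<psi> (x + (\<Sum>i=1..n. - (\<mu> i * x)))"
      by (rule psi_add[symmetric]) (use x \<mu> in \<open>auto intro!: sum_in\<close>)
    also have "x + (\<Sum>i=1..n. - (\<mu> i * x)) = x * ?s"
      by (simp add: sum_negf sum_distrib_left algebra_simps)
    finally show "\<psi> x * \<alpha> x * (\<Prod>i=1..n. \<Sum>\<nu>\<in>mult_chars K. ?E \<nu> (\<mu> i * x)) =
        (1 - q) ^ n * (\<psi> (x * ?s) * \<alpha> x)" .
  qed
  also have "\<dots> = (1 - q) ^ n * - (inverse (\<alpha> ?s) * g \<alpha>)"
    unfolding sum_distrib_left[symmetric]
    by (subst gauss_twisted[OF \<alpha>]) (use sumK in auto)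
  finally show ?thesis
    using gauss_nz[OF \<alpha>(1)] of_nat_N_nz(2) by simp
qed

corollary binomial_theorem:
  assumes "\<beta> \<in> mult_chars K" "\<beta> \<noteq> triv_char K" "t \<in> K - {0}"
  shows "(\<Sum>\<nu>\<in>mult_chars K. poch K \<psi> \<beta> \<nu> / poch_circ K \<psi> (triv_char K) \<nu> * \<nu> t) =
         (1 - q) * inverse (\<beta> (1 - t))"
proof -
  have "(\<Sum>\<nu>\<in>{Suc 0} \<rightarrow>\<^sub>E mult_chars K. poch K \<psi> \<beta> (\<nu> (Suc 0)) /
           poch_circ K \<psi> (triv_char K) (\<nu> (Suc 0)) * \<nu> (Suc 0) t) / (1 - q) =
         inverse (\<beta> (1 - t))"
    using multinomial_theorem[of \<beta> 1 "\<lambda>_. t"] assms by simp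
  thus ?thesis
    using sum_PiE_singleton[of "mult_chars K"
        "\<lambda>\<nu>. poch K \<psi> \<beta> \<nu> / poch_circ K \<psi> (triv_char K) \<nu> * \<nu> t"] of_nat_N_nz(2)
    by (simp add: field_simps)
qed

text \<open>
  The Jacobi sum of \<open>\<alpha> \<nu>\<close> and \<open>\<eta>\<close> is the Jacobi sum of \<open>\<alpha>\<close> and \<open>\<eta>\<close> times the quotient of the symbols
  of \<open>\<alpha>\<close> and \<open>\<gamma> = \<alpha> \<eta>\<close> at \<open>\<nu>\<close> (a beta integral). Written as a sum over \<open>x\<close>, it turns \<open>\<nu>\<^sub>i(l\<^sub>i)\<close> into
  \<open>\<nu>\<^sub>i(l\<^sub>i x)\<close>, and the sums over the \<open>\<nu>\<^sub>i\<close> separate into binomial series.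
\<close>
theorem FD_curve_integral:
  assumes \<alpha>: "\<alpha> \<in> mult_chars K" and \<eta>: "\<eta> \<in> mult_chars K" "\<eta> \<noteq> triv_char K"
    and \<beta>: "\<And>i. i \<in> {1..n} \<Longrightarrow> \<beta> i \<in> mult_chars K" "\<And>i. i \<in> {1..n} \<Longrightarrow> \<beta> i \<noteq> triv_char K"
    and n: "n \<ge> 1" and l: "\<And>i. i \<in> {1..n} \<Longrightarrow> l i \<in> K - {0}"
  shows "jacobi_sum K 2 (\<lambda>i. if i = 1 then \<alpha> else \<eta>) * lauricella_FD K \<psi> n \<alpha> \<beta> (char_mult \<alpha> \<eta>) l =
         - (\<Sum>x\<in>K - {0}. \<alpha> x * (\<Prod>i=1..n. inverse (\<beta> i (1 - l i * x))) * \<eta> (1 - x))"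
proof -
  let ?J = "\<lambda>\<theta>. jacobi_sum K 2 (\<lambda>i. if i = 1 then \<theta> else \<eta>)"
  let ?\<gamma> = "char_mult \<alpha> \<eta>"
  let ?B = "\<lambda>i \<nu> t. poch K \<psi> (\<beta> i) \<nu> / poch_circ K \<psi> (triv_char K) \<nu> * \<nu> t"
  have J: "?J \<theta> = g \<theta> * g \<eta> / gc (char_mult \<theta> \<eta>)" if "\<theta> \<in> mult_chars K" for \<theta>
    using jacobi_eq_gauss[of 2 "\<lambda>i. if i = 1 then \<theta> else \<eta>" 2] that \<eta>
    by (simp add: numeral_2_eq_2 char_mult_def)
  have ratio: "?J \<alpha> * (poch K \<psi> \<alpha> P / poch_circ K \<psi> ?\<gamma> P) = ?J (char_mult \<alpha> P)"
    if "P \<in> mult_chars K" for P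
  proof -
    have comm: "char_mult (char_mult \<alpha> P) \<eta> = char_mult ?\<gamma> P"
      by (simp add: char_mult_def mult_ac)
    show ?thesis
      unfolding J[OF \<alpha>] J[OF char_mult_in[OF \<alpha> that]] comm poch_def poch_circ_def
      using gauss_nz[OF \<alpha>] gauss_circ_nz[OF char_mult_in[OF \<alpha> \<eta>(1)]] by simp
  qed
  have "?J \<alpha> * lauricella_FD K \<psi> n \<alpha> \<beta> ?\<gamma> l = 1 / (1 - q) ^ n *
      (\<Sum>\<nu>\<in>{1..n} \<rightarrow>\<^sub>E mult_chars K.
        ?J \<alpha> * (poch K \<psi> \<alpha> (\<lambda>x. \<Prod>i=1..n. \<nu> i x) / poch_circ K \<psi> ?\<gamma> (\<lambda>x. \<Prod>i=1..n. \<nu> i x)) *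
        (\<Prod>i=1..n. ?B i (\<nu> i) (l i)))"
    unfolding lauricella_FD_def sum_distrib_left prod.distrib prod_dividef
    by (intro sum.cong refl) simp
  also have "\<dots> = 1 / (1 - q) ^ n *
      (\<Sum>\<nu>\<in>{1..n} \<rightarrow>\<^sub>E mult_chars K.
        \<Sum>x\<in>K - {0}. - (\<alpha> x * \<eta> (1 - x)) * (\<Prod>i=1..n. ?B i (\<nu> i) (l i * x)))"
  proof (intro arg_cong2[of _ _ _ _ "(*)"] sum.cong refl)
    fix \<nu> assume \<nu>: "\<nu> \<in> {1..n} \<rightarrow>\<^sub>E mult_chars K"
    let ?P = "\<lambda>x. \<Prod>i=1..n. \<nu> i x"
    have P: "?P \<in> mult_chars K" using \<nu> n by (intro char_prod_in) auto
    have "?J \<alpha> * (poch K \<psi> \<alpha> ?P / poch_circ K \<psi> ?\<gamma> ?P) = - (\<Sum>x\<in>K - {0}. \<alpha> x * ?P x * \<eta> (1 - x))"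
      using trans[OF ratio[OF P] jacobi_sum_2[OF char_mult_in[OF \<alpha> P] \<eta>(1)]]
      by (simp only: char_mult_def)
    moreover have "?P x * (\<Prod>i=1..n. ?B i (\<nu> i) (l i)) = (\<Prod>i=1..n. ?B i (\<nu> i) (l i * x))"
      if x: "x \<in> K - {0}" for x
      unfolding prod.distrib[symmetric]
    proof (intro prod.cong refl)
      fix i assume i: "i \<in> {1..n}"
      have "\<nu> i (l i * x) = \<nu> i (l i) * \<nu> i x"
        using \<nu> i x l[OF i] by (intro mult_char_mult) auto
      thus "\<nu> i x * ?B i (\<nu> i) (l i) = ?B i (\<nu> i) (l i * x)" by simp
    qed
    ultimately show "?J \<alpha> * (poch K \<psi> \<alpha> ?P / poch_circ K \<psi> ?\<gamma> ?P) * (\<Prod>i=1..n. ?B i (\<nu> i) (l i)) =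
        (\<Sum>x\<in>K - {0}. - (\<alpha> x * \<eta> (1 - x)) * (\<Prod>i=1..n. ?B i (\<nu> i) (l i * x)))"
      by (simp add: sum_distrib_right sum_negf mult_ac)
  qed
  also have "\<dots> = 1 / (1 - q) ^ n *
      (\<Sum>x\<in>K - {0}. - (\<alpha> x * \<eta> (1 - x)) * (\<Prod>i=1..n. \<Sum>\<nu>\<in>mult_chars K. ?B i \<nu> (l i * x)))"
    by (subst sum.swap) (simp add: prod_sum_PiE sum_distrib_left)
  also have "\<dots> = 1 / (1 - q) ^ n *
      (\<Sum>x\<in>K - {0}. - (\<alpha> x * \<eta> (1 - x)) * ((1 - q) ^ n * (\<Prod>i=1..n. inverse (\<beta> i (1 - l i * x)))))"
  proof (intro arg_cong2[of _ _ _ _ "(*)"] sum.cong refl)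
    fix x assume x: "x \<in> K - {0}"
    have "(\<Prod>i=1..n. \<Sum>\<nu>\<in>mult_chars K. ?B i \<nu> (l i * x)) =
          (\<Prod>i=1..n. (1 - q) * inverse (\<beta> i (1 - l i * x)))"
      by (intro prod.cong refl binomial_theorem) (use \<beta> l x in auto)
    also have "\<dots> = (1 - q) ^ n * (\<Prod>i=1..n. inverse (\<beta> i (1 - l i * x)))"
      by (simp add: prod.distrib)
    finally show "(\<Prod>i=1..n. \<Sum>\<nu>\<in>mult_chars K. ?B i \<nu> (l i * x)) =
          (1 - q) ^ n * (\<Prod>i=1..n. inverse (\<beta> i (1 - l i * x)))" .
  qed
  also have "\<dots> = - (\<Sum>x\<in>K - {0}. \<alpha> x * (\<Prod>i=1..n. inverse (\<beta> i (1 - l i * x))) * \<eta> (1 - x))"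
    unfolding sum_distrib_left sum_negf[symmetric]
    by (intro sum.cong refl) (use of_nat_N_nz(2) in simp)
  finally show ?thesis .
qed

text \<open>
  As for the curve, except that now the symbols of \<open>\<beta>\<^sub>1, \<dots>, \<beta>\<^sub>n\<close> and \<open>\<gamma>\<close> are absorbed into a
  Jacobi sum (a Dirichlet integral). What is left is one multinomial series in the \<open>l\<^sub>i x\<^sub>i\<close>, with
  the symbols of \<open>\<alpha>\<close>.
\<close>
theorem FD_hypersurface_integral:
  assumes \<alpha>: "\<alpha> \<in> mult_chars K" "\<alpha> \<noteq> triv_char K" and \<eta>: "\<eta> \<in> mult_chars K" "\<eta> \<noteq> triv_char K"
    and \<beta>: "\<And>i. i \<in> {1..n} \<Longrightarrow> \<beta> i \<in> mult_chars K"
    and n: "n \<ge> 1" and l: "\<And>i. i \<in> {1..n} \<Longrightarrow> l i \<in> K - {0}"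
  shows "jacobi_sum K (n + 1) (\<lambda>i. if i \<le> n then \<beta> i else \<eta>) *
           lauricella_FD K \<psi> n \<alpha> \<beta> (\<lambda>x. (\<Prod>i=1..n. \<beta> i x) * \<eta> x) l =
         (- 1) ^ n * (\<Sum>x\<in>{1..n} \<rightarrow>\<^sub>E K - {0}. inverse (\<alpha> (1 - (\<Sum>i=1..n. l i * x i))) *
           (\<Prod>i=1..n. \<beta> i (x i)) * \<eta> (1 - (\<Sum>i=1..n. x i)))"
proof -
  let ?J = "\<lambda>\<theta>. jacobi_sum K (n + 1) (\<lambda>i. if i \<le> n then \<theta> i else \<eta>)"
  let ?\<gamma> = "\<lambda>x. (\<Prod>i=1..n. \<beta> i x) * \<eta> x"
  let ?D = "\<lambda>\<nu>. \<Prod>i=1..n. poch_circ K \<psi> (triv_char K) (\<nu> i)"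
  have \<gamma>: "?\<gamma> \<in> mult_chars K"
    using char_mult_in[OF char_prod_in \<eta>(1), of "{1..n}" \<beta>] \<beta> n by (auto simp: char_mult_def)
  have J: "?J \<theta> = (\<Prod>i=1..n. g (\<theta> i)) * g \<eta> / gc (\<lambda>x. (\<Prod>i=1..n. \<theta> i x) * \<eta> x)"
    if "\<And>i. i \<in> {1..n} \<Longrightarrow> \<theta> i \<in> mult_chars K" for \<theta>
    using jacobi_eq_gauss[of "n + 1" "\<lambda>i. if i \<le> n then \<theta> i else \<eta>" "n + 1"] that \<eta> by simp
  have ratio: "?J \<beta> * ((\<Prod>i=1..n. poch K \<psi> (\<beta> i) (\<nu> i)) / poch_circ K \<psi> ?\<gamma> (\<lambda>x. \<Prod>i=1..n. \<nu> i x)) =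
      ?J (\<lambda>i. char_mult (\<beta> i) (\<nu> i))"
    if \<nu>: "\<And>i. i \<in> {1..n} \<Longrightarrow> \<nu> i \<in> mult_chars K" for \<nu>
  proof -
    have comm: "(\<lambda>x. (\<Prod>i=1..n. char_mult (\<beta> i) (\<nu> i) x) * \<eta> x) = char_mult ?\<gamma> (\<lambda>x. \<Prod>i=1..n. \<nu> i x)"
      by (simp add: char_mult_def prod.distrib mult_ac)
    have nz: "(\<Prod>i=1..n. g (\<beta> i)) \<noteq> 0" "gc ?\<gamma> \<noteq> 0" "g \<eta> \<noteq> 0"
      using gauss_nz \<beta> \<gamma> \<eta> gauss_circ_nz by auto
    have "?J (\<lambda>i. char_mult (\<beta> i) (\<nu> i)) =
          (\<Prod>i=1..n. g (char_mult (\<beta> i) (\<nu> i))) * g \<eta> / gc (char_mult ?\<gamma> (\<lambda>x. \<Prod>i=1..n. \<nu> i x))"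
      by (rule J[of "\<lambda>i. char_mult (\<beta> i) (\<nu> i)", unfolded comm]) (use \<beta> \<nu> in auto)
    moreover have "?J \<beta> = (\<Prod>i=1..n. g (\<beta> i)) * g \<eta> / gc ?\<gamma>"
      using \<beta> by (rule J)
    ultimately show ?thesis
      using nz by (simp add: poch_def poch_circ_def prod_dividef)
  qed
  have "?J \<beta> * lauricella_FD K \<psi> n \<alpha> \<beta> ?\<gamma> l = 1 / (1 - q) ^ n *
      (\<Sum>\<nu>\<in>{1..n} \<rightarrow>\<^sub>E mult_chars K.
        ?J \<beta> * ((\<Prod>i=1..n. poch K \<psi> (\<beta> i) (\<nu> i)) / poch_circ K \<psi> ?\<gamma> (\<lambda>x. \<Prod>i=1..n. \<nu> i x)) *
        (poch K \<psi> \<alpha> (\<lambda>x. \<Prod>i=1..n. \<nu> i x) / ?D \<nu> * (\<Prod>i=1..n. \<nu> i (l i))))"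
    unfolding lauricella_FD_def sum_distrib_left by (intro sum.cong refl) simp
  also have "\<dots> = 1 / (1 - q) ^ n *
      (\<Sum>\<nu>\<in>{1..n} \<rightarrow>\<^sub>E mult_chars K. \<Sum>x\<in>{1..n} \<rightarrow>\<^sub>E K - {0}.
        (- 1) ^ n * (\<Prod>i=1..n. \<beta> i (x i)) * \<eta> (1 - (\<Sum>i=1..n. x i)) *
        (poch K \<psi> \<alpha> (\<lambda>x. \<Prod>i=1..n. \<nu> i x) / ?D \<nu> * (\<Prod>i=1..n. \<nu> i (l i * x i))))"
  proof (intro arg_cong2[of _ _ _ _ "(*)"] sum.cong refl)
    fix \<nu> assume \<nu>: "\<nu> \<in> {1..n} \<rightarrow>\<^sub>E mult_chars K"
    let ?A = "poch K \<psi> \<alpha> (\<lambda>x. \<Prod>i=1..n. \<nu> i x) / ?D \<nu>"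
    have "?J \<beta> * ((\<Prod>i=1..n. poch K \<psi> (\<beta> i) (\<nu> i)) / poch_circ K \<psi> ?\<gamma> (\<lambda>x. \<Prod>i=1..n. \<nu> i x)) =
          ?J (\<lambda>i. char_mult (\<beta> i) (\<nu> i))"
      using \<nu> by (intro ratio) auto
    also have "\<dots> = (- 1) ^ n * (\<Sum>x\<in>{1..n} \<rightarrow>\<^sub>E K - {0}.
        (\<Prod>i=1..n. \<beta> i (x i)) * (\<Prod>i=1..n. \<nu> i (x i)) * \<eta> (1 - (\<Sum>i=1..n. x i)))"
    proof -
      have "(if i \<le> n then char_mult (\<beta> i) (\<nu> i) else \<eta>) \<in> mult_chars K" if "i \<in> {1..n+1}" for i
        using that PiE_mem[OF \<nu>] \<beta> \<eta> by auto
      from jacobi_sum_eliminate_last[OF this] show ?thesis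
        by (simp add: char_mult_def prod.distrib)
    qed
    finally have 1: "?J \<beta> * ((\<Prod>i=1..n. poch K \<psi> (\<beta> i) (\<nu> i)) / poch_circ K \<psi> ?\<gamma> (\<lambda>x. \<Prod>i=1..n. \<nu> i x)) =
        (- 1) ^ n * (\<Sum>x\<in>{1..n} \<rightarrow>\<^sub>E K - {0}.
        (\<Prod>i=1..n. \<beta> i (x i)) * (\<Prod>i=1..n. \<nu> i (x i)) * \<eta> (1 - (\<Sum>i=1..n. x i)))" .
    have 2: "(\<Prod>i=1..n. \<nu> i (l i * x i)) = (\<Prod>i=1..n. \<nu> i (l i)) * (\<Prod>i=1..n. \<nu> i (x i))"
      if x: "x \<in> {1..n} \<rightarrow>\<^sub>E K - {0}" for x
      unfolding prod.distrib[symmetric]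
      by (intro prod.cong refl mult_char_mult) (use \<nu> l x in auto)
    have "(- 1) ^ n * (\<Prod>i=1..n. \<beta> i (x i)) * \<eta> (1 - (\<Sum>i=1..n. x i)) * (?A * (\<Prod>i=1..n. \<nu> i (l i * x i))) =
          (- 1) ^ n * ((\<Prod>i=1..n. \<beta> i (x i)) * (\<Prod>i=1..n. \<nu> i (x i)) * \<eta> (1 - (\<Sum>i=1..n. x i))) *
          (?A * (\<Prod>i=1..n. \<nu> i (l i)))" if "x \<in> {1..n} \<rightarrow>\<^sub>E K - {0}" for x
      unfolding 2[OF that] by (simp only: mult_ac)
    thus "?J \<beta> * ((\<Prod>i=1..n. poch K \<psi> (\<beta> i) (\<nu> i)) / poch_circ K \<psi> ?\<gamma> (\<lambda>x. \<Prod>i=1..n. \<nu> i x)) *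
        (?A * (\<Prod>i=1..n. \<nu> i (l i))) =
        (\<Sum>x\<in>{1..n} \<rightarrow>\<^sub>E K - {0}. (- 1) ^ n * (\<Prod>i=1..n. \<beta> i (x i)) * \<eta> (1 - (\<Sum>i=1..n. x i)) *
        (?A * (\<Prod>i=1..n. \<nu> i (l i * x i))))"
      unfolding 1 by (simp only: sum_distrib_left sum_distrib_right cong: sum.cong)
  qed
  also have "\<dots> = (\<Sum>x\<in>{1..n} \<rightarrow>\<^sub>E K - {0}.
        (- 1) ^ n * (\<Prod>i=1..n. \<beta> i (x i)) * \<eta> (1 - (\<Sum>i=1..n. x i)) *
        (1 / (1 - q) ^ n * (\<Sum>\<nu>\<in>{1..n} \<rightarrow>\<^sub>E mult_chars K.
          poch K \<psi> \<alpha> (\<lambda>x. \<Prod>i=1..n. \<nu> i x) / ?D \<nu> * (\<Prod>i=1..n. \<nu> i (l i * x i)))))"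
    by (subst sum.swap) (simp add: sum_distrib_left mult_ac)
  also have "\<dots> = (\<Sum>x\<in>{1..n} \<rightarrow>\<^sub>E K - {0}.
        (- 1) ^ n * (\<Prod>i=1..n. \<beta> i (x i)) * \<eta> (1 - (\<Sum>i=1..n. x i)) *
        inverse (\<alpha> (1 - (\<Sum>i=1..n. l i * x i))))"
    by (intro arg_cong2[of _ _ _ _ "(*)"] sum.cong refl multinomial_theorem)
       (use \<alpha> n l in \<open>auto simp: PiE_iff\<close>)
  also have "\<dots> = (- 1) ^ n * (\<Sum>x\<in>{1..n} \<rightarrow>\<^sub>E K - {0}. inverse (\<alpha> (1 - (\<Sum>i=1..n. l i * x i))) *
           (\<Prod>i=1..n. \<beta> i (x i)) * \<eta> (1 - (\<Sum>i=1..n. x i)))"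
    unfolding sum_distrib_left by (intro sum.cong refl) (simp only: mult_ac)
  finally show ?thesis .
qed

end

section \<open>Extensions of a finite field\<close>

lemma finite_subfield_UNIV: "finite_subfield (UNIV :: 'a::finite_field set)"
  by standard auto

lemma CARD_field_ge_2: "CARD('a::finite_field) \<ge> 2"
  using finite_subfield.card_ge_2[OF finite_subfield_UNIV] .

text \<open>
  The polynomial \<open>(X + 1) ^ q - X ^ q - 1\<close> has degree less than \<open>q\<close> and vanishes at all \<open>q\<close>
  elements of the field, so that all its coefficients are zero.
\<close>
lemma of_nat_binomial_CARD_eq_0:
  assumes "0 < k" "k < CARD('a::finite_field)"
  shows "of_nat (CARD('a) choose k) = (0 :: 'a)"
proof -
  let ?q = "CARD('a)"
  let ?p = "(\<Sum>k\<in>{0<..<?q}. monom (of_nat (?q choose k)) k) :: 'a poly"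
  have split: "{..?q} = insert 0 (insert ?q {0<..<?q})" by auto
  have "poly ?p x = 0" for x
  proof -
    have "x + 1 = (x + 1) ^ ?q" by (simp add: finite_field_power_card_eq_same)
    also have "\<dots> = (\<Sum>k\<le>?q. of_nat (?q choose k) * x ^ k)" by (simp add: binomial_ring)
    also have "\<dots> = 1 + (x ^ ?q + poly ?p x)"
      unfolding split using CARD_field_ge_2[where ?'a = 'a] by (simp add: poly_sum poly_monom)
    also have "x ^ ?q = x" by (rule finite_field_power_card_eq_same)
    finally show ?thesis by simp
  qed
  hence roots: "{x. poly ?p x = 0} = UNIV" by auto
  have "?p = 0"
  proof (rule ccontr)
    assume nz: "?p \<noteq> 0"
    have "?q \<le> degree ?p" using card_poly_roots_bound[OF nz] unfolding roots .
    moreover have "degree ?p \<le> ?q - 1"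
    proof (rule degree_sum_le)
      show "degree (monom (of_nat (?q choose k)) k :: 'a poly) \<le> ?q - 1" if "k \<in> {0<..<?q}" for k
        using degree_monom_le[of "of_nat (?q choose k) :: 'a" k] that by (auto intro: order_trans)
    qed auto
    ultimately show False using CARD_field_ge_2[where ?'a = 'a] by simp
  qed
  hence "coeff ?p k = 0" by simp
  moreover have "coeff ?p k = of_nat (?q choose k)"
    using assms by (simp add: coeff_sum if_distrib cong: if_cong)
  ultimately show ?thesis by simp
qed

lemma frob_add: "(x + y :: 'a::finite_field alg_closure) ^ CARD('a) = x ^ CARD('a) + y ^ CARD('a)"
proof -
  let ?q = "CARD('a)"
  have split: "{..?q} = insert 0 (insert ?q {0<..<?q})" by auto
  have zero: "of_nat (?q choose k) = (0 :: 'a alg_closure)" if "k \<in> {0<..<?q}" for k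
    using of_nat_binomial_CARD_eq_0[of k, where ?'a = 'a] that
    by (metis greaterThanLessThan_iff to_ac_0 to_ac_of_nat)
  have "(x + y) ^ ?q = (\<Sum>k\<le>?q. of_nat (?q choose k) * x ^ k * y ^ (?q - k))"
    by (rule binomial_ring)
  also have "\<dots> = y ^ ?q + (x ^ ?q + (\<Sum>k\<in>{0<..<?q}. of_nat (?q choose k) * x ^ k * y ^ (?q - k)))"
    unfolding split using CARD_field_ge_2[where ?'a = 'a] by simp
  also have "(\<Sum>k\<in>{0<..<?q}. of_nat (?q choose k) * x ^ k * y ^ (?q - k)) = 0"
    by (intro sum.neutral ballI) (simp only: zero mult_zero_left)
  finally show ?thesis by simp
qed

lemma frob_pow_add:
  "(x + y :: 'a::finite_field alg_closure) ^ (CARD('a) ^ r) = x ^ (CARD('a) ^ r) + y ^ (CARD('a) ^ r)"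
  by (induction r arbitrary: x y) (simp_all add: power_mult frob_add)

lemma frob_pow_uminus: "(- x :: 'a::finite_field alg_closure) ^ (CARD('a) ^ r) = - (x ^ (CARD('a) ^ r))"
proof -
  have "0 = (x + - x) ^ (CARD('a) ^ r)" by (simp add: power_0_left)
  also have "\<dots> = x ^ (CARD('a) ^ r) + (- x) ^ (CARD('a) ^ r)" by (rule frob_pow_add)
  finally show ?thesis by (metis add_eq_0_iff)
qed

lemma frob_pow_inj:
  assumes "(x :: 'a::finite_field alg_closure) ^ (CARD('a) ^ r) = y ^ (CARD('a) ^ r)"
  shows "x = y"
proof -
  have "(x + - y) ^ (CARD('a) ^ r) = 0"
    unfolding frob_pow_add frob_pow_uminus using assms by simp
  thus ?thesis by simp
qed

lemma frob_inj: "inj (\<lambda>x :: 'a::finite_field alg_closure. x ^ CARD('a))"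
  using frob_pow_inj[where r = 1] by (intro injI) simp

lemma frob_sum: "(sum f I) ^ CARD('a) = (\<Sum>i\<in>I. f i ^ CARD('a) :: 'a::finite_field alg_closure)"
  by (induction I rule: infinite_finite_induct) (simp_all add: frob_add power_0_left)

lemma of_nat_CARD_eq_0: "of_nat (CARD('a::finite_field)) = (0 :: 'a alg_closure)"
proof -
  have "of_nat (CARD('a)) = (0 :: 'a)"
    using of_nat_binomial_CARD_eq_0[of 1, where ?'a = 'a] CARD_field_ge_2[where ?'a = 'a] by simp
  thus ?thesis by (metis to_ac_0 to_ac_of_nat)
qed

text \<open>The polynomial \<open>X ^ (q ^ r) - X\<close> is separable, since its derivative is \<open>- 1\<close>.\<close>
lemma card_ext_field:
  assumes "r \<ge> 1"
  shows "card (ext_field r :: 'a::finite_field alg_closure set) = CARD('a) ^ r"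
proof -
  let ?Q = "CARD('a) ^ r"
  let ?p = "monom 1 ?Q - monom 1 1 :: 'a alg_closure poly"
  have Q: "?Q > 1"
    using CARD_field_ge_2[where ?'a = 'a] assms by (intro one_less_power) auto
  have "degree ?p = ?Q"
  proof -
    have "degree (monom 1 ?Q + - monom 1 1 :: 'a alg_closure poly) = degree (monom 1 ?Q :: 'a alg_closure poly)"
      by (rule degree_add_eq_left) (use Q in \<open>simp add: degree_monom_eq\<close>)
    thus ?thesis by (simp add: degree_monom_eq)
  qed
  moreover have "card {x. poly ?p x = 0} = degree ?p"
  proof (rule card_roots_separable)
    fix x
    have "of_nat ?Q = (0 :: 'a alg_closure)"
      using assms by (simp add: of_nat_CARD_eq_0 power_0_left)
    hence "pderiv ?p = - 1"
      by (simp add: pderiv_diff pderiv_monom monom_0 one_pCons del: of_nat_power)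
    thus "poly (pderiv ?p) x \<noteq> 0" by simp
  qed
  moreover have "{x. poly ?p x = 0} = ext_field r"
    by (auto simp: ext_field_def poly_monom)
  ultimately show ?thesis by simp
qed

lemma finite_ext_field: "r \<ge> 1 \<Longrightarrow> finite (ext_field r :: 'a::finite_field alg_closure set)"
  using card_ext_field[of r, where ?'a = 'a] by (intro card_ge_0_finite) simp

lemma finite_subfield_ext_field:
  assumes "r \<ge> 1"
  shows "finite_subfield (ext_field r :: 'a::finite_field alg_closure set)"
  by standard (use assms finite_ext_field in
    \<open>auto simp: ext_field_def power_0_left power_mult_distrib frob_pow_add frob_pow_uminus power_inverse\<close>)

lemma to_ac_in_ext_field: "to_ac (x :: 'a::finite_field) \<in> ext_field r"
  unfolding ext_field_def by (simp flip: to_ac_power add: finite_field_power_card_power_eq_same)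

lemma ext_field_1: "(ext_field 1 :: 'a::finite_field alg_closure set) = range to_ac"
proof (rule card_subset_eq[symmetric])
  show "card (range to_ac :: 'a alg_closure set) = card (ext_field 1 :: 'a alg_closure set)"
    by (simp add: card_ext_field card_image inj_to_ac)
qed (auto simp: to_ac_in_ext_field finite_ext_field)

lemma to_ac_of_ac_ext_field: "x \<in> ext_field 1 \<Longrightarrow> to_ac (of_ac x) = x"
  unfolding ext_field_1 by (rule to_ac_of_ac)

lemma of_ac_mult: "x \<in> ext_field 1 \<Longrightarrow> y \<in> ext_field 1 \<Longrightarrow> of_ac (x * y) = of_ac x * of_ac y"
  and of_ac_add: "x \<in> ext_field 1 \<Longrightarrow> y \<in> ext_field 1 \<Longrightarrow> of_ac (x + y) = of_ac x + of_ac y"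
  by (rule of_ac_eqI; simp add: to_ac_of_ac_ext_field del: to_ac_eq_iff)+

lemma in_ext_field_1_iff: "x \<in> ext_field 1 \<longleftrightarrow> x ^ CARD('a) = (x :: 'a::finite_field alg_closure)"
  by (simp add: ext_field_def)

subsection \<open>Norm and trace\<close>

definition ext_trace :: "nat \<Rightarrow> 'a::finite_field alg_closure \<Rightarrow> 'a" where
  "ext_trace r x = of_ac (\<Sum>i<r. x ^ (CARD('a) ^ i))"

text \<open>
  The Frobenius permutes the factors cyclically, so that the product lies in the base field and
  \<open>of_ac\<close> does not return its default value \<open>0\<close>.
\<close>
lemma to_ac_ext_norm:
  assumes "x \<in> ext_field r"
  shows "to_ac (ext_norm r x) = (\<Prod>i<r. x ^ (CARD('a::finite_field) ^ i) :: 'a alg_closure)"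
proof -
  have "(\<Prod>i<r. x ^ (CARD('a) ^ i)) ^ CARD('a) * x = (\<Prod>i<Suc r. x ^ (CARD('a) ^ i))"
    by (simp only: prod.lessThan_Suc_shift) (simp add: prod_power_distrib mult.commute flip: power_mult)
  also have "\<dots> = (\<Prod>i<r. x ^ (CARD('a) ^ i)) * x"
    using assms by (simp add: ext_field_def)
  finally have "(\<Prod>i<r. x ^ (CARD('a) ^ i)) \<in> ext_field 1"
    unfolding in_ext_field_1_iff by (cases "x = 0"; cases r) (auto simp: power_0_left)
  thus ?thesis unfolding ext_norm_def by (rule to_ac_of_ac_ext_field)
qed

lemma to_ac_ext_trace:
  assumes "x \<in> ext_field r"
  shows "to_ac (ext_trace r x) = (\<Sum>i<r. x ^ (CARD('a::finite_field) ^ i) :: 'a alg_closure)"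
proof -
  have "(\<Sum>i<r. x ^ (CARD('a) ^ i)) ^ CARD('a) + x = (\<Sum>i<Suc r. x ^ (CARD('a) ^ i))"
    by (simp only: sum.lessThan_Suc_shift) (simp add: frob_sum mult.commute flip: power_mult)
  also have "\<dots> = (\<Sum>i<r. x ^ (CARD('a) ^ i)) + x"
    using assms by (simp add: ext_field_def)
  finally have "(\<Sum>i<r. x ^ (CARD('a) ^ i)) \<in> ext_field 1"
    unfolding in_ext_field_1_iff by simp
  thus ?thesis unfolding ext_trace_def by (rule to_ac_of_ac_ext_field)
qed

lemma ext_norm_mult:
  assumes "x \<in> ext_field r" "y \<in> ext_field r"
  shows "ext_norm r (x * y) = ext_norm r x * ext_norm r (y :: 'a::finite_field alg_closure)"
proof -
  have "x * y \<in> ext_field r" using assms by (simp add: ext_field_def power_mult_distrib)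
  hence "to_ac (ext_norm r (x * y)) = to_ac (ext_norm r x * ext_norm r y)"
    using assms by (simp add: to_ac_ext_norm power_mult_distrib prod.distrib del: to_ac_eq_iff)
  thus ?thesis by (rule injD[OF inj_to_ac])
qed

lemma ext_trace_add:
  assumes "x \<in> ext_field r" "y \<in> ext_field r"
  shows "ext_trace r (x + y) = ext_trace r x + ext_trace r (y :: 'a::finite_field alg_closure)"
proof -
  have "x + y \<in> ext_field r" using assms by (simp add: ext_field_def frob_pow_add)
  hence "to_ac (ext_trace r (x + y)) = to_ac (ext_trace r x + ext_trace r y)"
    using assms by (simp add: to_ac_ext_trace frob_pow_add sum.distrib del: to_ac_eq_iff)
  thus ?thesis by (rule injD[OF inj_to_ac])
qed

lemma ext_norm_eq_0_iff:
  assumes "x \<in> ext_field r" "r \<ge> 1"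
  shows "ext_norm r x = 0 \<longleftrightarrow> (x :: 'a::finite_field alg_closure) = 0"
proof -
  have "ext_norm r x = 0 \<longleftrightarrow> to_ac (ext_norm r x) = 0" by simp
  also have "\<dots> \<longleftrightarrow> x = 0"
    unfolding to_ac_ext_norm[OF assms(1)] using assms(2) by (auto simp: Bex_def intro: exI[of _ 0])
  finally show ?thesis .
qed

lemma sum_CARD_powers: "(\<Sum>i<r. CARD('a::finite_field) ^ i) * (CARD('a) - 1) = CARD('a) ^ r - 1"
proof (induction r)
  case (Suc r)
  have "CARD('a) ^ r \<ge> 1" "CARD('a) \<ge> 1"
    using CARD_field_ge_2[where ?'a = 'a] by auto
  thus ?case using Suc by (simp add: algebra_simps)
qed simp

text \<open>
  A solution of \<open>x ^ (1 + q + \<dots> + q ^ (r - 1)) = u\<close> in the algebraic closure lies in the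
  extension of degree \<open>r\<close>, because \<open>x ^ (q ^ r - 1) = u ^ (q - 1) = 1\<close>.
\<close>
lemma ext_norm_surj:
  assumes "r \<ge> 1" "u \<noteq> (0 :: 'a::finite_field)"
  shows "\<exists>x\<in>ext_field r - {0}. ext_norm r x = u"
proof -
  let ?e = "\<Sum>i<r. CARD('a) ^ i"
  have "CARD('a) ^ 0 \<le> ?e" using assms by (intro member_le_sum) auto
  hence "?e > 0" by simp
  then obtain x where x: "x ^ ?e = to_ac u" using nth_root_exists by blast
  have "x ^ (CARD('a) ^ r - 1) = to_ac u ^ (CARD('a) - 1)"
    by (simp only: sum_CARD_powers[symmetric] power_mult x)
  also have "\<dots> = to_ac (u ^ (CARD('a) - 1))" by simp
  also have "u ^ (CARD('a) - 1) = 1"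
    using finite_subfield.power_N[OF finite_subfield_UNIV, of u] assms by simp
  finally have "x * x ^ (CARD('a) ^ r - 1) = x" by simp
  hence "x ^ Suc (CARD('a) ^ r - 1) = x" by (simp only: power_Suc)
  moreover have "Suc (CARD('a) ^ r - 1) = CARD('a) ^ r"
    by (intro Suc_diff_1) (use CARD_field_ge_2[where ?'a = 'a] in simp)
  ultimately have xin: "x \<in> ext_field r" unfolding ext_field_def by (simp only: mem_Collect_eq)
  have "to_ac (ext_norm r x) = to_ac u"
    unfolding to_ac_ext_norm[OF xin] x[symmetric] by (simp add: power_sum)
  moreover have "x \<noteq> 0"
  proof
    assume "x = 0"
    hence "x ^ ?e = 0" using \<open>?e > 0\<close> by (simp only: zero_power)
    thus False using x assms(2) by simp
  qed
  ultimately show ?thesis using xin by auto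
qed

definition lift_char :: "nat \<Rightarrow> ('a::finite_field \<Rightarrow> qbar) \<Rightarrow> 'a alg_closure \<Rightarrow> qbar" where
  "lift_char r \<eta> = (\<lambda>x. if x \<in> ext_field r then \<eta> (ext_norm r x) else 0)"

definition lift_add_char :: "nat \<Rightarrow> ('a::finite_field \<Rightarrow> qbar) \<Rightarrow> 'a alg_closure \<Rightarrow> qbar" where
  "lift_add_char r \<psi> = (\<lambda>x. \<psi> (ext_trace r x))"

lemma lift_char_in:
  assumes "r \<ge> 1" "\<eta> \<in> mult_chars (UNIV :: 'a::finite_field set)"
  shows "lift_char r \<eta> \<in> mult_chars (ext_field r)"
proof -
  interpret U: finite_subfield "UNIV :: 'a set" by (rule finite_subfield_UNIV)
  interpret K: finite_subfield "ext_field r :: 'a alg_closure set"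
    using assms by (intro finite_subfield_ext_field)
  show ?thesis
    unfolding mult_chars_def
  proof (intro CollectI conjI ballI allI impI)
    fix x :: "'a alg_closure" assume x: "x \<in> ext_field r - {0}"
    hence "ext_norm r x \<noteq> 0" using ext_norm_eq_0_iff assms(1) by blast
    thus "lift_char r \<eta> x \<noteq> 0" using x U.mult_char_nz[OF assms(2)] by (simp add: lift_char_def)
  next
    fix x y :: "'a alg_closure" assume "x \<in> ext_field r - {0}" "y \<in> ext_field r - {0}"
    thus "lift_char r \<eta> (x * y) = lift_char r \<eta> x * lift_char r \<eta> y"
      using assms by (simp add: lift_char_def ext_norm_mult U.mult_char_mult)
  next
    fix x :: "'a alg_closure" assume "x \<notin> ext_field r - {0}"
    moreover have "ext_norm r (0 :: 'a alg_closure) = 0"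
      using ext_norm_eq_0_iff[of "0 :: 'a alg_closure" r] assms(1) by simp
    ultimately show "lift_char r \<eta> x = 0" using assms(2) by (auto simp: lift_char_def)
  qed
qed

lemma lift_char_triv:
  assumes "r \<ge> 1"
  shows "lift_char r (triv_char (UNIV :: 'a::finite_field set)) = triv_char (ext_field r)"
  using assms by (auto simp: lift_char_def triv_char_def fun_eq_iff ext_norm_eq_0_iff)

lemma lift_char_eq_triv_iff:
  assumes "r \<ge> 1" "\<eta> \<in> mult_chars (UNIV :: 'a::finite_field set)"
  shows "lift_char r \<eta> = triv_char (ext_field r) \<longleftrightarrow> \<eta> = triv_char UNIV"
proof
  interpret U: finite_subfield "UNIV :: 'a set" by (rule finite_subfield_UNIV)
  assume triv: "lift_char r \<eta> = triv_char (ext_field r)"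
  show "\<eta> = triv_char UNIV"
  proof
    fix u :: 'a
    show "\<eta> u = triv_char UNIV u"
    proof (cases "u = 0")
      case False
      then obtain x where x: "x \<in> ext_field r - {0}" "ext_norm r x = u"
        using ext_norm_surj assms by blast
      have "\<eta> u = lift_char r \<eta> x" using x by (simp add: lift_char_def)
      also have "\<dots> = 1" unfolding triv using x by (simp add: triv_char_def)
      finally show ?thesis using False by (simp add: triv_char_def)
    qed (use assms in \<open>simp add: triv_char_def\<close>)
  qed
next
  assume "\<eta> = triv_char UNIV"
  thus "lift_char r \<eta> = triv_char (ext_field r)" using lift_char_triv assms by blast
qed

section \<open>The Hasse--Davenport relation\<close>

subsection \<open>Frobenius-invariant multisets\<close>

text \<open>
  These represent the monic polynomials of degree \<open>k\<close> over the base field by their roots.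
  Multiplication of polynomials becomes addition of multisets.
\<close>
definition frob_msets :: "nat \<Rightarrow> 'a::finite_field alg_closure multiset set" where
  "frob_msets k = {M. size M = k \<and> image_mset (\<lambda>x. x ^ CARD('a)) M = M}"

text \<open>The roots of the characteristic polynomial of \<open>x\<close> over the base field.\<close>
definition conjugates :: "nat \<Rightarrow> 'a::finite_field alg_closure \<Rightarrow> 'a alg_closure multiset" where
  "conjugates r x = image_mset (\<lambda>i. x ^ (CARD('a) ^ i)) (mset_set {..<r})"

lemma size_conjugates [simp]: "size (conjugates r x) = r"
  by (simp add: conjugates_def)

lemma conjugates_0 [simp]: "conjugates 0 x = {#}"
  by (simp add: conjugates_def)

lemma conjugates_Suc: "conjugates (Suc r) x = add_mset (x ^ (CARD('a::finite_field) ^ r)) (conjugates r (x :: 'a alg_closure))"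
  by (simp add: conjugates_def lessThan_Suc)

lemma prod_mset_conjugates: "prod_mset (conjugates r x) = (\<Prod>i<r. (x :: 'a::finite_field alg_closure) ^ (CARD('a) ^ i))"
  by (induction r) (simp_all add: conjugates_Suc mult.commute)

lemma sum_mset_conjugates: "sum_mset (conjugates r x) = (\<Sum>i<r. (x :: 'a::finite_field alg_closure) ^ (CARD('a) ^ i))"
  by (induction r) (simp_all add: conjugates_Suc add.commute)

lemma self_in_conjugates: "r \<ge> 1 \<Longrightarrow> x \<in># conjugates r x"
  by (auto simp: conjugates_def intro!: image_eqI[of _ _ 0])

lemma conjugates_frob_mset:
  fixes x :: "'a::finite_field alg_closure"
  assumes "x \<in> ext_field r"
  shows "conjugates r x \<in> frob_msets r"
proof -
  have "add_mset x (image_mset (\<lambda>x. x ^ CARD('a)) (conjugates k x)) = conjugates (Suc k) x" for k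
  proof (induction k)
    case (Suc k)
    have "add_mset x (image_mset (\<lambda>x. x ^ CARD('a)) (conjugates (Suc k) x)) =
          add_mset ((x ^ (CARD('a) ^ k)) ^ CARD('a)) (add_mset x (image_mset (\<lambda>x. x ^ CARD('a)) (conjugates k x)))"
      by (simp add: conjugates_Suc add_mset_commute)
    also have "\<dots> = add_mset ((x ^ (CARD('a) ^ k)) ^ CARD('a)) (conjugates (Suc k) x)"
      unfolding Suc ..
    also have "(x ^ (CARD('a) ^ k)) ^ CARD('a) = x ^ (CARD('a) ^ Suc k)"
      by (simp add: mult.commute flip: power_mult)
    finally show ?case by (simp only: conjugates_Suc[of "Suc k"])
  qed (simp add: conjugates_Suc)
  from this[of r] show ?thesis
    using assms by (simp add: frob_msets_def conjugates_Suc ext_field_def)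
qed

lemma frob_msets_add:
  "M \<in> frob_msets k \<Longrightarrow> M' \<in> frob_msets k' \<Longrightarrow> M + M' \<in> frob_msets (k + k')"
  by (simp add: frob_msets_def)

lemma frob_msets_diff:
  assumes "M \<in> frob_msets k" "C \<in> frob_msets r" "C \<subseteq># M"
  shows "M - C \<in> frob_msets (k - r)"
proof -
  obtain D where D: "M = C + D" using assms(3) by (auto simp: subset_mset.le_iff_add)
  show ?thesis using assms(1,2) by (auto simp: frob_msets_def D)
qed

lemma frob_msets_count:
  fixes x :: "'a::finite_field alg_closure"
  assumes "M \<in> frob_msets k"
  shows "count M (x ^ (CARD('a) ^ i)) = count M x"
proof (induction i)
  case (Suc i)
  let ?F = "\<lambda>x :: 'a alg_closure. x ^ CARD('a)"
  have "count M (?F y) = count M y" for y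
  proof -
    have "count (image_mset ?F M) (?F y) = count M y"
    proof (cases "y \<in># M")
      case True
      hence "?F -` {?F y} \<inter> set_mset M = {y}" using injD[OF frob_inj] by auto
      thus ?thesis by (simp add: count_image_mset)
    next
      case False
      hence "?F -` {?F y} \<inter> set_mset M = {}" using injD[OF frob_inj] by auto
      thus ?thesis using False by (simp add: count_image_mset not_in_iff)
    qed
    thus ?thesis using assms by (simp add: frob_msets_def)
  qed
  from this[of "x ^ (CARD('a) ^ i)"] show ?case
    using Suc by (simp add: mult.commute flip: power_mult)
qed simp

text \<open>
  All \<open>x ^ (q ^ i)\<close> belong to the finite multiset, so two of them coincide.
\<close>
lemma frob_msets_period:
  fixes x :: "'a::finite_field alg_closure"
  assumes M: "M \<in> frob_msets k" and x: "x \<in># M"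
  shows "\<exists>e\<ge>1. x \<in> ext_field e"
proof -
  have "range (\<lambda>i. x ^ (CARD('a) ^ i)) \<subseteq> set_mset M"
    using frob_msets_count[OF M, of x] x by (auto simp flip: count_greater_zero_iff)
  hence "finite (range (\<lambda>i. x ^ (CARD('a) ^ i)))" by (rule finite_subset) simp
  hence "\<not> inj (\<lambda>i::nat. x ^ (CARD('a) ^ i))" using finite_imageD infinite_UNIV_nat by blast
  then obtain i j :: nat where ij: "i < j" "x ^ (CARD('a) ^ i) = x ^ (CARD('a) ^ j)"
    unfolding inj_def by (metis nat_neq_iff)
  have "(x ^ (CARD('a) ^ (j - i))) ^ (CARD('a) ^ i) = x ^ (CARD('a) ^ i)"
    using ij by (simp flip: power_mult power_add)
  hence "x ^ (CARD('a) ^ (j - i)) = x" by (rule frob_pow_inj)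
  thus ?thesis using ij(1) by (intro exI[of _ "j - i"]) (auto simp: ext_field_def)
qed

lemma exact_period:
  fixes x :: "'a::finite_field alg_closure"
  assumes "\<exists>e\<ge>1. x \<in> ext_field e"
  obtains e where "e \<ge> 1" "\<And>r. x \<in> ext_field r \<longleftrightarrow> e dvd r" "inj_on (\<lambda>i. x ^ (CARD('a) ^ i)) {..<e}"
proof -
  define e where "e = (LEAST e. e \<ge> 1 \<and> x \<in> ext_field e)"
  have e: "e \<ge> 1" "x \<in> ext_field e"
    using LeastI_ex[OF assms] unfolding e_def by auto
  have e_le: "e \<le> r" if "r \<ge> 1" "x \<in> ext_field r" for r
    unfolding e_def using that by (intro Least_le) auto
  have mult: "x \<in> ext_field (e * j)" for j
  proof (induction j)
    case (Suc j)
    have "x ^ (CARD('a) ^ (e * Suc j)) = (x ^ (CARD('a) ^ e)) ^ (CARD('a) ^ (e * j))"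
      by (simp flip: power_mult add: power_add)
    thus ?case using Suc e(2) by (simp add: ext_field_def)
  qed (simp add: ext_field_def)
  have iff: "x \<in> ext_field r \<longleftrightarrow> e dvd r" for r
  proof
    assume r: "x \<in> ext_field r"
    have "x ^ (CARD('a) ^ r) = (x ^ (CARD('a) ^ (e * (r div e)))) ^ (CARD('a) ^ (r mod e))"
      by (simp flip: power_mult power_add)
    also have "\<dots> = x ^ (CARD('a) ^ (r mod e))"
      using mult by (simp add: ext_field_def)
    finally have "x \<in> ext_field (r mod e)" using r by (simp add: ext_field_def)
    moreover have "r mod e < e" using e(1) by simp
    ultimately have "r mod e = 0" using e_le[of "r mod e"] by linarith
    thus "e dvd r" by auto
  next
    assume "e dvd r"
    thus "x \<in> ext_field r" using mult by (elim dvdE) simp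
  qed
  have inj: "inj_on (\<lambda>i. x ^ (CARD('a) ^ i)) {..<e}"
  proof (rule linorder_inj_onI')
    fix i j assume ij: "i \<in> {..<e}" "j \<in> {..<e}" "i < j"
    show "x ^ (CARD('a) ^ i) \<noteq> x ^ (CARD('a) ^ j)"
    proof
      assume "x ^ (CARD('a) ^ i) = x ^ (CARD('a) ^ j)"
      hence "(x ^ (CARD('a) ^ (j - i))) ^ (CARD('a) ^ i) = x ^ (CARD('a) ^ i)"
        using ij by (simp flip: power_mult power_add)
      hence "x ^ (CARD('a) ^ (j - i)) = x" by (rule frob_pow_inj)
      hence "e \<le> j - i" using ij by (intro e_le) (auto simp: ext_field_def)
      thus False using ij by auto
    qed
  qed
  show ?thesis by (rule that[OF e(1) iff inj])
qed

lemma conjugates_add: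
  fixes x :: "'a::finite_field alg_closure"
  assumes "x \<in> ext_field r"
  shows "conjugates (r + s) x = conjugates r x + conjugates s x"
proof (induction s)
  case (Suc s)
  have "x ^ (CARD('a) ^ (r + s)) = (x ^ (CARD('a) ^ r)) ^ (CARD('a) ^ s)"
    by (simp add: power_add power_mult)
  hence "x ^ (CARD('a) ^ (r + s)) = x ^ (CARD('a) ^ s)"
    using assms by (simp add: ext_field_def)
  thus ?case using Suc by (simp add: conjugates_Suc)
qed simp

lemma conjugates_multiple:
  assumes "x \<in> ext_field e"
  shows "conjugates (j * e) x = repeat_mset j (conjugates e x)"
  by (induction j) (simp_all add: conjugates_add[OF assms])

text \<open>
  The \<open>e\<close> distinct conjugates of \<open>x\<close> have the same multiplicity in an invariant multiset.
\<close>
lemma conjugates_subset_iff: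
  fixes x :: "'a::finite_field alg_closure"
  assumes M: "M \<in> frob_msets k" and e: "e \<ge> 1" "x \<in> ext_field e"
    and inj: "inj_on (\<lambda>i. x ^ (CARD('a) ^ i)) {..<e}"
  shows "conjugates (j * e) x \<subseteq># M \<longleftrightarrow> j \<le> count M x"
proof -
  define C where "C = (\<lambda>i. x ^ (CARD('a) ^ i)) ` {..<e}"
  have C: "conjugates e x = mset_set C"
    unfolding conjugates_def C_def by (rule image_mset_mset_set[OF inj])
  have count_C: "count M y = count M x" if "y \<in> C" for y
    using that frob_msets_count[OF M, of x] by (auto simp: C_def)
  have fin: "finite C" by (simp add: C_def)
  have x: "x \<in> C" using e(1) by (auto simp: C_def intro!: image_eqI[of _ _ 0])
  show ?thesis
    unfolding conjugates_multiple[OF e(2)] C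
  proof
    assume "repeat_mset j (mset_set C) \<subseteq># M"
    from mset_subset_eq_count[OF this, of x] show "j \<le> count M x" using x fin by simp
  next
    assume j: "j \<le> count M x"
    show "repeat_mset j (mset_set C) \<subseteq># M"
    proof (rule mset_subset_eqI)
      fix y show "count (repeat_mset j (mset_set C)) y \<le> count M y"
        using j count_C[of y] fin by (cases "y \<in> C") auto
    qed
  qed
qed

lemma finite_frob_msets: "finite (frob_msets k :: 'a::finite_field alg_closure multiset set)"
proof (rule finite_subset)
  let ?S = "\<Union>e\<in>{1..k}. ext_field e :: 'a alg_closure set"
  show "frob_msets k \<subseteq> multisets_of_size ?S k"
  proof
    fix M :: "'a alg_closure multiset" assume M: "M \<in> frob_msets k"
    have "x \<in> ?S" if x: "x \<in># M" for x
    proof -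
      obtain e where e: "e \<ge> 1" "\<And>r. x \<in> ext_field r \<longleftrightarrow> e dvd r"
        "inj_on (\<lambda>i. x ^ (CARD('a) ^ i)) {..<e}"
        using exact_period[OF frob_msets_period[OF M x]] by metis
      have "conjugates (1 * e) x \<subseteq># M"
        using conjugates_subset_iff[OF M e(1) _ e(3), of 1] e(2) x
        by (simp add: Suc_le_eq)
      from size_mset_mono[OF this] have "e \<le> k" using M by (simp add: frob_msets_def)
      thus ?thesis using e(1) e(2)[of e] by (intro UN_I[of e]) auto
    qed
    thus "M \<in> multisets_of_size ?S k"
      using M by (auto simp: multisets_of_size_def frob_msets_def)
  qed
  show "finite (multisets_of_size ?S k)"
    by (intro finite_multisets_of_size finite_UN_I finite_ext_field) auto
qed

text \<open>
  For a root \<open>x\<close> of degree \<open>e\<close>, the characteristic polynomials of \<open>x\<close> over the extensions of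
  degrees \<open>e, 2 e, \<dots>\<close> are the powers of its minimal polynomial, and exactly as many of
  these divide the given polynomial as \<open>x\<close> has multiplicity. Hence the total is the degree.
\<close>
lemma card_conjugates_subset:
  fixes M :: "'a::finite_field alg_closure multiset"
  assumes M: "M \<in> frob_msets k"
  shows "(\<Sum>r=1..k. card {x \<in> ext_field r. conjugates r x \<subseteq># M}) = k"
proof -
  have "(\<Sum>r=1..k. card {x \<in> ext_field r. conjugates r x \<subseteq># M}) =
        (\<Sum>r=1..k. \<Sum>x\<in>set_mset M. if x \<in> ext_field r \<and> conjugates r x \<subseteq># M then 1 else 0)"
  proof (intro sum.cong refl)
    fix r assume r: "r \<in> {1..k}"
    have "{x \<in> ext_field r. conjugates r x \<subseteq># M} =
          {x \<in> set_mset M. x \<in> ext_field r \<and> conjugates r x \<subseteq># M}"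
      using self_in_conjugates[of r] r by (auto dest: mset_subset_eqD)
    thus "card {x \<in> ext_field r. conjugates r x \<subseteq># M} =
        (\<Sum>x\<in>set_mset M. if x \<in> ext_field r \<and> conjugates r x \<subseteq># M then 1 else 0)"
      by (simp add: sum.If_cases Int_def)
  qed
  also have "\<dots> = (\<Sum>x\<in>set_mset M. card {r \<in> {1..k}. x \<in> ext_field r \<and> conjugates r x \<subseteq># M})"
    by (subst sum.swap) (simp add: sum.If_cases Int_def)
  also have "\<dots> = (\<Sum>x\<in>set_mset M. count M x)"
  proof (intro sum.cong refl)
    fix x assume x: "x \<in># M"
    obtain e where e: "e \<ge> 1" "\<And>r. x \<in> ext_field r \<longleftrightarrow> e dvd r"
      "inj_on (\<lambda>i. x ^ (CARD('a) ^ i)) {..<e}"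
      using exact_period[OF frob_msets_period[OF M x]] by metis
    have iff: "conjugates (j * e) x \<subseteq># M \<longleftrightarrow> j \<le> count M x" for j
      by (rule conjugates_subset_iff[OF M e(1) _ e(3)]) (simp add: e(2))
    have "{r \<in> {1..k}. x \<in> ext_field r \<and> conjugates r x \<subseteq># M} = (\<lambda>j. j * e) ` {1..count M x}"
    proof (intro equalityI subsetI)
      fix r assume "r \<in> {r \<in> {1..k}. x \<in> ext_field r \<and> conjugates r x \<subseteq># M}"
      hence r: "r \<ge> 1" "e dvd r" "conjugates r x \<subseteq># M" by (auto simp: e(2))
      then obtain j where j: "r = j * e" by (auto simp: mult.commute elim: dvdE)
      thus "r \<in> (\<lambda>j. j * e) ` {1..count M x}"
        using r iff[of j] by (intro image_eqI[of _ _ j]) (cases j; auto)+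
    next
      fix r assume "r \<in> (\<lambda>j. j * e) ` {1..count M x}"
      then obtain j where "r = j * e" "j \<in> {1..count M x}" by (rule imageE)
      hence j: "r = j * e" "1 \<le> j" "j \<le> count M x" by auto
      hence sub: "conjugates r x \<subseteq># M" using iff by simp
      have "r \<le> k" using size_mset_mono[OF sub] M by (simp add: frob_msets_def)
      thus "r \<in> {r \<in> {1..k}. x \<in> ext_field r \<and> conjugates r x \<subseteq># M}"
        using sub j e by (auto simp: Suc_le_eq)
    qed
    moreover have "inj_on (\<lambda>j. j * e) {1..count M x}" using e(1) by (auto intro: inj_onI)
    ultimately show "card {r \<in> {1..k}. x \<in> ext_field r \<and> conjugates r x \<subseteq># M} = count M x"
      by (simp add: card_image)
  qed
  also have "\<dots> = k" using M by (simp add: frob_msets_def size_multiset_overloaded_eq)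
  finally show ?thesis .
qed

subsection \<open>Polynomials from their multisets of roots\<close>

abbreviation root_poly :: "'b::field multiset \<Rightarrow> 'b poly" where
  "root_poly M \<equiv> (\<Prod>x\<in>#M. [:-x, 1:])"

lemma degree_root_poly: "degree (root_poly M) = size M \<and> coeff (root_poly M) (size M) = 1"
proof (induction M)
  case (add x M)
  have "root_poly M \<noteq> 0" using add by auto
  hence "degree ([:-x, 1:] * root_poly M) = Suc (size M)"
    using add by (subst degree_mult_eq) auto
  moreover have "coeff ([:-x, 1:] * root_poly M) (Suc (size M)) = 1"
    using add by (simp add: coeff_eq_0)
  ultimately show ?case by simp
qed simp

lemma coeff_root_poly_pred: "size M = Suc k \<Longrightarrow> coeff (root_poly M) k = - sum_mset M"
proof (induction M arbitrary: k)
  case (add x M)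
  have size: "size M = k" using add by simp
  have "coeff ([:-x, 1:] * root_poly M) k = (case k of 0 \<Rightarrow> 0 | Suc j \<Rightarrow> coeff (root_poly M) j) - x * coeff (root_poly M) k"
    by (simp add: coeff_pCons)
  also have "\<dots> = - sum_mset M - x"
    using add.IH degree_root_poly[of M] size by (cases k) auto
  finally show ?case by simp
qed simp

lemma coeff_root_poly_0: "coeff (root_poly M) 0 = (- 1) ^ size M * prod_mset M"
  by (induction M) (simp_all add: mult_ac)

lemma map_poly_frob_root_poly:
  "map_poly (\<lambda>x. x ^ CARD('a)) (root_poly M) = root_poly (image_mset (\<lambda>x. x ^ CARD('a)) (M :: 'a::finite_field alg_closure multiset))"
proof (induction M)
  case (add x M)
  let ?F = "\<lambda>x :: 'a alg_closure. x ^ CARD('a)"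
  have minus: "(- y) ^ CARD('a) = - (y ^ CARD('a) :: 'a alg_closure)" for y
    using frob_pow_uminus[of y 1] by simp
  have diff: "(y - z) ^ CARD('a) = y ^ CARD('a) - (z ^ CARD('a) :: 'a alg_closure)" for y z
    using frob_add[of y "- z"] minus by simp
  have "map_poly ?F ([:-x, 1:] * P) = [:- ?F x, 1:] * map_poly ?F P" for P
    by (rule poly_eqI)
       (auto simp: coeff_map_poly coeff_pCons diff minus power_mult_distrib power_0_left split: nat.splits)
  thus ?case using add by simp
qed simp

lemma root_poly_eq_iff: "root_poly M = root_poly M' \<longleftrightarrow> M = M'"
  using proots_prod_linear by metis

text \<open>
  Adding \<open>t X ^ (k - 1)\<close> to the polynomial moves the sum of the roots by \<open>- t\<close> and, as
  \<open>k \<ge> 2\<close>, keeps their product.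
\<close>
definition shift_roots :: "'b::field \<Rightarrow> 'b multiset \<Rightarrow> 'b multiset" where
  "shift_roots t M = proots (root_poly M + monom t (size M - 1))"

lemma root_poly_shift_roots:
  fixes M :: "'b::alg_closed_field multiset"
  assumes "size M \<ge> 1"
  shows "root_poly (shift_roots t M) = root_poly M + monom t (size M - 1)" "size (shift_roots t M) = size M"
proof -
  let ?Q = "root_poly M + monom t (size M - 1)"
  have deg: "degree ?Q = size M"
  proof -
    have "degree (monom t (size M - 1)) < degree (root_poly M)"
      using degree_monom_le[of t "size M - 1"] assms degree_root_poly[of M] by simp
    thus ?thesis by (simp add: degree_add_eq_left degree_root_poly)
  qed
  have lead: "lead_coeff ?Q = 1"
    unfolding deg using assms by (simp add: degree_root_poly)
  hence "?Q \<noteq> 0" by (metis leading_coeff_0_iff zero_neq_one)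
  then obtain A where A: "size A = degree ?Q" "?Q = smult (lead_coeff ?Q) (root_poly A)"
    using alg_closed_imp_factorization by blast
  hence Q: "?Q = root_poly A" using lead by simp
  hence "shift_roots t M = A" by (simp add: shift_roots_def proots_prod_linear)
  thus "root_poly (shift_roots t M) = ?Q" "size (shift_roots t M) = size M"
    using Q A(1) deg by simp_all
qed

lemma shift_roots_inverse:
  fixes M :: "'b::alg_closed_field multiset"
  assumes "size M \<ge> 1"
  shows "shift_roots (- t) (shift_roots t M) = M"
  unfolding shift_roots_def[of "- t"] root_poly_shift_roots[OF assms]
  by (simp add: add_monom proots_prod_linear add.assoc)

lemma shift_roots_frob_msets:
  fixes M :: "'a::finite_field alg_closure multiset"
  assumes M: "M \<in> frob_msets k" and k: "k \<ge> 1" and t: "t \<in> ext_field 1"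
  shows "shift_roots t M \<in> frob_msets k"
proof -
  let ?F = "\<lambda>x :: 'a alg_closure. x ^ CARD('a)"
  have size: "size M = k" "size M \<ge> 1" using M k by (auto simp: frob_msets_def)
  have "root_poly (image_mset ?F (shift_roots t M)) = map_poly ?F (root_poly M + monom t (size M - 1))"
    unfolding map_poly_frob_root_poly[symmetric] root_poly_shift_roots[OF size(2)] ..
  also have "\<dots> = map_poly ?F (root_poly M) + monom t (size M - 1)"
    using t unfolding in_ext_field_1_iff
    by (intro poly_eqI) (auto simp: coeff_map_poly frob_add power_0_left)
  also have "map_poly ?F (root_poly M) = root_poly M"
    unfolding map_poly_frob_root_poly using M by (simp add: frob_msets_def)
  also have "root_poly M + monom t (size M - 1) = root_poly (shift_roots t M)"
    by (rule root_poly_shift_roots[OF size(2), symmetric])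
  finally show ?thesis
    using root_poly_shift_roots(2)[OF size(2)] size(1) by (simp add: frob_msets_def root_poly_eq_iff)
qed

lemma shift_roots_sum_prod:
  fixes M :: "'b::alg_closed_field multiset"
  assumes "size M \<ge> 2"
  shows "sum_mset (shift_roots t M) = sum_mset M - t" "prod_mset (shift_roots t M) = prod_mset M"
proof -
  have size: "size M \<ge> 1" "size M = Suc (size M - 1)" using assms by auto
  note rp = root_poly_shift_roots[OF size(1), of t]
  have "- sum_mset (shift_roots t M) = coeff (root_poly (shift_roots t M)) (size M - 1)"
    using size rp(2) by (intro coeff_root_poly_pred[symmetric]) simp
  also have "\<dots> = - sum_mset M + t"
    unfolding rp(1) using coeff_root_poly_pred[OF size(2)] by simp
  finally show "sum_mset (shift_roots t M) = sum_mset M - t" by (simp add: algebra_simps)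
  have "(- 1) ^ size M * prod_mset (shift_roots t M) = coeff (root_poly (shift_roots t M)) 0"
    using coeff_root_poly_0[of "shift_roots t M"] rp(2) by simp
  also have "\<dots> = (- 1) ^ size M * prod_mset M"
    unfolding rp(1) using assms by (simp add: coeff_root_poly_0)
  finally show "prod_mset (shift_roots t M) = prod_mset M" by simp
qed

subsection \<open>The recursion for twisted sums over invariant multisets\<close>

text \<open>
  For the polynomial \<open>X\<^sup>k - s X\<^sup>k\<^sup>-\<^sup>1 + \<dots> + (-1)\<^sup>k p\<close> this is \<open>\<eta>(p) \<psi>(s)\<close>, a multiplicative
  function of the polynomial.
\<close>
definition mset_weight :: "('a::finite_field \<Rightarrow> qbar) \<Rightarrow> ('a \<Rightarrow> qbar) \<Rightarrow> 'a alg_closure multiset \<Rightarrow> qbar" where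
  "mset_weight \<eta> \<psi> M = \<eta> (of_ac (prod_mset M)) * \<psi> (of_ac (sum_mset M))"

lemma frob_msets_prod_sum_in:
  assumes "M \<in> frob_msets k"
  shows "prod_mset M \<in> (ext_field 1 :: 'a::finite_field alg_closure set)" "sum_mset M \<in> (ext_field 1 :: 'a alg_closure set)"
proof -
  have inv: "image_mset (\<lambda>x. x ^ CARD('a)) M = M"
    using assms by (simp add: frob_msets_def)
  have "prod_mset (image_mset (\<lambda>x. x ^ CARD('a)) A) = prod_mset A ^ CARD('a)" for A :: "'a alg_closure multiset"
    by (induction A) (simp_all add: power_mult_distrib)
  from this[of M] show "prod_mset M \<in> ext_field 1"
    unfolding in_ext_field_1_iff inv by simp
  have "sum_mset (image_mset (\<lambda>x. x ^ CARD('a)) A) = sum_mset A ^ CARD('a)" for A :: "'a alg_closure multiset"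
    by (induction A) (simp_all add: frob_add power_0_left)
  from this[of M] show "sum_mset M \<in> ext_field 1"
    unfolding in_ext_field_1_iff inv by simp
qed

context
  fixes \<eta> \<psi> :: "'a::finite_field \<Rightarrow> qbar"
  assumes \<eta>: "\<eta> \<in> mult_chars UNIV" and \<psi>: "nontriv_add_char UNIV \<psi>"
begin

interpretation U: gauss_field "UNIV :: 'a set" \<psi>
  using finite_subfield_UNIV \<psi> by (auto simp: gauss_field_def gauss_field_axioms_def)

lemma mset_weight_add:
  assumes "M \<in> frob_msets k" "M' \<in> frob_msets k'"
  shows "mset_weight \<eta> \<psi> (M + M') = mset_weight \<eta> \<psi> M * mset_weight \<eta> \<psi> M'"
  using frob_msets_prod_sum_in[OF assms(1)] frob_msets_prod_sum_in[OF assms(2)] \<eta>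
  by (simp add: mset_weight_def of_ac_mult of_ac_add U.mult_char_mult U.psi_add del: One_nat_def)

lemma mset_weight_conjugates:
  "x \<in> ext_field r \<Longrightarrow> mset_weight \<eta> \<psi> (conjugates r x) = lift_char r \<eta> x * lift_add_char r \<psi> x"
  by (simp add: mset_weight_def lift_char_def lift_add_char_def prod_mset_conjugates
      sum_mset_conjugates ext_norm_def ext_trace_def)

abbreviation mset_sum :: "nat \<Rightarrow> qbar" where
  "mset_sum k \<equiv> (\<Sum>M\<in>frob_msets k. mset_weight \<eta> \<psi> M)"

abbreviation point_sum :: "nat \<Rightarrow> qbar" where
  "point_sum r \<equiv> (\<Sum>x\<in>ext_field r. lift_char r \<eta> x * lift_add_char r \<psi> x)"

text \<open>
  Weight each multiset by its degree, replace the degree by the number of sub-multisets of the form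
  \<open>conjugates r x\<close>, and split these off. On them the weight is the summand of the Gauss sum over
  the extension of degree \<open>r\<close>. In terms of generating functions this is the logarithmic derivative
  of the Euler product.
\<close>
lemma weighted_recursion: "of_nat k * mset_sum k = (\<Sum>r=1..k. point_sum r * mset_sum (k - r))"
proof -
  have "of_nat k * mset_sum k = (\<Sum>M\<in>frob_msets k. (\<Sum>r=1..k. of_nat (card {x \<in> ext_field r. conjugates r x \<subseteq># M})) * mset_weight \<eta> \<psi> M)"
    unfolding sum_distrib_left
    by (intro sum.cong refl) (simp only: of_nat_sum[symmetric] card_conjugates_subset)
  also have "\<dots> = (\<Sum>r=1..k. \<Sum>M\<in>frob_msets k. of_nat (card {x \<in> ext_field r. conjugates r x \<subseteq># M}) * mset_weight \<eta> \<psi> M)"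
    unfolding sum_distrib_right by (rule sum.swap)
  also have "\<dots> = (\<Sum>r=1..k. point_sum r * mset_sum (k - r))"
  proof (intro sum.cong refl)
    fix r assume r: "r \<in> {1..k}"
    hence fin: "finite (ext_field r :: 'a alg_closure set)" by (intro finite_ext_field) auto
    have "(\<Sum>M\<in>frob_msets k. of_nat (card {x \<in> ext_field r. conjugates r x \<subseteq># M}) * mset_weight \<eta> \<psi> M) =
        (\<Sum>M\<in>frob_msets k. \<Sum>x\<in>ext_field r. if conjugates r x \<subseteq># M then mset_weight \<eta> \<psi> M else 0)"
      using fin by (simp add: sum.If_cases Int_def)
    also have "\<dots> = (\<Sum>x\<in>ext_field r. \<Sum>M\<in>{M \<in> frob_msets k. conjugates r x \<subseteq># M}. mset_weight \<eta> \<psi> M)"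
      by (subst sum.swap) (simp add: sum.If_cases Int_def finite_frob_msets)
    also have "\<dots> = (\<Sum>x\<in>ext_field r. lift_char r \<eta> x * lift_add_char r \<psi> x * mset_sum (k - r))"
    proof (intro sum.cong refl)
      fix x :: "'a alg_closure" assume x: "x \<in> ext_field r"
      note C = conjugates_frob_mset[OF x]
      have "(\<Sum>M\<in>{M \<in> frob_msets k. conjugates r x \<subseteq># M}. mset_weight \<eta> \<psi> M) =
            (\<Sum>M\<in>frob_msets (k - r). mset_weight \<eta> \<psi> (conjugates r x + M))"
        by (rule sum.reindex_bij_witness[of _ "\<lambda>M. conjugates r x + M" "\<lambda>M. M - conjugates r x"])
          (use C r frob_msets_add[OF C, of _ "k - r"] frob_msets_diff[OF _ C, of _ k] in auto)
      also have "\<dots> = (\<Sum>M\<in>frob_msets (k - r). lift_char r \<eta> x * lift_add_char r \<psi> x * mset_weight \<eta> \<psi> M)"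
        by (intro sum.cong refl) (simp only: mset_weight_add[OF C] mset_weight_conjugates[OF x])
      finally show "(\<Sum>M\<in>{M \<in> frob_msets k. conjugates r x \<subseteq># M}. mset_weight \<eta> \<psi> M) =
          lift_char r \<eta> x * lift_add_char r \<psi> x * mset_sum (k - r)"
        by (simp only: sum_distrib_left)
    qed
    finally show "(\<Sum>M\<in>frob_msets k. of_nat (card {x \<in> ext_field r. conjugates r x \<subseteq># M}) * mset_weight \<eta> \<psi> M) = point_sum r * mset_sum (k - r)"
      by (simp only: sum_distrib_right)
  qed
  finally show ?thesis .
qed


lemma mset_sum_0: "mset_sum 0 = 1"
proof -
  have "frob_msets 0 = {{#} :: 'a alg_closure multiset}"
    by (auto simp: frob_msets_def)
  thus ?thesis using \<eta> by (simp add: mset_weight_def)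
qed

text \<open>
  Shifting the sum of the roots by \<open>s\<close> while keeping their product permutes the summands and
  multiplies the total by \<open>\<psi> s\<close>.
\<close>
lemma mset_sum_ge_2:
  assumes k: "k \<ge> 2"
  shows "mset_sum k = 0"
proof -
  obtain s where s: "\<psi> s \<noteq> 1" using \<psi> by (auto simp: nontriv_add_char_def)
  define t where "t = to_ac (- s)"
  have t: "t \<in> ext_field 1" "- t \<in> ext_field 1"
    unfolding t_def ext_field_1 by (auto simp flip: to_ac_minus)
  have size: "size M = k" if "M \<in> frob_msets k" for M :: "'a alg_closure multiset"
    using that by (simp add: frob_msets_def)
  have "mset_sum k = (\<Sum>M\<in>frob_msets k. mset_weight \<eta> \<psi> (shift_roots t M))"
  proof (rule sum.reindex_bij_witness[of _ "shift_roots t" "shift_roots (- t)"])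
    fix M :: "'a alg_closure multiset" assume M: "M \<in> frob_msets k"
    show "shift_roots t (shift_roots (- t) M) = M"
      using shift_roots_inverse[of M "- t"] size[OF M] k by simp
    show "shift_roots (- t) (shift_roots t M) = M"
      using shift_roots_inverse[of M t] size[OF M] k by simp
    show "shift_roots t M \<in> frob_msets k" "shift_roots (- t) M \<in> frob_msets k"
      using shift_roots_frob_msets[OF M] k t by simp_all
    show "mset_weight \<eta> \<psi> (shift_roots t (shift_roots (- t) M)) = mset_weight \<eta> \<psi> M"
      using shift_roots_inverse[of M "- t"] size[OF M] k by simp
  qed
  also have "\<dots> = (\<Sum>M\<in>frob_msets k. \<psi> s * mset_weight \<eta> \<psi> M)"
  proof (intro sum.cong refl)
    fix M :: "'a alg_closure multiset" assume M: "M \<in> frob_msets k"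
    have "of_ac (sum_mset M - t) = of_ac (sum_mset M + - t)" by simp
    also have "\<dots> = of_ac (sum_mset M) + of_ac (- t)"
      using frob_msets_prod_sum_in[OF M] t by (intro of_ac_add)
    also have "of_ac (- t) = s" unfolding t_def by (rule of_ac_eqI) simp
    finally show "mset_weight \<eta> \<psi> (shift_roots t M) = \<psi> s * mset_weight \<eta> \<psi> M"
      using shift_roots_sum_prod[of M t] size[OF M] k
      by (simp add: mset_weight_def U.psi_add mult_ac)
  qed
  also have "\<dots> = \<psi> s * mset_sum k" by (simp add: sum_distrib_left)
  finally show ?thesis using s by simp
qed

lemma point_sum_eq_gauss:
  assumes "r \<ge> 1"
  shows "point_sum r = - gauss_sum (ext_field r) (lift_add_char r \<psi>) (lift_char r \<eta>)"
proof -
  interpret K: finite_subfield "ext_field r :: 'a alg_closure set"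
    using assms by (rule finite_subfield_ext_field)
  have "lift_char r \<eta> 0 = 0" using K.mult_char_zero[OF lift_char_in[OF assms \<eta>]] .
  thus ?thesis by (simp add: gauss_sum_def sum_diff1 mult.commute)
qed

lemma point_sum_1: "point_sum 1 = - gauss_sum UNIV \<psi> \<eta>"
proof -
  have "point_sum 1 = (\<Sum>x\<in>UNIV. \<psi> x * \<eta> x)"
    unfolding ext_field_1
    by (subst sum.reindex) (auto simp: inj_to_ac lift_char_def lift_add_char_def ext_norm_def
        ext_trace_def to_ac_in_ext_field mult.commute)
  thus ?thesis using \<eta> by (simp add: gauss_sum_def sum_diff1)
qed

text \<open>
  As all but the first two of the sums over invariant multisets vanish, the recursion shrinks to
  \<open>point_sum (k + 1) = - point_sum 1 * point_sum k\<close>.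
\<close>
theorem hasse_davenport:
  assumes "r \<ge> 1"
  shows "gauss_sum (ext_field r) (lift_add_char r \<psi>) (lift_char r \<eta>) = gauss_sum UNIV \<psi> \<eta> ^ r"
proof -
  note A0 = mset_sum_0
  have A1: "mset_sum 1 = point_sum 1"
    using weighted_recursion[of 1] A0 by simp
  have "point_sum r = - (gauss_sum UNIV \<psi> \<eta> ^ r)"
    using assms
  proof (induction r rule: dec_induct)
    case base
    show ?case using point_sum_1 by simp
  next
    case (step k)
    have split: "{1..Suc k} = insert (Suc k) (insert k {1..<k})" using step by auto
    have "0 = (\<Sum>r=1..Suc k. point_sum r * mset_sum (Suc k - r))"
      using weighted_recursion[of "Suc k"] mset_sum_ge_2[of "Suc k"] step by simp
    also have "\<dots> = point_sum (Suc k) * mset_sum 0 + (point_sum k * mset_sum 1 +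
        (\<Sum>r\<in>{1..<k}. point_sum r * mset_sum (Suc k - r)))"
      unfolding split by simp
    also have "(\<Sum>r\<in>{1..<k}. point_sum r * mset_sum (Suc k - r)) = 0"
      by (intro sum.neutral ballI) (auto simp: mset_sum_ge_2)
    finally have "point_sum (Suc k) = - (point_sum k * point_sum 1)"
      unfolding A0 A1 by (simp add: add_eq_0_iff2)
    thus ?case unfolding step.IH point_sum_1 by simp
  qed
  thus ?thesis using point_sum_eq_gauss[OF assms] by simp
qed

end

text \<open>
  If the lifted additive character were trivial, the Gauss sum of the trivial character would be
  \<open>- (q ^ r - 1)\<close> instead of \<open>1\<close>.
\<close>
lemma lift_add_char_nontriv:
  assumes "r \<ge> 1" "nontriv_add_char (UNIV :: 'a::finite_field set) \<psi>"
  shows "nontriv_add_char (ext_field r) (lift_add_char r \<psi>)"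
proof -
  interpret U: gauss_field "UNIV :: 'a set" \<psi>
    using finite_subfield_UNIV assms(2) by (auto simp: gauss_field_def gauss_field_axioms_def)
  interpret K: finite_subfield "ext_field r :: 'a alg_closure set"
    using assms(1) by (rule finite_subfield_ext_field)
  have "\<exists>x\<in>ext_field r. lift_add_char r \<psi> x \<noteq> 1"
  proof (rule ccontr)
    assume triv: "\<not> ?thesis"
    have "gauss_sum (ext_field r) (lift_add_char r \<psi>) (triv_char (ext_field r)) = 1"
      using hasse_davenport[OF U.triv_char_in assms(2,1)] by (simp add: lift_char_triv[OF assms(1)])
    moreover have "(\<Sum>x\<in>ext_field r - {0}. lift_add_char r \<psi> x * triv_char (ext_field r) x) =
        (\<Sum>x\<in>ext_field r - {0 :: 'a alg_closure}. 1)"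
      using triv by (intro sum.cong) (auto simp: triv_char_def)
    ultimately have eq: "- of_nat K.N = (1 :: qbar)" by (simp add: gauss_sum_def)
    have "of_nat (Suc K.N) = 1 + (of_nat K.N :: qbar)" by (rule of_nat_Suc)
    also have "\<dots> = 0" unfolding eq[symmetric] by (rule left_minus)
    finally have "of_nat (Suc K.N) = (0 :: qbar)" .
    thus False by (simp only: of_nat_eq_0_iff)
  qed
  thus ?thesis
    by (auto simp: nontriv_add_char_def lift_add_char_def ext_trace_add U.psi_add U.psi_nz)
qed

text \<open>
  Jacobi sums are quotients of Gauss sums as soon as one of the characters is non-trivial. The factor
  \<open>q\<close> in the denominator, which occurs if the product character is trivial, is compatible
  with the lifting because a character and its lift are trivial at the same time.
\<close>
theorem hasse_davenport_jacobi:
  fixes \<eta> :: "nat \<Rightarrow> 'a::finite_field \<Rightarrow> qbar"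
  assumes r: "r \<ge> 1" and \<psi>: "nontriv_add_char (UNIV :: 'a set) \<psi>"
    and \<eta>: "\<And>i. i \<in> {1..k} \<Longrightarrow> \<eta> i \<in> mult_chars UNIV" and j: "j \<in> {1..k}" "\<eta> j \<noteq> triv_char UNIV"
  shows "jacobi_sum (ext_field r) k (\<lambda>i. lift_char r (\<eta> i)) = jacobi_sum UNIV k \<eta> ^ r"
proof -
  interpret U: gauss_field "UNIV :: 'a set" \<psi>
    using finite_subfield_UNIV \<psi> by (auto simp: gauss_field_def gauss_field_axioms_def)
  interpret K: gauss_field "ext_field r :: 'a alg_closure set" "lift_add_char r \<psi>"
    using finite_subfield_ext_field[OF r] lift_add_char_nontriv[OF r \<psi>]
    by (auto simp: gauss_field_def gauss_field_axioms_def)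
  define P where "P = (\<lambda>x. \<Prod>i=1..k. \<eta> i x)"
  have P: "P \<in> mult_chars UNIV" unfolding P_def by (intro U.char_prod_in) (use \<eta> j in auto)
  have lift_P: "(\<lambda>x. \<Prod>i=1..k. lift_char r (\<eta> i) x) = lift_char r P"
    using j(1) by (auto simp: lift_char_def P_def fun_eq_iff power_0_left)
  have circ: "gauss_sum_circ (ext_field r) (lift_add_char r \<psi>) (lift_char r P) = gauss_sum_circ UNIV \<psi> P ^ r"
    unfolding gauss_sum_circ_def char_delta_def hasse_davenport[OF P \<psi> r] lift_char_eq_triv_iff[OF r P]
    by (simp add: card_ext_field[OF r] power_mult_distrib)
  have "jacobi_sum (ext_field r) k (\<lambda>i. lift_char r (\<eta> i)) =
      (\<Prod>i=1..k. gauss_sum (ext_field r) (lift_add_char r \<psi>) (lift_char r (\<eta> i))) /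
      gauss_sum_circ (ext_field r) (lift_add_char r \<psi>) (lift_char r P)"
    unfolding lift_P[symmetric]
    by (rule K.jacobi_eq_gauss[of _ _ j]) (use \<eta> j r in \<open>auto simp: lift_char_in lift_char_eq_triv_iff\<close>)
  also have "\<dots> = (\<Prod>i=1..k. gauss_sum UNIV \<psi> (\<eta> i) ^ r) / gauss_sum_circ UNIV \<psi> P ^ r"
    unfolding circ using \<eta> by (intro arg_cong2[of _ _ _ _ "(/)"] prod.cong refl hasse_davenport \<psi> r)
  also have "\<dots> = jacobi_sum UNIV k \<eta> ^ r"
    using U.jacobi_eq_gauss[of k \<eta> j] \<eta> j by (simp add: P_def prod_power_distrib power_divide)
  finally show ?thesis .
qed

section \<open>Exponential generating series\<close>

lemma exp_series_cong: "(\<And>r. r \<ge> 1 \<Longrightarrow> c r = c' r) \<Longrightarrow> exp_series c = exp_series c'"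
  unfolding exp_series_def by (intro arg_cong2[of _ _ _ _ fps_compose] refl fps_ext) auto

lemma exp_series_nth_0 [simp]: "exp_series c $ 0 = 1"
  by (simp add: exp_series_def)

lemma fps_deriv_exp_series: "fps_deriv (exp_series c) = exp_series c * Abs_fps (\<lambda>r. c (Suc r))"
proof -
  have "fps_deriv (Abs_fps (\<lambda>r. if r = 0 then 0 else c r / of_nat r)) = Abs_fps (\<lambda>r. c (Suc r))"
    by (rule fps_ext) (simp del: of_nat_Suc)
  thus ?thesis
    unfolding exp_series_def by (subst fps_compose_deriv) simp_all
qed

text \<open>The product of the two series has derivative zero and constant term \<open>1\<close>.\<close>
lemma exp_series_uminus: "exp_series (\<lambda>r. - c r) = inverse (exp_series c)"
proof -
  have neg: "Abs_fps (\<lambda>r. - c (Suc r)) = - Abs_fps (\<lambda>r. c (Suc r))"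
    by (rule fps_ext) simp
  have "fps_deriv (exp_series c * exp_series (\<lambda>r. - c r)) = 0"
    by (simp add: fps_deriv_exp_series neg)
  hence "exp_series c * exp_series (\<lambda>r. - c r) = fps_const ((exp_series c * exp_series (\<lambda>r. - c r)) $ 0)"
    by (simp only: fps_deriv_eq_0_iff)
  also have "\<dots> = 1" by (simp add: fps_mult_nth_0)
  finally show ?thesis by (metis fps_inverse_unique mult.commute)
qed

text \<open>
  Both sides have the logarithmic derivative \<open>\<Sum>r. Q ^ (r + 1) X ^ r\<close>.
\<close>
lemma exp_series_geometric: "exp_series (\<lambda>r. Q ^ r) = 1 / (1 - fps_const Q * fps_X)"
proof -
  let ?D = "Abs_fps (\<lambda>r. Q ^ Suc r)"
  have D: "(1 - fps_const Q * fps_X) * ?D = fps_const Q"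
  proof (rule fps_ext)
    fix n show "((1 - fps_const Q * fps_X) * ?D) $ n = fps_const Q $ n"
      by (cases n) (simp_all add: left_diff_distrib mult.assoc)
  qed
  have "fps_deriv ((1 - fps_const Q * fps_X) * exp_series (\<lambda>r. Q ^ r)) =
        (1 - fps_const Q * fps_X) * ?D * exp_series (\<lambda>r. Q ^ r) - fps_const Q * exp_series (\<lambda>r. Q ^ r)"
    by (simp add: fps_deriv_exp_series algebra_simps)
  also have "\<dots> = 0" unfolding D by simp
  finally have "(1 - fps_const Q * fps_X) * exp_series (\<lambda>r. Q ^ r) =
      fps_const (((1 - fps_const Q * fps_X) * exp_series (\<lambda>r. Q ^ r)) $ 0)"
    by (simp only: fps_deriv_eq_0_iff)
  also have "\<dots> = 1" by (simp add: fps_mult_nth_0)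
  finally have "exp_series (\<lambda>r. Q ^ r) = inverse (1 - fps_const Q * fps_X)"
    by (metis fps_inverse_unique mult.commute)
  also have "\<dots> = 1 / (1 - fps_const Q * fps_X)"
    by (subst fps_divide_unit) simp_all
  finally show ?thesis .
qed

section \<open>Powers of characters\<close>

lemma power_int_mod_exponent:
  fixes w :: "'b::field"
  assumes "w ^ d = 1" "d \<ge> 1"
  shows "w powi k = w ^ nat (k mod int d)"
proof -
  have nz: "w \<noteq> 0" using assms by (auto simp: power_0_left)
  have "w powi k = w powi (int d * (k div int d) + k mod int d)" by simp
  also have "\<dots> = w powi (k mod int d)"
    using nz by (subst power_int_add) (simp_all add: power_int_mult assms(1))
  also have "\<dots> = w ^ nat (k mod int d)"
    using assms(2) by (simp add: power_int_def)
  finally show ?thesis .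
qed

context finite_subfield
begin

lemma char_pow_add: "\<eta> \<in> mult_chars K \<Longrightarrow> char_pow K \<eta> (i + j) = char_mult (char_pow K \<eta> i) (char_pow K \<eta> j)"
  by (auto simp: char_pow_def char_mult_def fun_eq_iff power_int_add mult_char_nz)

lemma char_pow_sum:
  assumes "\<eta> \<in> mult_chars K" "finite I" "I \<noteq> {}"
  shows "char_pow K \<eta> (\<Sum>i\<in>I. k i) = (\<lambda>x. \<Prod>i\<in>I. char_pow K \<eta> (k i) x)"
  using assms(2,3)
proof (induction I rule: finite_ne_induct)
  case (insert i I)
  thus ?case using char_pow_add[OF assms(1)] by (simp add: char_mult_def)
qed simp

lemma char_pow_of_power:
  assumes "\<eta> \<in> mult_chars K" "x \<in> K" "k \<ge> 1"
  shows "char_pow K \<eta> m (x ^ k) = char_pow K \<eta> (m * int k) x"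
  using assms by (auto simp: char_pow_def mult_char_power power_int_mult power_int_power mult.commute)

lemma char_pow_inv: "char_pow K (char_inv \<eta>) k = char_inv (char_pow K \<eta> k)"
  by (auto simp: char_pow_def char_inv_def fun_eq_iff power_int_inverse)

lemma mult_char_prod:
  assumes "\<eta> \<in> mult_chars K" "\<And>i. i \<in> I \<Longrightarrow> f i \<in> K"
  shows "\<eta> (\<Prod>i\<in>I. f i) = (\<Prod>i\<in>I. \<eta> (f i))"
  using assms by (induction I rule: infinite_finite_induct) (simp_all add: mult_char_mult)

end

lemma lift_char_pow:
  assumes "r \<ge> 1"
  shows "lift_char r (char_pow UNIV \<eta> k) = char_pow (ext_field r) (lift_char r (\<eta> :: 'a::finite_field \<Rightarrow> qbar)) k"
  using assms by (auto simp: lift_char_def char_pow_def fun_eq_iff ext_norm_eq_0_iff)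

lemma char_d_ext_eq_lift: "char_d_ext \<phi> d r = lift_char r (char_d \<phi> d)"
  by (simp add: char_d_ext_def lift_char_def)

locale char_generator =
  fixes \<phi> :: "'a::finite_field \<Rightarrow> qbar" and d :: nat
  assumes gen: "is_char_generator \<phi>" and d_pos: "d \<ge> 1" and d_dvd: "d dvd CARD('a) - 1"
begin

sublocale U: finite_subfield "UNIV :: 'a set" by (rule finite_subfield_UNIV)

definition e :: nat where "e = (CARD('a) - 1) div d"

lemma de: "d * e = CARD('a) - 1"
  using d_dvd by (simp add: e_def)

lemma phi_in: "\<phi> \<in> mult_chars UNIV"
  using gen by (simp add: is_char_generator_def)

text \<open>A generator takes the value \<open>1\<close> only at \<open>1\<close>, because all characters together separate points.\<close>
lemma phi_eq_1: "x \<noteq> 0 \<Longrightarrow> \<phi> x = 1 \<Longrightarrow> x = 1"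
proof (rule ccontr)
  assume x: "x \<noteq> 0" "\<phi> x = 1" "x \<noteq> 1"
  then obtain \<eta> where \<eta>: "\<eta> \<in> mult_chars UNIV" "\<eta> x \<noteq> 1"
    using U.mult_chars_separate[of x] by auto
  then obtain k where "\<eta> = char_pow UNIV \<phi> k" using gen by (auto simp: is_char_generator_def)
  thus False using \<eta> x by (simp add: char_pow_def)
qed

lemma char_d_in: "char_d \<phi> d \<in> mult_chars UNIV"
  unfolding char_d_def using phi_in by (rule U.char_pow_in)

lemma char_d_eq: "x \<noteq> 0 \<Longrightarrow> char_d \<phi> d x = \<phi> (x ^ e)"
  using U.mult_char_power[OF phi_in, of x e] by (simp add: char_d_def char_pow_def e_def)

lemma power_e_in_mu: "(x :: 'a) \<noteq> 0 \<Longrightarrow> x ^ e \<in> mu d"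
  using U.power_N[of x] by (simp add: mu_def de mult.commute flip: power_mult)

lemma phi_mu_power_d: "z \<in> mu d \<Longrightarrow> \<phi> z ^ d = 1"
  using U.mult_char_power[OF phi_in, of z d] U.mult_char_one[OF phi_in] by (simp add: mu_def)

lemma phi_mu_dvd:
  assumes "z \<in> mu d" "int d dvd m"
  shows "\<phi> z powi m = 1"
  unfolding power_int_mod_exponent[OF phi_mu_power_d[OF assms(1)] d_pos] using assms(2) by simp

text \<open>
  The \<open>e\<close>-th power of a generator of the units has order exactly \<open>d\<close>, and \<open>\<phi>\<close> is injective.
\<close>
lemma mu_nontriv:
  assumes m: "\<not> int d dvd m"
  shows "U.gen ^ e \<in> mu d" "\<phi> (U.gen ^ e) powi m \<noteq> 1"
proof -
  have nz: "U.gen \<noteq> 0" using U.gen_in by simp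
  show mem: "U.gen ^ e \<in> mu d" using nz by (rule power_e_in_mu)
  show "\<phi> (U.gen ^ e) powi m \<noteq> 1"
  proof
    define k where "k = nat (m mod int d)"
    assume "\<phi> (U.gen ^ e) powi m = 1"
    hence "\<phi> (U.gen ^ e) ^ k = 1"
      unfolding k_def power_int_mod_exponent[OF phi_mu_power_d[OF mem] d_pos] .
    hence "\<phi> ((U.gen ^ e) ^ k) = 1"
      using U.mult_char_power[OF phi_in] by simp
    hence "(U.gen ^ e) ^ k = 1" using nz by (intro phi_eq_1) auto
    hence "d * e dvd k * e"
      unfolding power_mult[symmetric] U.gen_power_eq_1_iff de by (simp add: mult.commute)
    moreover have "e \<noteq> 0" using de CARD_field_ge_2[where ?'a = 'a] by (intro notI) simp
    ultimately have "d dvd k" by simp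
    moreover have "k < d" using d_pos by (simp add: k_def nat_less_iff)
    ultimately have "k = 0" using nat_dvd_not_less by blast
    hence "m mod int d \<le> 0" by (simp add: k_def)
    with pos_mod_sign[of "int d" m] d_pos have "m mod int d = 0" by linarith
    thus False using m by auto
  qed
qed

lemma char_d_pow_nontriv:
  assumes "\<not> int d dvd k"
  shows "char_pow UNIV (char_d \<phi> d) k \<noteq> triv_char UNIV"
proof
  assume "char_pow UNIV (char_d \<phi> d) k = triv_char UNIV"
  from fun_cong[OF this, of U.gen] have "\<phi> (U.gen ^ e) powi k = 1"
    using U.gen_in by (simp add: char_pow_def triv_char_def char_d_eq)
  thus False using mu_nontriv[OF assms] by simp
qed

lemma of_nat_d_nz: "of_nat d \<noteq> (0 :: 'a alg_closure)"
proof
  assume "of_nat d = (0 :: 'a alg_closure)"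
  hence "of_nat (d * e) = (0 :: 'a alg_closure)" by simp
  moreover have "of_nat (Suc (d * e)) = (0 :: 'a alg_closure)"
    using of_nat_CARD_eq_0[where ?'a = 'a] CARD_field_ge_2[where ?'a = 'a] unfolding de by simp
  ultimately show False by (simp only: of_nat_Suc) simp
qed

lemma card_dth_roots:
  assumes "v \<noteq> 0"
  shows "card {y :: 'a alg_closure. y ^ d = v} = d"
proof -
  let ?p = "monom 1 d - [:v:]"
  have "degree ?p = d"
  proof -
    have "degree (monom 1 d + - [:v:]) = degree (monom 1 d :: 'a alg_closure poly)"
      by (rule degree_add_eq_left) (use d_pos in \<open>simp add: degree_monom_eq\<close>)
    thus ?thesis unfolding diff_conv_add_uminus by (simp add: degree_monom_eq)
  qed
  moreover have "card {y. poly ?p y = 0} = degree ?p"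
  proof (rule card_roots_separable)
    fix y assume "poly ?p y = 0"
    hence "y ^ d = v" by (simp add: poly_monom)
    hence "y \<noteq> 0" using assms d_pos by (auto simp: power_0_left)
    thus "poly (pderiv ?p) y \<noteq> 0"
      using of_nat_d_nz by (simp add: pderiv_diff pderiv_monom poly_monom)
  qed
  ultimately show ?thesis by (simp add: poly_monom)
qed

lemma card_mu: "card (mu d :: 'a set) = d"
proof -
  have "{y :: 'a alg_closure. y ^ d = 1} = to_ac ` mu d"
  proof (intro equalityI subsetI)
    fix y :: "'a alg_closure" assume "y \<in> {y. y ^ d = 1}"
    hence y: "y ^ d = 1" by simp
    have "y ^ CARD('a) = y ^ (d * e + 1)"
      using CARD_field_ge_2[where ?'a = 'a] unfolding de by simp
    also have "\<dots> = y" by (simp add: power_add power_mult y)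
    finally have "y \<in> range to_ac" unfolding ext_field_1[symmetric] in_ext_field_1_iff .
    thus "y \<in> to_ac ` mu d" using y by (auto simp: mu_def simp flip: to_ac_power)
  qed (auto simp: mu_def simp flip: to_ac_power)
  hence "card (to_ac ` (mu d :: 'a set)) = d" using card_dth_roots[of 1] by simp
  thus ?thesis by (subst (asm) card_image) (auto intro: inj_on_subset[OF inj_to_ac])
qed

lemma sum_mu: "(\<Sum>z\<in>mu d. \<phi> z powi m) = (if int d dvd m then of_nat d else 0)"
proof (cases "int d dvd m")
  case True
  thus ?thesis by (simp add: phi_mu_dvd card_mu)
next
  case False
  define t where "t = U.gen ^ e"
  have t: "t \<in> mu d" "\<phi> t powi m \<noteq> 1" using mu_nontriv[OF False] by (auto simp: t_def)
  have "t \<noteq> 0" using t(1) d_pos by (auto simp: mu_def power_0_left)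
  have "(\<Sum>z\<in>mu d. \<phi> z powi m) = (\<Sum>z\<in>mu d. \<phi> (t * z) powi m)"
    by (rule sum.reindex_bij_witness[of _ "\<lambda>z. t * z" "\<lambda>z. z / t"])
       (use t(1) \<open>t \<noteq> 0\<close> in \<open>auto simp: mu_def power_mult_distrib power_divide\<close>)
  also have "\<dots> = \<phi> t powi m * (\<Sum>z\<in>mu d. \<phi> z powi m)"
    unfolding sum_distrib_left using U.mult_char_mult[OF phi_in]
    by (intro sum.cong refl) (simp add: power_int_mult_distrib)
  finally show ?thesis using t(2) False by simp
qed

section \<open>Counting points\<close>

text \<open>
  If \<open>v \<noteq> 0\<close> then every \<open>d\<close>-th root \<open>y\<close> of \<open>v\<close> satisfies
  \<open>y ^ (q ^ r - 1) = N v ^ ((q - 1) / d)\<close>, so that all \<open>d\<close> of them are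
  counted for exactly one root of unity \<open>z\<close>.
\<close>
lemma twisted_fibre_sum:
  assumes r: "r \<ge> 1" and v: "v \<in> ext_field r"
  shows "(\<Sum>z\<in>mu d. \<phi> z powi m * of_nat (card {y. y ^ d = v \<and> y ^ (CARD('a) ^ r) = to_ac z * y})) =
         (if int d dvd m then of_nat d else of_nat d * char_pow (ext_field r) (char_d_ext \<phi> d r) m v)"
proof (cases "v = 0")
  case True
  have "{y :: 'a alg_closure. y ^ d = v \<and> y ^ (CARD('a) ^ r) = to_ac z * y} = {0}" for z
    using True d_pos by (auto simp: power_0_left)
  thus ?thesis using True by (simp add: sum_mu char_pow_def)
next
  case False
  define z0 where "z0 = ext_norm r v ^ e"
  have N_nz: "ext_norm r v \<noteq> 0" using False ext_norm_eq_0_iff[OF v r] by simp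
  have z0: "z0 \<in> mu d" unfolding z0_def using N_nz by (rule power_e_in_mu)
  have root: "y ^ (CARD('a) ^ r) = to_ac z0 * y" if "y ^ d = v" for y
  proof -
    let ?s = "\<Sum>i<r. CARD('a) ^ i"
    have "to_ac z0 = v ^ (?s * e)"
      by (simp add: z0_def to_ac_ext_norm[OF v] power_sum power_mult)
    also have "\<dots> = y ^ (?s * (d * e))"
      by (simp add: that[symmetric] mult_ac flip: power_mult)
    also have "?s * (d * e) = CARD('a) ^ r - 1"
      unfolding de by (rule sum_CARD_powers)
    finally have "to_ac z0 * y = y ^ Suc (CARD('a) ^ r - 1)" by (simp only: power_Suc2)
    also have "Suc (CARD('a) ^ r - 1) = CARD('a) ^ r"
      by (intro Suc_diff_1) (use CARD_field_ge_2[where ?'a = 'a] in simp)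
    finally show ?thesis ..
  qed
  have nz: "y \<noteq> 0" if "y ^ d = v" for y
    using that False d_pos by (auto simp: power_0_left)
  have "{y. y ^ d = v \<and> y ^ (CARD('a) ^ r) = to_ac z * y} = (if z = z0 then {y. y ^ d = v} else {})" for z
    using root nz by auto
  hence "(\<Sum>z\<in>mu d. \<phi> z powi m * of_nat (card {y. y ^ d = v \<and> y ^ (CARD('a) ^ r) = to_ac z * y})) =
      (\<Sum>z\<in>mu d. if z = z0 then \<phi> z powi m * of_nat d else 0)"
    using card_dth_roots[OF False] by (intro sum.cong) auto
  also have "\<dots> = \<phi> z0 powi m * of_nat d"
    using z0 by simp
  also have "\<dots> = (if int d dvd m then of_nat d else of_nat d * char_pow (ext_field r) (char_d_ext \<phi> d r) m v)"
    using phi_mu_dvd[OF z0] v False N_nz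
    by (simp add: char_pow_def char_d_ext_def char_d_eq z0_def)
  finally show ?thesis .
qed

text \<open>
  The curve is a cover of the line and the hypersurface one of affine \<open>n\<close>-space. Here \<open>G\<close> is the
  \<open>q ^ r\<close>-Frobenius of the base \<open>T\<close>, whose fixed points \<open>S\<close> carry the count.
\<close>
lemma twisted_count_cyclic_cover:
  fixes T :: "'x set" and f :: "'x \<Rightarrow> 'a alg_closure"
  assumes r: "r \<ge> 1" and V: "V = {(x, y). x \<in> T \<and> y ^ d = f x}"
    and F: "\<And>x y. x \<in> T \<Longrightarrow> (F ^^ r) (x, y) = (G x, y ^ (CARD('a) ^ r))"
    and S: "{x \<in> T. G x = x} = S" "finite S" and f: "\<And>x. x \<in> S \<Longrightarrow> f x \<in> ext_field r"
  shows "twisted_count V F (mu d) mu_act (mu_char \<phi> m) r =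
         (if int d dvd m then of_nat (card S)
          else \<Sum>x\<in>S. char_pow (ext_field r) (char_d_ext \<phi> d r) m (f x))"
proof -
  let ?Y = "\<lambda>z x. {y. y ^ d = f x \<and> y ^ (CARD('a) ^ r) = to_ac z * y}"
  have fin: "finite (?Y z x)" for z x
  proof (rule finite_subset)
    let ?p = "monom 1 d - [:f x:]"
    have "coeff ?p d = 1" using d_pos by (cases d) auto
    hence "?p \<noteq> 0" by (metis coeff_0 zero_neq_one)
    thus "finite {y. poly ?p y = 0}" by (rule poly_roots_finite)
  qed (auto simp: poly_monom)
  have "{P \<in> V. (F ^^ r) P = mu_act z P} = Sigma S (?Y z)" for z
    using F S(1) by (auto simp: V mu_act_def)
  hence card_eq: "card {P \<in> V. (F ^^ r) P = mu_act z P} = (\<Sum>x\<in>S. card (?Y z x))" for z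
    using S(2) fin by simp
  have "twisted_count V F (mu d) mu_act (mu_char \<phi> m) r =
        1 / of_nat d * (\<Sum>x\<in>S. \<Sum>z\<in>mu d. \<phi> z powi m * of_nat (card (?Y z x)))"
    unfolding twisted_count_def card_eq card_mu mu_char_def of_nat_sum sum_distrib_left[of "_ powi _"]
    by (subst sum.swap) (rule refl)
  also have "\<dots> = 1 / of_nat d * (\<Sum>x\<in>S. if int d dvd m then of_nat d
        else of_nat d * char_pow (ext_field r) (char_d_ext \<phi> d r) m (f x))"
    by (intro arg_cong2[of _ _ _ _ "(*)"] sum.cong refl twisted_fibre_sum r f)
  also have "\<dots> = (if int d dvd m then of_nat (card S)
          else \<Sum>x\<in>S. char_pow (ext_field r) (char_d_ext \<phi> d r) m (f x))"
    using d_pos by (simp add: sum_distrib_left)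
  finally show ?thesis .
qed

lemma frob_C_funpow: "(frob_C ^^ r) (x, y) = (x ^ (CARD('a) ^ r), y ^ (CARD('a) ^ r) :: 'a alg_closure)"
  by (induction r) (simp_all add: frob_C_def mult.commute flip: power_mult)

lemma frob_S_funpow:
  "x \<in> extensional {1..n} \<Longrightarrow>
   (frob_S n ^^ r) (x, y) = (\<lambda>i\<in>{1..n}. x i ^ (CARD('a) ^ r), y ^ (CARD('a) ^ r) :: 'a alg_closure)"
proof (induction r)
  case 0
  thus ?case by (simp add: extensional_restrict)
next
  case (Suc r)
  thus ?case by (auto simp: frob_S_def fun_eq_iff mult.commute simp flip: power_mult)
qed

lemma twisted_count_curve:
  assumes r: "r \<ge> 1"
  shows "twisted_count (curve_C n d a b c l) frob_C (mu d) mu_act (mu_char \<phi> m) r =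
    (if int d dvd m then of_nat (CARD('a)) ^ r
     else \<Sum>x\<in>ext_field r. char_pow (ext_field r) (char_d_ext \<phi> d r) m
       ((\<Prod>i=1..n. (1 - to_ac (l i) * x) ^ b i) * x ^ a * (1 - x) ^ c))"
proof -
  interpret K: finite_subfield "ext_field r :: 'a alg_closure set"
    using r by (rule finite_subfield_ext_field)
  have "twisted_count (curve_C n d a b c l) frob_C (mu d) mu_act (mu_char \<phi> m) r =
    (if int d dvd m then of_nat (card (ext_field r :: 'a alg_closure set))
     else \<Sum>x\<in>ext_field r. char_pow (ext_field r) (char_d_ext \<phi> d r) m
       ((\<Prod>i=1..n. (1 - to_ac (l i) * x) ^ b i) * x ^ a * (1 - x) ^ c))"
    by (rule twisted_count_cyclic_cover[where T = UNIV and G = "\<lambda>x. x ^ (CARD('a) ^ r)"])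
       (use r in \<open>auto simp: curve_C_def frob_C_funpow ext_field_def[symmetric] to_ac_in_ext_field\<close>)
  thus ?thesis by (simp add: card_ext_field[OF r])
qed

lemma twisted_count_hypersurface:
  assumes r: "r \<ge> 1"
  shows "twisted_count (hypersurface_S n d a b c l) (frob_S n) (mu d) mu_act (mu_char \<phi> m) r =
    (if int d dvd m then (of_nat (CARD('a)) ^ n) ^ r
     else \<Sum>x\<in>{1..n} \<rightarrow>\<^sub>E ext_field r. char_pow (ext_field r) (char_d_ext \<phi> d r) m
       ((1 - (\<Sum>i=1..n. to_ac (l i) * x i)) ^ a * (\<Prod>i=1..n. x i ^ b i) * (1 - (\<Sum>i=1..n. x i)) ^ c))"
proof -
  interpret K: finite_subfield "ext_field r :: 'a alg_closure set"
    using r by (rule finite_subfield_ext_field)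
  have fixed: "{x \<in> {1..n} \<rightarrow>\<^sub>E UNIV. (\<lambda>i\<in>{1..n}. x i ^ (CARD('a) ^ r)) = x} =
      ({1..n} \<rightarrow>\<^sub>E ext_field r :: (nat \<Rightarrow> 'a alg_closure) set)"
    by (auto simp: PiE_iff extensional_def fun_eq_iff ext_field_def)
  have "twisted_count (hypersurface_S n d a b c l) (frob_S n) (mu d) mu_act (mu_char \<phi> m) r =
    (if int d dvd m then of_nat (card ({1..n} \<rightarrow>\<^sub>E ext_field r :: (nat \<Rightarrow> 'a alg_closure) set))
     else \<Sum>x\<in>{1..n} \<rightarrow>\<^sub>E ext_field r. char_pow (ext_field r) (char_d_ext \<phi> d r) m
       ((1 - (\<Sum>i=1..n. to_ac (l i) * x i)) ^ a * (\<Prod>i=1..n. x i ^ b i) * (1 - (\<Sum>i=1..n. x i)) ^ c))"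
  proof (rule twisted_count_cyclic_cover[OF r _ _ fixed])
    show "(frob_S n ^^ r) (x, y) = (\<lambda>i\<in>{1..n}. x i ^ (CARD('a) ^ r), y ^ (CARD('a) ^ r))"
      if "x \<in> {1..n} \<rightarrow>\<^sub>E UNIV" for x and y :: "'a alg_closure"
      using that by (intro frob_S_funpow) (auto simp: PiE_iff)
    show "finite ({1..n} \<rightarrow>\<^sub>E ext_field r :: (nat \<Rightarrow> 'a alg_closure) set)"
      by (intro finite_PiE) auto
    fix x :: "nat \<Rightarrow> 'a alg_closure" assume "x \<in> {1..n} \<rightarrow>\<^sub>E ext_field r"
    hence "x i \<in> ext_field r" if "i \<in> {1..n}" for i using that by auto
    thus "(1 - (\<Sum>i=1..n. to_ac (l i) * x i)) ^ a * (\<Prod>i=1..n. x i ^ b i) * (1 - (\<Sum>i=1..n. x i)) ^ c \<in> ext_field r"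
      by (intro K.mult_in K.power_in K.diff_in K.sum_in K.prod_in K.one_in to_ac_in_ext_field)
  qed (auto simp: hypersurface_S_def)
  moreover have "card ({1..n} \<rightarrow>\<^sub>E ext_field r :: (nat \<Rightarrow> 'a alg_closure) set) = (CARD('a) ^ n) ^ r"
    by (simp add: card_PiE card_ext_field[OF r] mult.commute flip: power_mult)
  ultimately show ?thesis by simp
qed

end

section \<open>The L-functions\<close>

context char_generator
begin

text \<open>The \<open>k\<close>-th power of \<open>\<phi>\<^sub>d\<^sub>,\<^sub>r\<close>.\<close>
abbreviation theta :: "nat \<Rightarrow> int \<Rightarrow> 'a alg_closure \<Rightarrow> qbar" where
  "theta r k \<equiv> char_pow (ext_field r) (char_d_ext \<phi> d r) k"

lemma theta_eq_lift: "r \<ge> 1 \<Longrightarrow> theta r k = lift_char r (char_pow UNIV (char_d \<phi> d) k)"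
  by (simp add: char_d_ext_eq_lift lift_char_pow)

lemma theta_in: "r \<ge> 1 \<Longrightarrow> theta r k \<in> mult_chars (ext_field r)"
  unfolding theta_eq_lift by (intro lift_char_in U.char_pow_in char_d_in)

lemma theta_nontriv: "r \<ge> 1 \<Longrightarrow> \<not> int d dvd k \<Longrightarrow> theta r k \<noteq> triv_char (ext_field r)"
  unfolding theta_eq_lift using lift_char_eq_triv_iff U.char_pow_in[OF char_d_in] char_d_pow_nontriv by blast

lemma inverse_char_pow_inv: "inverse (char_pow K (char_inv \<eta>) k x) = char_pow K \<eta> k x"
  by (simp add: char_pow_def char_inv_def power_int_inverse)

lemma not_dvd_mult:
  assumes "\<not> int d dvd m" "coprime d k"
  shows "\<not> int d dvd m * int k"
  using assms by (simp add: coprime_dvd_mult_left_iff)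

text \<open>
  The additive character \<open>\<psi>\<close> of the extension enters the Lauricella function; the unrelated
  character \<open>\<psi>0\<close> of the base field only serves to apply the Hasse--Davenport relation. The two
  uses meet in the Jacobi sum over the extension, which does not involve an additive character.
\<close>
lemma twisted_count_curve_FD:
  assumes r: "r \<ge> 1" and \<psi>: "nontriv_add_char (ext_field r) \<psi>" and \<psi>0: "nontriv_add_char (UNIV :: 'a set) \<psi>0"
    and m: "\<not> int d dvd m" and n: "n \<ge> 1" and a: "a \<ge> 1" and c: "c \<ge> 1" "coprime d c"
    and b: "\<And>i. i \<in> {1..n} \<Longrightarrow> b i \<ge> 1" "\<And>i. i \<in> {1..n} \<Longrightarrow> coprime d (b i)"
    and l: "\<And>i. i \<in> {1..n} \<Longrightarrow> l i \<noteq> 0"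
  shows "twisted_count (curve_C n d a b c l) frob_C (mu d) mu_act (mu_char \<phi> m) r =
    - (jacobi_sum UNIV 2
         (\<lambda>i. if i = 1 then char_pow UNIV (char_d \<phi> d) (m * int a)
              else char_pow UNIV (char_d \<phi> d) (m * int c)) ^ r *
       lauricella_FD (ext_field r) \<psi> n (theta r (m * int a))
         (\<lambda>i. char_pow (ext_field r) (char_inv (char_d_ext \<phi> d r)) (m * int (b i)))
         (theta r (m * int (c + a))) (\<lambda>i. to_ac (l i)))"
proof -
  interpret K: gauss_field "ext_field r :: 'a alg_closure set" \<psi>
    using finite_subfield_ext_field[OF r] \<psi> by (auto simp: gauss_field_def gauss_field_axioms_def)
  let ?\<Phi> = "char_d_ext \<phi> d r"
  let ?\<alpha> = "theta r (m * int a)" and ?\<eta> = "theta r (m * int c)"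
  let ?\<beta> = "\<lambda>i. char_pow (ext_field r) (char_inv ?\<Phi>) (m * int (b i))"
  have \<Phi>: "?\<Phi> \<in> mult_chars (ext_field r)"
    unfolding char_d_ext_eq_lift by (intro lift_char_in r char_d_in)
  have \<eta>: "char_pow UNIV (char_d \<phi> d) (m * int c) \<noteq> triv_char UNIV"
    by (intro char_d_pow_nontriv not_dvd_mult m c)
  have "jacobi_sum UNIV 2 (\<lambda>i. if i = 1 then char_pow UNIV (char_d \<phi> d) (m * int a)
          else char_pow UNIV (char_d \<phi> d) (m * int c)) ^ r =
        jacobi_sum (ext_field r) 2 (\<lambda>i. lift_char r (if i = 1 then char_pow UNIV (char_d \<phi> d) (m * int a)
          else char_pow UNIV (char_d \<phi> d) (m * int c)))"
    by (rule hasse_davenport_jacobi[OF r \<psi>0, symmetric, of 2 _ 2]) (use \<eta> char_d_in in auto)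
  also have "\<dots> = jacobi_sum (ext_field r) 2 (\<lambda>i. if i = 1 then ?\<alpha> else ?\<eta>)"
    unfolding theta_eq_lift[OF r] by (intro arg_cong[of _ _ "jacobi_sum _ _"]) auto
  finally have J: "jacobi_sum UNIV 2 (\<lambda>i. if i = 1 then char_pow UNIV (char_d \<phi> d) (m * int a)
          else char_pow UNIV (char_d \<phi> d) (m * int c)) ^ r =
        jacobi_sum (ext_field r) 2 (\<lambda>i. if i = 1 then ?\<alpha> else ?\<eta>)" .
  have \<gamma>: "theta r (m * int (c + a)) = char_mult ?\<alpha> ?\<eta>"
    using K.char_pow_add[OF \<Phi>, of "m * int a" "m * int c"] by (simp add: algebra_simps)
  have \<beta>: "?\<beta> i \<in> mult_chars (ext_field r)" "?\<beta> i \<noteq> triv_char (ext_field r)" if "i \<in> {1..n}" for i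
    using \<Phi> theta_nontriv[OF r not_dvd_mult[OF m b(2)[OF that]]]
    by (auto simp: K.char_pow_inv K.char_inv_eq_triv_iff)
  have "jacobi_sum (ext_field r) 2 (\<lambda>i. if i = 1 then ?\<alpha> else ?\<eta>) *
      lauricella_FD (ext_field r) \<psi> n ?\<alpha> ?\<beta> (char_mult ?\<alpha> ?\<eta>) (\<lambda>i. to_ac (l i)) =
      - (\<Sum>x\<in>ext_field r - {0}. ?\<alpha> x * (\<Prod>i=1..n. inverse (?\<beta> i (1 - to_ac (l i) * x))) * ?\<eta> (1 - x))"
    by (rule K.FD_curve_integral)
       (use \<beta> n l to_ac_in_ext_field theta_in[OF r] theta_nontriv[OF r not_dvd_mult[OF m c(2)]] in auto)
  \<comment> \<open>As \<open>a \<ge> 1\<close>, the point \<open>x = 0\<close> is a zero of \<open>f\<close>, in accordance with \<open>\<alpha>(0) = 0\<close>.\<close>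
  also have "(\<Sum>x\<in>ext_field r - {0}. ?\<alpha> x * (\<Prod>i=1..n. inverse (?\<beta> i (1 - to_ac (l i) * x))) * ?\<eta> (1 - x)) =
      (\<Sum>x\<in>ext_field r. ?\<alpha> x * (\<Prod>i=1..n. theta r (m * int (b i)) (1 - to_ac (l i) * x)) * ?\<eta> (1 - x))"
    unfolding inverse_char_pow_inv by (rule sum.mono_neutral_left) (auto simp: char_pow_def)
  also have "\<dots> = (\<Sum>x\<in>ext_field r. theta r m
      ((\<Prod>i=1..n. (1 - to_ac (l i) * x) ^ b i) * x ^ a * (1 - x) ^ c))"
  proof (intro sum.cong refl)
    fix x :: "'a alg_closure" assume x: "x \<in> ext_field r"
    have lin: "1 - to_ac (l i) * x \<in> ext_field r" for i
      using x by (intro K.diff_in K.mult_in K.one_in to_ac_in_ext_field)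
    have "theta r m ((\<Prod>i=1..n. (1 - to_ac (l i) * x) ^ b i) * x ^ a * (1 - x) ^ c) =
          (\<Prod>i=1..n. theta r m ((1 - to_ac (l i) * x) ^ b i)) * theta r m (x ^ a) * theta r m ((1 - x) ^ c)"
      using x lin by (simp add: K.mult_char_mult[OF theta_in[OF r]] K.mult_char_prod[OF theta_in[OF r]])
    also have "\<dots> = (\<Prod>i=1..n. theta r (m * int (b i)) (1 - to_ac (l i) * x)) * ?\<alpha> x * ?\<eta> (1 - x)"
      using x lin a b(1) c(1) by (simp add: K.char_pow_of_power[OF \<Phi>])
    finally show "?\<alpha> x * (\<Prod>i=1..n. theta r (m * int (b i)) (1 - to_ac (l i) * x)) * ?\<eta> (1 - x) =
        theta r m ((\<Prod>i=1..n. (1 - to_ac (l i) * x) ^ b i) * x ^ a * (1 - x) ^ c)"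
      by (simp only: mult_ac)
  qed
  finally show ?thesis
    unfolding twisted_count_curve[OF r] J \<gamma> using m by simp
qed

lemma twisted_count_hypersurface_FD:
  assumes r: "r \<ge> 1" and \<psi>: "nontriv_add_char (ext_field r) \<psi>" and \<psi>0: "nontriv_add_char (UNIV :: 'a set) \<psi>0"
    and m: "\<not> int d dvd m" and n: "n \<ge> 1" and a: "a \<ge> 1" "coprime d a" and c: "c \<ge> 1" "coprime d c"
    and b: "\<And>i. i \<in> {1..n} \<Longrightarrow> b i \<ge> 1" and l: "\<And>i. i \<in> {1..n} \<Longrightarrow> l i \<noteq> 0"
  shows "twisted_count (hypersurface_S n d a b c l) (frob_S n) (mu d) mu_act (mu_char \<phi> m) r =
    (- 1) ^ n * (jacobi_sum UNIV (n + 1)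
         (\<lambda>i. if i \<le> n then char_pow UNIV (char_d \<phi> d) (m * int (b i))
              else char_pow UNIV (char_d \<phi> d) (m * int c)) ^ r *
       lauricella_FD (ext_field r) \<psi> n
         (char_pow (ext_field r) (char_inv (char_d_ext \<phi> d r)) (m * int a))
         (\<lambda>i. theta r (m * int (b i)))
         (theta r (m * int ((\<Sum>i=1..n. b i) + c))) (\<lambda>i. to_ac (l i)))"
proof -
  interpret K: gauss_field "ext_field r :: 'a alg_closure set" \<psi>
    using finite_subfield_ext_field[OF r] \<psi> by (auto simp: gauss_field_def gauss_field_axioms_def)
  let ?\<Phi> = "char_d_ext \<phi> d r"
  let ?\<alpha> = "char_pow (ext_field r) (char_inv ?\<Phi>) (m * int a)" and ?\<eta> = "theta r (m * int c)"
  let ?\<beta> = "\<lambda>i. theta r (m * int (b i))"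
  have \<Phi>: "?\<Phi> \<in> mult_chars (ext_field r)"
    unfolding char_d_ext_eq_lift by (intro lift_char_in r char_d_in)
  have \<eta>: "char_pow UNIV (char_d \<phi> d) (m * int c) \<noteq> triv_char UNIV"
    by (intro char_d_pow_nontriv not_dvd_mult m c)
  have "jacobi_sum UNIV (n + 1) (\<lambda>i. if i \<le> n then char_pow UNIV (char_d \<phi> d) (m * int (b i))
          else char_pow UNIV (char_d \<phi> d) (m * int c)) ^ r =
        jacobi_sum (ext_field r) (n + 1) (\<lambda>i. lift_char r (if i \<le> n
          then char_pow UNIV (char_d \<phi> d) (m * int (b i)) else char_pow UNIV (char_d \<phi> d) (m * int c)))"
    by (rule hasse_davenport_jacobi[OF r \<psi>0, symmetric, of "n + 1" _ "n + 1"]) (use \<eta> char_d_in in auto)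
  also have "\<dots> = jacobi_sum (ext_field r) (n + 1) (\<lambda>i. if i \<le> n then ?\<beta> i else ?\<eta>)"
    unfolding theta_eq_lift[OF r] by (intro arg_cong[of _ _ "jacobi_sum _ _"]) auto
  finally have J: "jacobi_sum UNIV (n + 1) (\<lambda>i. if i \<le> n then char_pow UNIV (char_d \<phi> d) (m * int (b i))
          else char_pow UNIV (char_d \<phi> d) (m * int c)) ^ r =
        jacobi_sum (ext_field r) (n + 1) (\<lambda>i. if i \<le> n then ?\<beta> i else ?\<eta>)" .
  have "m * int ((\<Sum>i=1..n. b i) + c) = (\<Sum>i=1..n. m * int (b i)) + m * int c"
    by (simp add: distrib_left sum_distrib_left)
  hence \<gamma>: "theta r (m * int ((\<Sum>i=1..n. b i) + c)) = (\<lambda>x. (\<Prod>i=1..n. ?\<beta> i x) * ?\<eta> x)"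
    using n by (simp add: K.char_pow_add[OF \<Phi>] K.char_pow_sum[OF \<Phi>] char_mult_def)
  have \<alpha>: "?\<alpha> \<in> mult_chars (ext_field r)" "?\<alpha> \<noteq> triv_char (ext_field r)"
    using \<Phi> theta_nontriv[OF r not_dvd_mult[OF m a(2)]]
    by (auto simp: K.char_pow_inv K.char_inv_eq_triv_iff)
  let ?I = "\<lambda>x. theta r (m * int a) (1 - (\<Sum>i=1..n. to_ac (l i) * x i)) *
      (\<Prod>i=1..n. ?\<beta> i (x i)) * ?\<eta> (1 - (\<Sum>i=1..n. x i))"
  have "jacobi_sum (ext_field r) (n + 1) (\<lambda>i. if i \<le> n then ?\<beta> i else ?\<eta>) *
      lauricella_FD (ext_field r) \<psi> n ?\<alpha> ?\<beta> (\<lambda>x. (\<Prod>i=1..n. ?\<beta> i x) * ?\<eta> x) (\<lambda>i. to_ac (l i)) =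
      (- 1) ^ n * (\<Sum>x\<in>{1..n} \<rightarrow>\<^sub>E ext_field r - {0}. ?I x)"
    by (rule K.FD_hypersurface_integral[where \<alpha> = ?\<alpha>, unfolded inverse_char_pow_inv])
       (use \<alpha> n l to_ac_in_ext_field theta_in[OF r] theta_nontriv[OF r not_dvd_mult[OF m c(2)]] in auto)
  \<comment> \<open>As \<open>b\<^sub>i \<ge> 1\<close>, the points on the coordinate hyperplanes are zeros of \<open>f\<close>.\<close>
  also have "(\<Sum>x\<in>{1..n} \<rightarrow>\<^sub>E ext_field r - {0}. ?I x) = (\<Sum>x\<in>{1..n} \<rightarrow>\<^sub>E ext_field r. ?I x)"
  proof (rule sum.mono_neutral_left)
    show "\<forall>x\<in>({1..n} \<rightarrow>\<^sub>E ext_field r) - ({1..n} \<rightarrow>\<^sub>E ext_field r - {0}). ?I x = 0"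
    proof
      fix x :: "nat \<Rightarrow> 'a alg_closure"
      assume "x \<in> ({1..n} \<rightarrow>\<^sub>E ext_field r) - ({1..n} \<rightarrow>\<^sub>E ext_field r - {0})"
      then obtain i where i: "i \<in> {1..n}" "x i = 0" by (auto simp: PiE_iff)
      hence "(\<Prod>i=1..n. ?\<beta> i (x i)) = 0"
        by (intro prod_zero) (auto simp: char_pow_def intro!: bexI[of _ i])
      thus "?I x = 0" by simp
    qed
  qed (auto intro!: finite_PiE PiE_mono)
  also have "\<dots> = (\<Sum>x\<in>{1..n} \<rightarrow>\<^sub>E ext_field r. theta r m
      ((1 - (\<Sum>i=1..n. to_ac (l i) * x i)) ^ a * (\<Prod>i=1..n. x i ^ b i) * (1 - (\<Sum>i=1..n. x i)) ^ c))"
  proof (intro sum.cong refl)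
    fix x :: "nat \<Rightarrow> 'a alg_closure" assume "x \<in> {1..n} \<rightarrow>\<^sub>E ext_field r"
    hence x: "x i \<in> ext_field r" if "i \<in> {1..n}" for i using that by auto
    have s: "1 - (\<Sum>i=1..n. x i) \<in> ext_field r" "1 - (\<Sum>i=1..n. to_ac (l i) * x i) \<in> ext_field r"
      using x by (intro K.diff_in K.sum_in K.mult_in K.one_in to_ac_in_ext_field; assumption)+
    have p: "(\<Prod>i=1..n. x i ^ b i) \<in> ext_field r"
      using x by (intro K.prod_in K.power_in)
    have "theta r m ((1 - (\<Sum>i=1..n. to_ac (l i) * x i)) ^ a * (\<Prod>i=1..n. x i ^ b i) * (1 - (\<Sum>i=1..n. x i)) ^ c) =
          theta r m ((1 - (\<Sum>i=1..n. to_ac (l i) * x i)) ^ a) * theta r m (\<Prod>i=1..n. x i ^ b i) *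
          theta r m ((1 - (\<Sum>i=1..n. x i)) ^ c)"
      using s p by (simp only: K.mult_char_mult[OF theta_in[OF r]] K.power_in K.mult_in)
    also have "theta r m (\<Prod>i=1..n. x i ^ b i) = (\<Prod>i=1..n. theta r m (x i ^ b i))"
      using x by (intro K.mult_char_prod[OF theta_in[OF r]] K.power_in)
    also have "(\<Prod>i=1..n. theta r m (x i ^ b i)) = (\<Prod>i=1..n. ?\<beta> i (x i))"
      using x b by (intro prod.cong refl K.char_pow_of_power[OF \<Phi>])
    finally show "?I x = theta r m ((1 - (\<Sum>i=1..n. to_ac (l i) * x i)) ^ a * (\<Prod>i=1..n. x i ^ b i) *
        (1 - (\<Sum>i=1..n. x i)) ^ c)"
      using s a c by (simp only: K.char_pow_of_power[OF \<Phi>])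
  qed
  finally have *: "jacobi_sum (ext_field r) (n + 1) (\<lambda>i. if i \<le> n then ?\<beta> i else ?\<eta>) *
      lauricella_FD (ext_field r) \<psi> n ?\<alpha> ?\<beta> (\<lambda>x. (\<Prod>i=1..n. ?\<beta> i x) * ?\<eta> x) (\<lambda>i. to_ac (l i)) =
      (- 1) ^ n * (\<Sum>x\<in>{1..n} \<rightarrow>\<^sub>E ext_field r. theta r m
      ((1 - (\<Sum>i=1..n. to_ac (l i) * x i)) ^ a * (\<Prod>i=1..n. x i ^ b i) * (1 - (\<Sum>i=1..n. x i)) ^ c))" .
  show ?thesis
    unfolding twisted_count_hypersurface[OF r] J \<gamma> * using m by (simp flip: mult.assoc power_add)
qed

end

lemma nontriv_add_char_to_ac:
  assumes "nontriv_add_char (ext_field 1) \<psi>"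
  shows "nontriv_add_char (UNIV :: 'a::finite_field set) (\<psi> \<circ> to_ac)"
  using assms unfolding ext_field_1 by (auto simp: nontriv_add_char_def)

theorem corollary4p5:
  fixes \<phi> :: "'a::finite_field \<Rightarrow> qbar"
    and \<psi> :: "nat \<Rightarrow> 'a alg_closure \<Rightarrow> qbar"
    and n d a c :: nat and b :: "nat \<Rightarrow> nat" and l :: "nat \<Rightarrow> 'a" and m :: int
  assumes \<phi>: "is_char_generator \<phi>"
    and \<psi>: "\<And>r. r \<ge> 1 \<Longrightarrow> nontriv_add_char (ext_field r) (\<psi> r)"
    and pos: "n \<ge> 1" "d \<ge> 1" "a \<ge> 1" "c \<ge> 1" "\<And>i. i \<in> {1..n} \<Longrightarrow> b i \<ge> 1"
    and d_dvd: "d dvd CARD('a) - 1"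
    and l_nz: "\<And>i. i \<in> {1..n} \<Longrightarrow> l i \<noteq> 0"
  shows
    "(inj_on l {1..n} \<and> (\<forall>i\<in>{1..n}. l i \<noteq> 1) \<and>
     coprime d c \<and> (\<forall>i\<in>{1..n}. coprime d (b i)) \<longrightarrow>
       L_fun (curve_C n d a b c l) frob_C (mu d) mu_act (mu_char \<phi> m) =
         (if int d dvd m then 1 / (1 - fps_const (of_nat CARD('a)) * fps_X)
          else inverse (exp_series (\<lambda>r.
            jacobi_sum UNIV 2
              (\<lambda>i. if i = 1 then char_pow UNIV (char_d \<phi> d) (m * int a)
                   else char_pow UNIV (char_d \<phi> d) (m * int c)) ^ r *
            lauricella_FD (ext_field r) (\<psi> r) n
              (char_pow (ext_field r) (char_d_ext \<phi> d r) (m * int a))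
              (\<lambda>i. char_pow (ext_field r) (char_inv (char_d_ext \<phi> d r)) (m * int (b i)))
              (char_pow (ext_field r) (char_d_ext \<phi> d r) (m * int (c + a)))
              (\<lambda>i. to_ac (l i))))))
     \<and>
     (coprime d a \<and> coprime d c \<longrightarrow>
       L_fun (hypersurface_S n d a b c l) (frob_S n) (mu d) mu_act (mu_char \<phi> m) =
         (if int d dvd m then 1 / (1 - fps_const (of_nat CARD('a) ^ n) * fps_X)
          else exp_series (\<lambda>r.
            jacobi_sum UNIV (n + 1)
              (\<lambda>i. if i \<le> n then char_pow UNIV (char_d \<phi> d) (m * int (b i))
                   else char_pow UNIV (char_d \<phi> d) (m * int c)) ^ r *
            lauricella_FD (ext_field r) (\<psi> r) n
              (char_pow (ext_field r) (char_inv (char_d_ext \<phi> d r)) (m * int a))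
              (\<lambda>i. char_pow (ext_field r) (char_d_ext \<phi> d r) (m * int (b i)))
              (char_pow (ext_field r) (char_d_ext \<phi> d r) (m * int ((\<Sum>i=1..n. b i) + c)))
              (\<lambda>i. to_ac (l i)))
            powi ((-1) ^ n)))"
proof -
  interpret char_generator \<phi> d
    using \<phi> pos d_dvd by unfold_locales
  note \<psi>0 = nontriv_add_char_to_ac[OF \<psi>[of 1, OF order_refl]]
  show ?thesis
  proof (intro conjI impI, goal_cases)
    case 1
    show ?case
    proof (cases "int d dvd m")
      case True
      have "L_fun (curve_C n d a b c l) frob_C (mu d) mu_act (mu_char \<phi> m) =
            exp_series (\<lambda>r. of_nat (CARD('a)) ^ r)"
        unfolding L_fun_def using True by (intro exp_series_cong) (simp only: twisted_count_curve if_True)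
      thus ?thesis using True by (simp add: exp_series_geometric)
    next
      case False
      show ?thesis
        unfolding L_fun_def if_not_P[OF False] exp_series_uminus[symmetric]
        by (intro exp_series_cong twisted_count_curve_FD[OF _ \<psi> \<psi>0 False]) (use 1 pos l_nz in auto)
    qed
  next
    case 2
    show ?case
    proof (cases "int d dvd m")
      case True
      have "L_fun (hypersurface_S n d a b c l) (frob_S n) (mu d) mu_act (mu_char \<phi> m) =
            exp_series (\<lambda>r. (of_nat (CARD('a)) ^ n) ^ r)"
        unfolding L_fun_def using True by (intro exp_series_cong) (simp only: twisted_count_hypersurface if_True)
      thus ?thesis using True by (simp add: exp_series_geometric)
    next
      case False
      have sign: "exp_series (\<lambda>r. (- 1) ^ n * h r) = exp_series h powi ((- 1) ^ n)" for h
        using exp_series_uminus[of h] by (cases "even n") (simp_all add: power_int_minus)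
      show ?thesis
        unfolding L_fun_def if_not_P[OF False] sign[symmetric]
        by (intro exp_series_cong twisted_count_hypersurface_FD[OF _ \<psi> \<psi>0 False]) (use 2 pos l_nz in auto)
    qed
  qed
qed

end
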